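(* Let $(\mathcal{F},\tau)$ be a bornological locally convex Hausdorff space of $\mathbb{K}$-valued continuous functions on a non-empty topological Hausdorff space $\Omega$, and let $\mathcal{B}$ be the family of $\tau$-bounded sets. Consider: (a) $(\mathcal{F},\tau)$ admits a continuous strong complete barrelled linearisation. (b) There is a locally convex Hausdorff topology $\widetilde{\tau}$ on $\mathcal{F}$ with $\tau_{\mathrm{p}}\leq\widetilde{\tau}$ such that $(\mathcal{F},\tau)$ satisfies (BBC) and (CNC) for $\widetilde{\tau}$, and every $B\in\mathcal{B}$ is equicontinuous (as a family of functions on $\Omega$). (c) There is a locally convex Hausdorff topology $\widetilde{\tau}$ on $\mathcal{F}$ such that $(\mathcal{F},\tau)$ satisfies (BBC) and (CNC) for $\widetilde{\tau}$ and $\Delta\colon\Omega\to(\mathcal{F}_{\mathcal{B},\widetilde{\tau}}',\beta)$, $\Delta(x)=\delta_x$, is a well-defined continuous map. (d) There is a locally convex Hausdorff topology $\widetilde{\tau}$ on $\mathcal{F}$ with $\tau_{\mathrm{co}}\leq\widetilde{\tau}$ such that $(\mathcal{F},\tau)$ satisfies (BBC) and (CNC) for $\widetilde{\tau}$. Then (a), (b), (c) are equivalent. If $\Omega$ is a $gk_{\mathbb{R}}$-space, then (d) implies (c).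
   Context: $\mathbb{K}\in\{\mathbb{R},\mathbb{C}\}$. For an lcH space $Y$, $Y'$ is its dual and $Y_b'$ its strong dual. $\delta_x(f)=f(x)$; $\tau_{\mathrm{p}}$ is the topology of pointwise convergence and $\tau_{\mathrm{co}}$ the compact-open topology (uniform convergence on compact subsets of $\Omega$), restricted to $\mathcal{F}$. A linearisation of $\mathcal{F}$ is a triple $(\delta,Y,T)$ of an lcH space $Y$ over $\mathbb{K}$, a map $\delta\colon\Omega\to Y$ and an algebraic isomorphism $T\colon\mathcal{F}\to Y'$ with $T(f)\circ\delta=f$ for all $f$. It is strong if $T\colon(\mathcal{F},\tau)\to Y_b'$ is a topological isomorphism, complete barrelled if $Y$ is complete and barrelled, and continuous if $\delta$ is continuous. (BBC) for $\widetilde{\tau}$: every $\tau$-bounded set is contained in an absolutely convex $\tau$-bounded $\widetilde{\tau}$-compact set. (CNC) for $\widetilde{\tau}$: $\tau$ has a $0$-neighbourhood basis of absolutely convex $\widetilde{\tau}$-closed sets. $\mathcal{F}_{\mathcal{B},\widetilde{\tau}}'$ is the space of linear functionals on $\mathcal{F}$ whose restriction to each $\tau$-bounded set is $\widetilde{\tau}$-continuous, and $\beta$ is the topology on it of uniform convergence on $\tau$-bounded sets. A topological space $\Omega$ is a $gk_{\mathbb{R}}$-space if for every completely regular space $Z$, every map $f\colon\Omega\to Z$ whose restriction to each compact subset of $\Omega$ is continuous is continuous. *)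

theory Defs
  imports "HOL-Analysis.Analysis" "HOL-Library.Function_Algebras"
begin

(* Scalar field K: a type 'k :: real_normed_field (i.e. R or C).
   A vector space is a carrier set Y of a type 'y :: ab_group_add together with
   a scalar multiplication s :: 'k => 'y => 'y. *)

definition fscale :: "'k::times \<Rightarrow> ('b \<Rightarrow> 'k) \<Rightarrow> 'b \<Rightarrow> 'k" where
  "fscale c f = (\<lambda>x. c * f x)"

definition vs_on :: "('k::field \<Rightarrow> 'y::ab_group_add \<Rightarrow> 'y) \<Rightarrow> 'y set \<Rightarrow> bool" where
  "vs_on s Y \<longleftrightarrow> 0 \<in> Y \<and> (\<forall>x\<in>Y. \<forall>y\<in>Y. x + y \<in> Y) \<and> (\<forall>c. \<forall>x\<in>Y. s c x \<in> Y)
     \<and> (\<forall>a. \<forall>x\<in>Y. \<forall>y\<in>Y. s a (x + y) = s a x + s a y)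
     \<and> (\<forall>a b. \<forall>x\<in>Y. s (a + b) x = s a x + s b x)
     \<and> (\<forall>a b. \<forall>x\<in>Y. s a (s b x) = s (a * b) x)
     \<and> (\<forall>x\<in>Y. s 1 x = x)"

definition absconv :: "('k::real_normed_field \<Rightarrow> 'y::ab_group_add \<Rightarrow> 'y) \<Rightarrow> 'y set \<Rightarrow> bool" where
  "absconv s A \<longleftrightarrow> (\<forall>x\<in>A. \<forall>y\<in>A. \<forall>a b. norm a + norm b \<le> 1 \<longrightarrow> s a x + s b y \<in> A)"

definition absorbs :: "('k::real_normed_field \<Rightarrow> 'y::ab_group_add \<Rightarrow> 'y) \<Rightarrow> 'y set \<Rightarrow> 'y set \<Rightarrow> bool" where
  "absorbs s A B \<longleftrightarrow> (\<exists>t>0. \<forall>c. norm c \<ge> t \<longrightarrow> B \<subseteq> s c ` A)"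

definition nbhd0 :: "'y::zero topology \<Rightarrow> 'y set \<Rightarrow> bool" where
  "nbhd0 T V \<longleftrightarrow> (\<exists>W. openin T W \<and> 0 \<in> W \<and> W \<subseteq> V)"

definition lcH_space :: "('k::real_normed_field \<Rightarrow> 'y::ab_group_add \<Rightarrow> 'y) \<Rightarrow> 'y set \<Rightarrow> 'y topology \<Rightarrow> bool" where
  "lcH_space s Y T \<longleftrightarrow> vs_on s Y \<and> topspace T = Y \<and> Hausdorff_space T
     \<and> continuous_map (prod_topology T T) T (\<lambda>(x, y). x + y)
     \<and> continuous_map (prod_topology (euclidean :: 'k topology) T) T (\<lambda>(c, x). s c x)
     \<and> (\<forall>U. openin T U \<and> 0 \<in> U \<longrightarrow> (\<exists>V. absconv s V \<and> V \<subseteq> U \<and> nbhd0 T V))"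

definition tvs_bounded :: "('k::real_normed_field \<Rightarrow> 'y::ab_group_add \<Rightarrow> 'y) \<Rightarrow> 'y set \<Rightarrow> 'y topology \<Rightarrow> 'y set \<Rightarrow> bool" where
  "tvs_bounded s Y T B \<longleftrightarrow> B \<subseteq> Y \<and> (\<forall>U. openin T U \<and> 0 \<in> U \<longrightarrow> absorbs s U B)"

definition bornological :: "('k::real_normed_field \<Rightarrow> 'y::ab_group_add \<Rightarrow> 'y) \<Rightarrow> 'y set \<Rightarrow> 'y topology \<Rightarrow> bool" where
  "bornological s Y T \<longleftrightarrow> (\<forall>A. A \<subseteq> Y \<and> absconv s A \<and> (\<forall>B. tvs_bounded s Y T B \<longrightarrow> absorbs s A B)
      \<longrightarrow> nbhd0 T A)"

definition barrelled :: "('k::real_normed_field \<Rightarrow> 'y::ab_group_add \<Rightarrow> 'y) \<Rightarrow> 'y set \<Rightarrow> 'y topology \<Rightarrow> bool" where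
  "barrelled s Y T \<longleftrightarrow> (\<forall>A. A \<subseteq> Y \<and> absconv s A \<and> closedin T A \<and> (\<forall>y\<in>Y. absorbs s A {y})
      \<longrightarrow> nbhd0 T A)"

definition tvs_cauchy :: "'y::ab_group_add set \<Rightarrow> 'y topology \<Rightarrow> 'y filter \<Rightarrow> bool" where
  "tvs_cauchy Y T F \<longleftrightarrow> F \<noteq> bot \<and> eventually (\<lambda>x. x \<in> Y) F \<and>
     (\<forall>U. openin T U \<and> 0 \<in> U \<longrightarrow> eventually (\<lambda>p. fst p - snd p \<in> U) (F \<times>\<^sub>F F))"

definition tvs_complete :: "'y::ab_group_add set \<Rightarrow> 'y topology \<Rightarrow> bool" where
  "tvs_complete Y T \<longleftrightarrow> (\<forall>F. tvs_cauchy Y T F \<longrightarrow> (\<exists>l. limitin T id l F))"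

definition lin_functional :: "('k::real_normed_field \<Rightarrow> 'y::ab_group_add \<Rightarrow> 'y) \<Rightarrow> 'y set \<Rightarrow> ('y \<Rightarrow> 'k) \<Rightarrow> bool" where
  "lin_functional s Y \<phi> \<longleftrightarrow> (\<forall>x\<in>Y. \<forall>y\<in>Y. \<phi> (x + y) = \<phi> x + \<phi> y) \<and> (\<forall>c. \<forall>x\<in>Y. \<phi> (s c x) = c * \<phi> x)
      \<and> (\<forall>x. x \<notin> Y \<longrightarrow> \<phi> x = 0)"

definition tvs_dual :: "('k::real_normed_field \<Rightarrow> 'y::ab_group_add \<Rightarrow> 'y) \<Rightarrow> 'y set \<Rightarrow> 'y topology \<Rightarrow> ('y \<Rightarrow> 'k) set" where
  "tvs_dual s Y T = {\<phi>. lin_functional s Y \<phi> \<and> continuous_map T (euclidean :: 'k topology) \<phi>}"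

definition unif_top :: "('y \<Rightarrow> 'k::real_normed_vector) set \<Rightarrow> 'y set set \<Rightarrow> ('y \<Rightarrow> 'k) topology" where
  "unif_top S Bs = topology_generated_by
     {{\<psi>\<in>S. \<exists>d<e. \<forall>y\<in>B. norm (\<psi> y - \<phi> y) \<le> d} | \<phi> B e. \<phi> \<in> S \<and> B \<in> Bs \<and> e > 0}"

definition strong_dual :: "('k::real_normed_field \<Rightarrow> 'y::ab_group_add \<Rightarrow> 'y) \<Rightarrow> 'y set \<Rightarrow> 'y topology \<Rightarrow> ('y \<Rightarrow> 'k) topology" where
  "strong_dual s Y T = unif_top (tvs_dual s Y T) {B. tvs_bounded s Y T B}"

definition cscb_linearisation ::
  "'a topology \<Rightarrow> ('a \<Rightarrow> 'k::real_normed_field) set \<Rightarrow> ('a \<Rightarrow> 'k) topology \<Rightarrow>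
   ('k \<Rightarrow> 'y::ab_group_add \<Rightarrow> 'y) \<Rightarrow> 'y set \<Rightarrow> 'y topology \<Rightarrow> ('a \<Rightarrow> 'y) \<Rightarrow> (('a \<Rightarrow> 'k) \<Rightarrow> 'y \<Rightarrow> 'k) \<Rightarrow> bool" where
  "cscb_linearisation \<Omega> F \<tau> s Y TY \<delta> T \<longleftrightarrow>
     lcH_space s Y TY \<and> (\<forall>x\<in>topspace \<Omega>. \<delta> x \<in> Y)
     \<and> bij_betw T F (tvs_dual s Y TY)
     \<and> (\<forall>f\<in>F. \<forall>g\<in>F. T (f + g) = T f + T g) \<and> (\<forall>c. \<forall>f\<in>F. T (fscale c f) = fscale c (T f))
     \<and> (\<forall>f\<in>F. \<forall>x\<in>topspace \<Omega>. T f (\<delta> x) = f x)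
     \<and> homeomorphic_map \<tau> (strong_dual s Y TY) T
     \<and> tvs_complete Y TY \<and> barrelled s Y TY
     \<and> continuous_map \<Omega> TY \<delta>"

definition cont_function_space :: "'a topology \<Rightarrow> ('a \<Rightarrow> 'k::real_normed_field) set \<Rightarrow> bool" where
  "cont_function_space \<Omega> F \<longleftrightarrow> vs_on fscale F \<and>
     (\<forall>f\<in>F. continuous_map \<Omega> (euclidean :: 'k topology) f \<and> (\<forall>x. x \<notin> topspace \<Omega> \<longrightarrow> f x = 0))"

definition coarser :: "'a topology \<Rightarrow> 'a topology \<Rightarrow> bool" where
  "coarser T1 T2 \<longleftrightarrow> (\<forall>U. openin T1 U \<longrightarrow> openin T2 U)"

definition tau_p :: "'a topology \<Rightarrow> ('a \<Rightarrow> 'k::real_normed_field) set \<Rightarrow> ('a \<Rightarrow> 'k) topology" where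
  "tau_p \<Omega> F = topology_generated_by {{f\<in>F. f x \<in> U} | x U. x \<in> topspace \<Omega> \<and> open U}"

definition tau_co :: "'a topology \<Rightarrow> ('a \<Rightarrow> 'k::real_normed_field) set \<Rightarrow> ('a \<Rightarrow> 'k) topology" where
  "tau_co \<Omega> F = unif_top F {K. compactin \<Omega> K}"

definition BBC :: "('a \<Rightarrow> 'k::real_normed_field) set \<Rightarrow> ('a \<Rightarrow> 'k) topology \<Rightarrow> ('a \<Rightarrow> 'k) topology \<Rightarrow> bool" where
  "BBC F \<tau> \<tau>' \<longleftrightarrow> (\<forall>B. tvs_bounded fscale F \<tau> B \<longrightarrow>
      (\<exists>K. B \<subseteq> K \<and> absconv fscale K \<and> tvs_bounded fscale F \<tau> K \<and> compactin \<tau>' K))"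

definition CNC :: "('a \<Rightarrow> 'k::real_normed_field) set \<Rightarrow> ('a \<Rightarrow> 'k) topology \<Rightarrow> ('a \<Rightarrow> 'k) topology \<Rightarrow> bool" where
  "CNC F \<tau> \<tau>' \<longleftrightarrow> (\<forall>U. openin \<tau> U \<and> 0 \<in> U \<longrightarrow>
      (\<exists>V. V \<subseteq> U \<and> absconv fscale V \<and> closedin \<tau>' V \<and> nbhd0 \<tau> V))"

definition equicontinuous_on :: "'a topology \<Rightarrow> ('a \<Rightarrow> 'k::real_normed_field) set \<Rightarrow> bool" where
  "equicontinuous_on \<Omega> B \<longleftrightarrow> (\<forall>x\<in>topspace \<Omega>. \<forall>e>0. \<exists>U. openin \<Omega> U \<and> x \<in> U \<and>
      (\<forall>y\<in>U. \<forall>f\<in>B. norm (f y - f x) < e))"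

definition Fprime_B :: "('a \<Rightarrow> 'k::real_normed_field) set \<Rightarrow> ('a \<Rightarrow> 'k) topology \<Rightarrow> ('a \<Rightarrow> 'k) topology \<Rightarrow> (('a \<Rightarrow> 'k) \<Rightarrow> 'k) set" where
  "Fprime_B F \<tau> \<tau>' = {\<phi>. lin_functional fscale F \<phi> \<and>
      (\<forall>B. tvs_bounded fscale F \<tau> B \<longrightarrow> continuous_map (subtopology \<tau>' B) (euclidean :: 'k topology) \<phi>)}"

definition beta_top :: "('a \<Rightarrow> 'k::real_normed_field) set \<Rightarrow> ('a \<Rightarrow> 'k) topology \<Rightarrow> ('a \<Rightarrow> 'k) topology \<Rightarrow> (('a \<Rightarrow> 'k) \<Rightarrow> 'k) topology" where
  "beta_top F \<tau> \<tau>' = unif_top (Fprime_B F \<tau> \<tau>') {B. tvs_bounded fscale F \<tau> B}"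

definition evalf :: "('a \<Rightarrow> 'k::zero) set \<Rightarrow> 'a \<Rightarrow> ('a \<Rightarrow> 'k) \<Rightarrow> 'k" where
  "evalf F x = (\<lambda>f. if f \<in> F then f x else 0)"

(* gk_R-space, with the completely regular target spaces Z ranging over topologies on the type 'z *)
definition gkR_space :: "'a topology \<Rightarrow> 'z itself \<Rightarrow> bool" where
  "gkR_space \<Omega> _ \<longleftrightarrow> (\<forall>(Z::'z topology) f. completely_regular_space Z \<and> f \<in> topspace \<Omega> \<rightarrow> topspace Z \<and>
      (\<forall>K. compactin \<Omega> K \<longrightarrow> continuous_map (subtopology \<Omega> K) Z f) \<longrightarrow> continuous_map \<Omega> Z f)"

end

theory Submission
  imports Defs
begin

text \<open>A real normed field is isomorphic to \<open>\<real>\<close> or \<open>\<complex>\<close>: were the least norm \<open>m\<close> of the real monic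
  quadratics \<open>q = (x - a)\<^sup>2 + b\<^sup>2\<close> at \<open>x\<close> positive, factoring \<open>q^N - e^N\<close>, \<open>N = 2^k\<close>, into such
  quadratics would give \<open>\<parallel>q + e\<parallel> = m\<close> for \<open>0 < e < m\<close>, and iterating this is absurd. So closed balls of
  the field are compact and the Hahn--Banach theorem is available.

  From (c) to (a): take \<open>Y = F'\<close> with the topology \<open>\<beta>\<close>, \<open>\<delta> x\<close> the evaluation at \<open>x\<close> and \<open>T f\<close> the
  evaluation at \<open>f\<close>. (BBC) makes \<open>T\<close> surjective: a functional bounded on the polar of a compact
  absolutely convex \<open>K\<close> is interpolated on finitely many elements of \<open>Y\<close> by a point of \<open>K\<close>
  (minimise the squared distance), hence on all of them by compactness. \<open>T\<close> is continuous because
  \<open>\<tau>\<close> is bornological and open by (CNC) and Hahn--Banach. Uniform limits on bounded sets stay in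
  \<open>Y\<close>, so \<open>Y\<close> is complete. The polar in \<open>F\<close> of a barrel is \<open>\<tau>\<close>-bounded by Banach--Mackey, so the
  barrel, being its own bipolar, is a neighbourhood of \<open>0\<close>.

  From (a) to (b): pull the weak-star topology back along \<open>T\<close>; barrelledness turns bounded sets into
  equicontinuous ones, and Alaoglu gives (BBC). From (b) to (c), equicontinuity of the bounded sets is
  continuity of \<open>\<Delta>\<close>. From (d) to (c), bounded sets are equicontinuous on each compact set, and
  \<open>\<beta>\<close> is completely regular.\<close>

section \<open>Real normed fields\<close>

text \<open>The scalar type is only known to be a real normed field, so completeness, local
  compactness and a conjugation must be won from the field structure before any functional analysis
  can start. Exponents are powers of two because complex square roots then suffice for the
  factoring.

  The choice of \<open>Y\<close> can be read off from (a): a point y of a predual acts on F by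
  \<open>f \<mapsto> T f y\<close>, which is weak-star continuous, and bounded sets lie in weak-star
  compact ones. With \<tau>' in place of the weak-star topology this leads to functionals that are
  \<tau>'-continuous on bounded sets. Asking for continuity on bounded sets only, and not on all of
  F, keeps \<open>Y\<close> closed under uniform limits on bounded sets. This closure property gives
  completeness, and it also provides the sum of the series in the Banach-Mackey argument.

  (c) yields (b) only by way of (a): the topology in (c) is not assumed to be finer than
  \<open>tau_p\<close>, so the one found for (b) is a new one.\<close>

lemma real_quadratic_min_exists:
  fixes x :: "'k::real_normed_field"
  obtains a b :: real where
    "\<And>c d. norm ((x - of_real a)\<^sup>2 + of_real (b\<^sup>2)) \<le> norm ((x - of_real c)\<^sup>2 + of_real (d\<^sup>2))"
proof -
  define f where "f = (\<lambda>p::real\<times>real. norm ((x - of_real (fst p))\<^sup>2 + of_real ((snd p)\<^sup>2)))"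
  define N where "N = norm x + 1"
  have N1: "N \<ge> 1" by (simp add: N_def)
  \<comment> \<open>Outside this box the value is at least N^2, hence at least the value at (0,0),
    so the minimum over the box is global.\<close>
  define S where "S = {-(6*N)..6*N} \<times> {-(6*N)..(6*N)}"
  have "compact S" unfolding S_def by (intro compact_Times compact_Icc)
  moreover have "(0,0) \<in> S" using N1 by (simp add: S_def)
  moreover have "continuous_on S f" unfolding f_def by (intro continuous_intros)
  ultimately obtain p where p: "p \<in> S" "\<And>q. q \<in> S \<Longrightarrow> f p \<le> f q"
    using continuous_attains_inf[of S f] by blast
  have f0: "f (0,0) \<le> N\<^sup>2"
    unfolding f_def by (simp add: norm_power N_def power_mono)
  have "f p \<le> f (c,d)" for c d
  proof (cases "(c,d) \<in> S")
    case True then show ?thesis using p by blast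
  next
    case False
    have *: "N\<^sup>2 \<le> norm ((x - of_real c)\<^sup>2 + of_real (d\<^sup>2))"
    proof (rule ccontr)
      assume neg: "\<not> ?thesis"
      \<comment> \<open>\<open>c\<^sup>2 + d\<^sup>2\<close> differs from the quadratic by \<open>2 c x - x\<^sup>2\<close> only, so a small norm confines \<open>(c, d)\<close>\<close>
      have "c\<^sup>2 + d\<^sup>2 = norm (of_real (c\<^sup>2 + d\<^sup>2) :: 'k)" unfolding norm_of_real by (simp only: abs_of_nonneg sum_power2_ge_zero)
      also have "(of_real (c\<^sup>2 + d\<^sup>2) :: 'k) = ((x - of_real c)\<^sup>2 + of_real (d\<^sup>2)) + (of_real (2*c) * x - x\<^sup>2)"
        by (simp add: power2_eq_square algebra_simps)
      also have "norm \<dots> \<le> norm ((x - of_real c)\<^sup>2 + of_real (d\<^sup>2)) + (norm (of_real (2*c) * x) + norm (x\<^sup>2))"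
        by (rule order_trans[OF norm_triangle_ineq add_left_mono[OF norm_triangle_ineq4]])
      also have "\<dots> \<le> N\<^sup>2 + (2*\<bar>c\<bar>*N + N\<^sup>2)"
        using neg by (intro add_mono) (auto simp: norm_mult norm_power N_def intro!: mult_left_mono power_mono)
      finally have k: "c\<^sup>2 + d\<^sup>2 \<le> 2*N\<^sup>2 + 2*\<bar>c\<bar>*N" by simp
      have "(\<bar>c\<bar> - N)\<^sup>2 + d\<^sup>2 \<le> 3*N\<^sup>2" using k by (simp add: power2_eq_square algebra_simps)
      moreover have "(2*N)\<^sup>2 = 4 * N\<^sup>2" by simp
      ultimately have "(\<bar>c\<bar> - N)\<^sup>2 \<le> (2*N)\<^sup>2 \<and> d\<^sup>2 \<le> (2*N)\<^sup>2"
        using zero_le_power2[of d] zero_le_power2[of N] zero_le_power2[of "\<bar>c\<bar> - N"] by linarith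
      then have "\<bar>\<bar>c\<bar> - N\<bar> \<le> 2*N" "\<bar>d\<bar> \<le> 2*N"
        using N1 power2_le_iff_abs_le[of "2*N" "\<bar>c\<bar> - N"] power2_le_iff_abs_le[of "2*N" d] by simp_all
      then have "(c,d) \<in> S" using N1 by (auto simp: S_def abs_le_iff)
      then show False using False by blast
    qed
    have "f p \<le> f (0,0)" using p N1 by (simp add: S_def)
    also have "\<dots> \<le> N\<^sup>2" by (rule f0)
    also have "\<dots> \<le> f (c,d)" using * by (simp add: f_def)
    finally show ?thesis .
  qed
  then show ?thesis using that[of "fst p" "snd p"] by (simp add: f_def)
qed

text \<open>With N = 2^k the expression is formally \<open>(q^N - u) * (q^N - cnj u)\<close>, kept
  in real form because complex scalars need not act on \<open>'k\<close>. A square root v of u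
  splits it into the same expressions for v and -v with half the power of q, which is why u is
  arbitrary in the induction. For k = 0 the roots pair up into two real quadratics at x, each of
  norm at least m; the exponent of m counts these quadratics.\<close>

lemma norm_conjugate_pair_ge:
  fixes x :: "'k::real_normed_field" and u :: complex
  assumes min: "\<And>c d. m \<le> norm ((x - of_real c)\<^sup>2 + of_real (d\<^sup>2))" and "m \<ge> 0"
    and q: "q = (x - of_real a)\<^sup>2 + of_real (b\<^sup>2)"
  shows "m^(2 * 2^k) \<le> norm ((q^(2^k))\<^sup>2 - of_real (2 * Re u) * q^(2^k) + of_real ((norm u)\<^sup>2))"
proof (induction k arbitrary: u)
  case 0
  have id: "(X\<^sup>2 + B)\<^sup>2 - 2 * (s\<^sup>2 - i\<^sup>2 + B) * (X\<^sup>2 + B) + ((s\<^sup>2 - i\<^sup>2 + B)\<^sup>2 + (2 * s * i)\<^sup>2)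
      = ((X - s)\<^sup>2 + i\<^sup>2) * ((X + s)\<^sup>2 + i\<^sup>2)" for X B s i :: 'k
    by algebra
  define s where "s = csqrt (u - of_real (b\<^sup>2))"
  have s: "s * s = u - of_real (b\<^sup>2)" by (metis s_def power2_csqrt power2_eq_square)
  have r: "Re u = (Re s)\<^sup>2 - (Im s)\<^sup>2 + b\<^sup>2" "Im u = 2 * Re s * Im s"
    using arg_cong[OF s, of Re] arg_cong[OF s, of Im] by (auto simp: power2_eq_square mult.commute)
  have nu: "(norm u)\<^sup>2 = (Re u)\<^sup>2 + (Im u)\<^sup>2" by (simp add: cmod_power2)
  have shift: "x - of_real (a + Re s) = (x - of_real a) - of_real (Re s)"
    "x - of_real (a - Re s) = (x - of_real a) + of_real (Re s)" by simp_all
  have "q\<^sup>2 - of_real (2 * Re u) * q + of_real ((norm u)\<^sup>2)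
    = ((x - of_real (a + Re s))\<^sup>2 + of_real ((Im s)\<^sup>2)) * ((x - of_real (a - Re s))\<^sup>2 + of_real ((Im s)\<^sup>2))"
    unfolding q nu r shift unfolding of_real_add of_real_diff of_real_mult of_real_power of_real_numeral
    by (rule id)
  then have "norm (q\<^sup>2 - of_real (2 * Re u) * q + of_real ((norm u)\<^sup>2)) \<ge> m * m"
    using \<open>m \<ge> 0\<close> by (simp only: norm_mult) (intro mult_mono min norm_ge_zero)
  then show ?case by (simp add: power2_eq_square)
next
  case (Suc k)
  have id: "(X\<^sup>2)\<^sup>2 - 2 * (s\<^sup>2 - i\<^sup>2) * X\<^sup>2 + (s\<^sup>2 + i\<^sup>2)\<^sup>2
      = (X\<^sup>2 - 2 * s * X + (s\<^sup>2 + i\<^sup>2)) * (X\<^sup>2 + 2 * s * X + (s\<^sup>2 + i\<^sup>2))" for X s i :: 'k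
    by algebra
  define v where "v = csqrt u"
  have v: "u = v * v" by (metis v_def power2_csqrt power2_eq_square)
  have r: "Re u = (Re v)\<^sup>2 - (Im v)\<^sup>2" using v by (simp add: power2_eq_square)
  have nu: "(norm u)\<^sup>2 = ((norm v)\<^sup>2)\<^sup>2" by (simp add: v norm_mult power2_eq_square)
  have nv: "(norm v)\<^sup>2 = (Re v)\<^sup>2 + (Im v)\<^sup>2" by (simp add: cmod_power2)
  define X where "X = q^(2^k)"
  have X2: "q^(2^Suc k) = X\<^sup>2" unfolding X_def by (simp add: power_mult[symmetric] mult.commute)
  have neg: "X\<^sup>2 - of_real (2 * Re (-v)) * X = X\<^sup>2 + of_real (2 * Re v) * X" by simp
  have eq: "(X\<^sup>2)\<^sup>2 - of_real (2 * Re u) * X\<^sup>2 + of_real ((norm u)\<^sup>2)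
     = (X\<^sup>2 - of_real (2 * Re v) * X + of_real ((norm v)\<^sup>2)) * (X\<^sup>2 - of_real (2 * Re (-v)) * X + of_real ((norm (-v))\<^sup>2))"
    unfolding nu unfolding r norm_minus_cancel nv neg
    unfolding of_real_add of_real_diff of_real_mult of_real_power of_real_numeral
    by (rule id)
  have "m^(2 * 2^k) * m^(2 * 2^k) \<le> norm ((X\<^sup>2)\<^sup>2 - of_real (2 * Re u) * X\<^sup>2 + of_real ((norm u)\<^sup>2))"
    unfolding eq norm_mult unfolding X_def using \<open>m \<ge> 0\<close> by (intro mult_mono Suc.IH) auto
  then show ?case unfolding X2 by (simp add: power_add[symmetric] mult_2[symmetric] mult.commute)
qed

lemma satisfies_real_quadratic:
  fixes x :: "'k::real_normed_field"
  shows "\<exists>a b. (x - of_real a)\<^sup>2 + of_real (b\<^sup>2) = 0"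
proof -
  obtain a b where ab: "\<And>c d. norm ((x - of_real a)\<^sup>2 + of_real (b\<^sup>2)) \<le> norm ((x - of_real c)\<^sup>2 + of_real (d\<^sup>2))"
    by (rule real_quadratic_min_exists) blast
  define m where "m = norm ((x - of_real a)\<^sup>2 + of_real (b\<^sup>2))"
  have min: "\<And>c d. m \<le> norm ((x - of_real c)\<^sup>2 + of_real (d\<^sup>2))" using ab by (simp add: m_def)
  have "m = 0"
  proof (rule ccontr)
    assume "m \<noteq> 0"
    then have m: "m > 0" by (simp add: m_def)
    define e where "e = m / 2"
    have e: "0 < e" "e < m" using m by (auto simp: e_def)
    \<comment> \<open>from a minimiser \<open>b\<close> one may move on to \<open>\<surd>(b\<^sup>2 + e)\<close> without increasing the norm\<close>
    have step: "norm ((x - of_real a)\<^sup>2 + of_real (c\<^sup>2) + of_real e) = m"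
      if c: "norm ((x - of_real a)\<^sup>2 + of_real (c\<^sup>2)) = m" for c
    proof -
      define q where "q = (x - of_real a)\<^sup>2 + of_real (c\<^sup>2)"
      have nq: "norm q = m" using c by (simp add: q_def)
      \<comment> \<open>For the real number u = - e^N the conjugate pair collapses to the square of
        q^N + e^N.\<close>
      have ge: "m^N \<le> norm (q^N + of_real (e^N))" if "N = 2^k" for N k
      proof -
        have "m^(2 * 2^k) \<le> norm ((q^(2^k))\<^sup>2 - of_real (2 * Re (- of_real (e^N))) * q^(2^k)
                 + of_real ((norm (- of_real (e^N) :: complex))\<^sup>2))"
          by (rule norm_conjugate_pair_ge[OF min less_imp_le[OF m] q_def])
        also have "(q^(2^k))\<^sup>2 - of_real (2 * Re (- of_real (e^N))) * q^(2^k)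
                 + of_real ((norm (- of_real (e^N) :: complex))\<^sup>2) = (q^N + of_real (e^N))\<^sup>2"
          using e by (simp only: norm_minus_cancel norm_of_real) (simp add: that power2_eq_square algebra_simps)
        finally have "(m^N)\<^sup>2 \<le> (norm (q^N + of_real (e^N)))\<^sup>2"
          by (simp add: that norm_power power_mult[symmetric] mult.commute)
        then show ?thesis using power2_le_imp_le norm_ge_zero by blast
      qed
      have ge1: "m \<le> norm (q - of_real e)"
      proof -
        have "m^(2 * 2^0) \<le> norm ((q^(2^0))\<^sup>2 - of_real (2 * Re (of_real e)) * q^(2^0)
                 + of_real ((norm (of_real e :: complex))\<^sup>2))"
          by (rule norm_conjugate_pair_ge[OF min less_imp_le[OF m] q_def])
        also have "(q^(2^0))\<^sup>2 - of_real (2 * Re (of_real e)) * q^(2^0)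
                 + of_real ((norm (of_real e :: complex))\<^sup>2) = (q - of_real e)\<^sup>2"
          by (simp add: power2_eq_square algebra_simps)
        finally have "m\<^sup>2 \<le> (norm (q - of_real e))\<^sup>2"
          by (simp add: norm_power)
        then show ?thesis using power2_le_imp_le norm_ge_zero by blast
      qed
      \<comment> \<open>Repeated use of the difference of squares: the factor q - e has norm at
        least m and q^(2^i) + e^(2^i) has norm at least m^(2^i) for i = 1, ..., k, while q + e is
        kept. The exponents 1 + 2 + ... + 2^k add up to 2^(k+1) - 1.\<close>
      have prod: "norm (q + of_real e) * m^(2^Suc k - 1) \<le> norm (q^(2^Suc k) - of_real (e^(2^Suc k)))" for k
      proof (induction k)
        case 0
        have "norm (q + of_real e) * m \<le> norm (q + of_real e) * norm (q - of_real e)"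
          by (intro mult_left_mono ge1) auto
        also have "\<dots> = norm (q^2 - of_real (e^2))"
          by (simp add: norm_mult[symmetric] power2_eq_square algebra_simps)
        finally show ?case by simp
      next
        case (Suc k)
        define N :: nat where "N = 2^Suc k"
        have N: "2^Suc (Suc k) = 2 * N" "2 * N - 1 = (N - 1) + N" by (auto simp: N_def)
        have "norm (q + of_real e) * m^(2 * N - 1) = norm (q + of_real e) * m^(N - 1) * m^N"
          unfolding N(2) by (simp add: power_add)
        also have "\<dots> \<le> norm (q^N - of_real (e^N)) * norm (q^N + of_real (e^N))"
          using Suc m by (intro mult_mono ge[OF N_def]) (auto simp: N_def)
        also have "\<dots> = norm (q^(2*N) - of_real (e^(2*N)))"
          by (simp add: norm_mult[symmetric] power2_eq_square algebra_simps power_mult power_add mult_2)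
        finally show ?case unfolding N .
      qed
      \<comment> \<open>Divide by m^(N-1); the term e^N leaves m * (e/m)^N, and e/m = 1/2 makes it
        vanish in the limit.\<close>
      have bound: "norm (q + of_real e) \<le> m + m * (1/2)^k" for k
      proof -
        define N :: nat where "N = 2^Suc k"
        have N: "N = Suc (N - 1)" "k \<le> N" by (auto simp: N_def intro: less_imp_le[OF less_trans[OF less_exp]])
        have "norm (q + of_real e) * m^(N - 1) \<le> norm (q^N - of_real (e^N))"
          using prod by (simp add: N_def)
        also have "\<dots> \<le> norm (q^N) + norm (of_real (e^N) :: 'k)" by (rule norm_triangle_ineq4)
        also have "\<dots> = m^N + m^N * (1/2)^N"
          unfolding norm_of_real norm_power nq using m by (simp add: e_def power_divide)
        also have "\<dots> \<le> m^N + m^N * (1/2)^k"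
          using m N by (intro add_left_mono mult_left_mono power_decreasing) auto
        also have "\<dots> = (m + m * (1/2)^k) * m^(N - 1)"
          by (subst (1 2) N(1)) (simp only: power_Suc, simp add: algebra_simps)
        finally show ?thesis using m by simp
      qed
      have "(\<lambda>k. m + m * (1/2)^k) \<longlonglongrightarrow> m + m * 0"
        by (intro tendsto_intros LIMSEQ_power_zero) auto
      then have le: "norm (q + of_real e) \<le> m"
        using LIMSEQ_le_const bound by fastforce
      have "m \<le> norm ((x - of_real a)\<^sup>2 + of_real ((sqrt (c\<^sup>2 + e))\<^sup>2))" by (rule min)
      then have "m \<le> norm (q + of_real e)" using e by (simp add: q_def add.assoc)
      then show ?thesis using le by (simp add: q_def)
    qed
    have "norm ((x - of_real a)\<^sup>2 + of_real (b\<^sup>2) + of_real (real n * e)) = m" for n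
    proof (induction n)
      case 0 then show ?case by (simp add: m_def)
    next
      case (Suc n)
      define c where "c = sqrt (b\<^sup>2 + real n * e)"
      have c: "c\<^sup>2 = b\<^sup>2 + real n * e" using e by (simp add: c_def)
      show ?case using step[of c] Suc unfolding c by (simp add: algebra_simps)
    qed
    \<comment> \<open>All translates by n * e have norm m, so n * e is at most 2 * m; since e = m/2,
      the first n to violate this is 5.\<close>
    from this[of 5] have "norm ((of_real (5 * e) :: 'k)) \<le> m + m"
      using norm_triangle_ineq4[of "(x - of_real a)\<^sup>2 + of_real (b\<^sup>2) + of_real (real 5 * e)" "(x - of_real a)\<^sup>2 + of_real (b\<^sup>2)"]
      by (simp add: m_def)
    then show False using m by (simp add: e_def)
  qed
  then show ?thesis unfolding m_def by auto
qed

text \<open>An element whose quadratic has b \<noteq> 0 gives, after an affine change, a square root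
  j of -1, and j splits the quadratic of every other element into linear factors. If there is no
  such element, each quadratic is the square of x - a and every x is real.\<close>

lemma real_or_complex_field:
  "\<exists>j::'k::real_normed_field. (j = 0 \<or> j * j = -1) \<and> (\<forall>x. \<exists>a b. x = of_real a + of_real b * j)"
proof (cases "\<exists>x::'k. \<exists>a b. (x - of_real a)\<^sup>2 + of_real (b\<^sup>2) = 0 \<and> b \<noteq> 0")
  case True
  then obtain x :: 'k and a b where x: "(x - of_real a)\<^sup>2 + of_real (b\<^sup>2) = 0" "b \<noteq> 0" by blast
  define j where "j = (x - of_real a) / of_real b"
  have sq: "(x - of_real a)\<^sup>2 = - of_real (b\<^sup>2)" using x(1) by (simp add: add_eq_0_iff2)
  have jj: "j * j = -1"
    using x(2) sq by (simp add: j_def power2_eq_square[symmetric] power_divide)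
  have "\<exists>c d. y = of_real c + of_real d * j" for y :: 'k
  proof -
    obtain c d where "(y - of_real c)\<^sup>2 + of_real (d\<^sup>2) = 0" using satisfies_real_quadratic by blast
    moreover have "(y - of_real c - of_real d * j) * (y - of_real c + of_real d * j)
        = (y - of_real c)\<^sup>2 - of_real (d\<^sup>2) * (j * j)"
      by (simp add: power2_eq_square algebra_simps)
    ultimately have "(y - of_real c - of_real d * j) * (y - of_real c + of_real d * j) = 0"
      unfolding jj by simp
    then have "y - of_real c = of_real d * j \<or> y - of_real c = - (of_real d * j)"
      unfolding mult_eq_0_iff right_minus_eq add_eq_0_iff2 .
    then have "y = of_real c + of_real d * j \<or> y = of_real c + of_real (-d) * j"
      unfolding diff_eq_eq by (auto simp: add.commute)
    then show ?thesis by blast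
  qed
  then show ?thesis using jj by blast
next
  case False
  have "\<exists>c. y = of_real c" for y :: 'k
  proof -
    obtain c d where "(y - of_real c)\<^sup>2 + of_real (d\<^sup>2) = 0" using satisfies_real_quadratic by blast
    moreover from this have "d = 0" using False by blast
    ultimately show ?thesis by auto
  qed
  then show ?thesis by (intro exI[of _ 0]) auto
qed

text \<open>The imaginary unit of the scalar field, or \<open>0\<close> if the field is isomorphic to the reals.\<close>

definition kj :: "'k::real_normed_field" where
  "kj = (SOME j. (j = 0 \<or> j * j = -1) \<and> (\<forall>x. \<exists>a b. x = of_real a + of_real b * j))"

lemma kj: "kj = (0::'k::real_normed_field) \<or> kj * kj = (-1::'k)"
  and ex_coords: "\<exists>a b. x = of_real a + of_real b * (kj::'k)"
  using someI_ex[OF real_or_complex_field] unfolding kj_def by blast+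

section \<open>Real part, imaginary part and conjugation\<close>

definition kre :: "'k::real_normed_field \<Rightarrow> real" where
  "kre x = (SOME a. \<exists>b. x = of_real a + of_real b * kj)"

text \<open>If \<open>kj\<close> is 0, every coefficient fits; the value 0 is imposed to keep
  \<open>kim\<close> linear over the reals.\<close>

definition kim :: "'k::real_normed_field \<Rightarrow> real" where
  "kim x = (if kj = (0::'k) then 0 else (SOME b. x = of_real (kre x) + of_real b * kj))"

definition kcnj :: "'k::real_normed_field \<Rightarrow> 'k" where
  "kcnj x = of_real (kre x) - of_real (kim x) * kj"

lemma coords: "x = of_real (kre x) + of_real (kim x) * (kj::'k::real_normed_field)"
proof -
  have *: "\<exists>b. x = of_real (kre x) + of_real b * (kj::'k)"
    unfolding kre_def using ex_coords by (rule someI_ex)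
  then show ?thesis
    using someI_ex[OF *] by (auto simp: kim_def)
qed

lemma coords_unique:
  assumes "of_real a + of_real b * (kj::'k::real_normed_field) = of_real c + of_real d * kj"
  shows "a = c" "kj \<noteq> (0::'k) \<Longrightarrow> b = d"
proof -
  have "a = c \<and> (kj \<noteq> (0::'k) \<longrightarrow> b = d)"
  proof (cases "kj = (0::'k)")
    case True then show ?thesis using assms by simp
  next
    case False
    then have jj: "kj * kj = (-1::'k)" using kj by blast
    have "of_real (b - d) * (kj::'k) = of_real (c - a)" using assms by (simp add: algebra_simps)
    then have "(of_real (b - d) * kj) * (of_real (b - d) * (kj::'k)) = of_real (c - a) * of_real (c - a)" by simp
    then have "of_real (b - d) * of_real (b - d) * (kj * kj) = (of_real ((c - a)\<^sup>2) :: 'k)"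
      by (simp only: power2_eq_square of_real_mult mult_ac)
    then have "of_real (- ((b - d)\<^sup>2)) = (of_real ((c - a)\<^sup>2) :: 'k)"
      unfolding jj by (simp add: power2_eq_square)
    then have "- ((b - d)\<^sup>2) = (c - a)\<^sup>2" unfolding of_real_eq_iff .
    then have "(c - a)\<^sup>2 + (b - d)\<^sup>2 = 0" by linarith
    then have "c - a = 0 \<and> b - d = 0" using sum_power2_eq_zero_iff by blast
    then show ?thesis by simp
  qed
  then show "a = c" "kj \<noteq> (0::'k) \<Longrightarrow> b = d" by auto
qed

lemma kre_kim_eqI:
  assumes "x = of_real a + of_real b * (kj::'k::real_normed_field)" "kj = (0::'k) \<Longrightarrow> b = 0"
  shows "kre x = a" "kim x = b"
  using coords_unique[OF trans[OF coords[of x, symmetric] assms(1)]] assms(2)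
  by (auto simp: kim_def)

lemma kim_real: "kj = (0::'k) \<Longrightarrow> kim (x::'k::real_normed_field) = 0"
  by (simp add: kim_def)

lemma kre_add: "kre (x + y) = kre x + kre y" and kim_add: "kim (x + y) = kim x + kim (y::'k::real_normed_field)"
proof -
  have "x + y = of_real (kre x + kre y) + of_real (kim x + kim y) * kj"
    by (subst (1) coords[of x], subst (1) coords[of y]) (simp add: algebra_simps)
  then show "kre (x + y) = kre x + kre y" "kim (x + y) = kim x + kim y"
    by (rule kre_kim_eqI; simp add: kim_real)+
qed

lemma kre_scale: "kre (of_real t * x) = t * kre x"
  and kim_scale: "kim (of_real t * x) = t * kim (x::'k::real_normed_field)"
proof -
  have "of_real t * x = of_real (t * kre x) + of_real (t * kim x) * kj"
    by (subst (1) coords[of x]) (simp add: algebra_simps)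
  then show "kre (of_real t * x) = t * kre x" "kim (of_real t * x) = t * kim x"
    by (rule kre_kim_eqI; simp add: kim_real)+
qed

lemma kre_of_real [simp]: "kre (of_real t :: 'k::real_normed_field) = t"
  by (rule kre_kim_eqI[of _ _ 0]) auto

lemma kre_minus: "kre (- x) = - kre (x::'k::real_normed_field)"
  using kre_scale[of "-1" x] by simp

lemma kre_diff: "kre (x - y) = kre x - kre (y::'k::real_normed_field)"
  using kre_add[of x "- y"] by (simp add: kre_minus)

lemma kcnj_mult_self: "kcnj x * x = of_real ((kre x)\<^sup>2 + (kim (x::'k::real_normed_field))\<^sup>2)"
proof -
  have "kcnj x * x = (of_real (kre x) - of_real (kim x) * kj) * (of_real (kre x) + of_real (kim x) * kj)"
    using arg_cong[OF coords[of x], of "\<lambda>y. kcnj x * y"] unfolding kcnj_def .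
  also have "\<dots> = of_real ((kre x)\<^sup>2) - of_real ((kim x)\<^sup>2) * (kj * kj)"
    by (simp add: algebra_simps power2_eq_square)
  also have "\<dots> = of_real ((kre x)\<^sup>2 + (kim x)\<^sup>2)"
    using kj[where 'k='k] kim_real[of x] by auto
  finally show ?thesis .
qed

lemma norm_kj_le: "norm (kj::'k::real_normed_field) \<le> 1"
proof (cases "kj = (0::'k)")
  case False
  then have "kj * kj = (-1::'k)" using kj by blast
  then have "norm (kj::'k) * norm (kj::'k) = 1" by (metis norm_minus_cancel norm_mult norm_one)
  then show ?thesis by (metis abs_1 abs_norm_cancel abs_square_eq_1 order_refl power2_eq_square)
qed auto

lemma coords_power:
  "(kre (x ^ n))\<^sup>2 + (kim (x ^ n))\<^sup>2 = ((kre x)\<^sup>2 + (kim (x::'k::real_normed_field))\<^sup>2) ^ n"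
proof (induction n)
  case 0
  have "kre (1::'k) = 1" "kim (1::'k) = 0" by (rule kre_kim_eqI[of 1 1 0]; simp)+
  then show ?case by simp
next
  case (Suc n)
  define a b c d where "a = kre x" and "b = kim x" and "c = kre (x^n)" and "d = kim (x^n)"
  have x: "x = of_real a + of_real b * kj" "x^n = of_real c + of_real d * kj"
    unfolding a_def b_def c_def d_def by (rule coords)+
  have z: "kj = (0::'k) \<Longrightarrow> b = 0" "kj = (0::'k) \<Longrightarrow> d = 0" unfolding b_def d_def by (rule kim_real; simp)+
  have e: "of_real b * of_real d * (kj * kj) = - (of_real b * of_real d :: 'k)"
    using kj[where 'k='k] z by auto
  have "x^Suc n = of_real a * of_real c + of_real (a*d + b*c) * kj + of_real b * of_real d * (kj * kj)"
    unfolding power_Suc x(2) by (subst x(1)) (simp add: algebra_simps)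
  then have "x^Suc n = of_real (a*c - b*d) + of_real (a*d + b*c) * kj" unfolding e by simp
  then have ks: "kre (x^Suc n) = a*c - b*d" "kim (x^Suc n) = a*d + b*c"
    by (rule kre_kim_eqI; simp add: z)+
  have "(kre (x^Suc n))\<^sup>2 + (kim (x^Suc n))\<^sup>2 = (a\<^sup>2 + b\<^sup>2) * (c\<^sup>2 + d\<^sup>2)"
    unfolding ks by (simp add: power2_eq_square algebra_simps)
  then show ?case using Suc by (simp add: a_def b_def c_def d_def)
qed

text \<open>Two multiplicative norms, one dominated by a multiple of the other: compare powers.\<close>

lemma norm_le_coords: "(norm x)\<^sup>2 \<le> (kre x)\<^sup>2 + (kim (x::'k::real_normed_field))\<^sup>2"
proof (rule ccontr)
  assume neg: "\<not> ?thesis"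
  define r where "r = (kre x)\<^sup>2 + (kim x)\<^sup>2"
  have r: "0 \<le> r" "r < (norm x)\<^sup>2" using neg by (auto simp: r_def)
  have two: "(norm y)\<^sup>2 \<le> 2 * ((kre y)\<^sup>2 + (kim y)\<^sup>2)" for y :: 'k
  proof -
    have "norm y \<le> norm (of_real (kre y) :: 'k) + norm (of_real (kim y) * (kj::'k))"
      by (subst (1) coords[of y]) (rule norm_triangle_ineq)
    also have "\<dots> \<le> \<bar>kre y\<bar> + \<bar>kim y\<bar>"
      using norm_kj_le[where 'k='k] by (simp add: norm_mult mult_left_le)
    finally have "(norm y)\<^sup>2 \<le> (\<bar>kre y\<bar> + \<bar>kim y\<bar>)\<^sup>2" by (rule power_mono) simp
    also have "\<dots> \<le> 2 * ((kre y)\<^sup>2 + (kim y)\<^sup>2)"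
      using sum_squares_bound[of "\<bar>kre y\<bar>" "\<bar>kim y\<bar>"] by (simp add: power2_sum)
    finally show ?thesis .
  qed
  define t where "t = r / (norm x)\<^sup>2"
  have t: "0 \<le> t" "t < 1" using r by (auto simp: t_def divide_less_eq)
  have "1 \<le> 2 * t^n" for n
  proof -
    have "((norm x)\<^sup>2)^n = (norm (x^n))\<^sup>2" by (simp add: norm_power power_mult[symmetric] mult.commute)
    also have "\<dots> \<le> 2 * r^n" using two[of "x^n"] by (simp add: coords_power r_def)
    finally have "((norm x)\<^sup>2)^n \<le> 2 * r^n" .
    moreover have "0 < ((norm x)\<^sup>2)^n" using r by (intro zero_less_power[of "(norm x)\<^sup>2"]) linarith
    ultimately show ?thesis by (simp add: t_def power_divide)
  qed
  moreover have "(\<lambda>n. 2 * t^n) \<longlonglongrightarrow> 2 * 0" by (intro tendsto_intros LIMSEQ_power_zero) (use t in auto)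
  ultimately have "1 \<le> 2 * (0::real)" using LIMSEQ_le_const by blast
  then show False by simp
qed

text \<open>The upper bound holds for x and for its conjugate, and their product has norm exactly r,
  so neither bound can be strict.\<close>

lemma norm_coords: "(norm x)\<^sup>2 = (kre x)\<^sup>2 + (kim (x::'k::real_normed_field))\<^sup>2"
proof (cases "x = 0")
  case True
  then show ?thesis using kre_kim_eqI[of x 0 0] by simp
next
  case False
  define r where "r = (kre x)\<^sup>2 + (kim x)\<^sup>2"
  have "kcnj x = of_real (kre x) + of_real (- kim x) * kj" by (simp add: kcnj_def)
  then have c: "kre (kcnj x) = kre x" "kim (kcnj x) = - kim x"
    by (rule kre_kim_eqI; simp add: kim_real)+
  have r: "(norm x)\<^sup>2 \<le> r" "(norm (kcnj x))\<^sup>2 \<le> r"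
    using norm_le_coords[of x] norm_le_coords[of "kcnj x"] by (auto simp: r_def c)
  have "norm (kcnj x) * norm x = r"
    using arg_cong[OF kcnj_mult_self[of x], of norm]
    unfolding norm_mult norm_of_real r_def by (simp only: abs_of_nonneg sum_power2_ge_zero)
  then have "(norm (kcnj x))\<^sup>2 * (norm x)\<^sup>2 = r\<^sup>2"
    unfolding power_mult_distrib[symmetric] by simp
  moreover have "0 < (norm x)\<^sup>2" using False by simp
  ultimately have "r * r \<le> r * (norm x)\<^sup>2" using r by (metis mult_right_mono less_imp_le power2_eq_square)
  then show ?thesis using r \<open>0 < (norm x)\<^sup>2\<close> by (fold r_def) (simp add: mult_le_cancel_left)
qed

lemma kcnj_mult_norm: "kcnj x * x = of_real ((norm (x::'k::real_normed_field))\<^sup>2)"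
  unfolding norm_coords by (rule kcnj_mult_self)

lemma abs_kre_le: "\<bar>kre x\<bar> \<le> norm (x::'k::real_normed_field)"
  and abs_kim_le: "\<bar>kim x\<bar> \<le> norm (x::'k::real_normed_field)"
  by (rule power2_le_imp_le; simp add: norm_coords)+

lemma ex_unit_scalar:
  fixes x :: "'k::real_normed_field"
  obtains u :: 'k where "norm u = 1" "u * x = of_real (norm x)"
proof (cases "x = 0")
  case True then show ?thesis using that[of 1] by simp
next
  case False then show ?thesis using that[of "of_real (norm x) / x"] by (simp add: norm_divide)
qed

section \<open>Compactness, completeness and quadratic expansion in the scalar field\<close>

lemma compact_cball_field: "compact (cball 0 r :: 'k::real_normed_field set)"
proof -
  define g :: "real \<times> real \<Rightarrow> 'k" where "g = (\<lambda>p. of_real (fst p) + of_real (snd p) * kj)"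
  have "compact (g ` ({-r..r} \<times> {-r..r}))"
    by (intro compact_continuous_image compact_Times compact_Icc)
       (auto simp: g_def intro!: continuous_intros)
  then have "compact (cball 0 r \<inter> g ` ({-r..r} \<times> {-r..r}))"
    by (intro closed_Int_compact) auto
  moreover have "cball 0 r \<subseteq> g ` ({-r..r} \<times> {-r..r})"
  proof
    fix x :: 'k assume "x \<in> cball 0 r"
    then have "(kre x, kim x) \<in> {-r..r} \<times> {-r..r}"
      using abs_kre_le[of x] abs_kim_le[of x] by (auto simp: abs_le_iff)
    moreover have "x = g (kre x, kim x)" by (simp add: g_def coords[symmetric])
    ultimately show "x \<in> g ` ({-r..r} \<times> {-r..r})" by blast
  qed
  ultimately show ?thesis by (simp add: Int_absorb2)
qed

lemma complete_field: "complete (UNIV :: 'k::real_normed_field set)"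
  unfolding complete_def
proof (intro allI impI)
  fix f :: "nat \<Rightarrow> 'k" assume f: "(\<forall>n. f n \<in> UNIV) \<and> Cauchy f"
  then have "bounded (range f)" using cauchy_imp_bounded by blast
  then obtain r where "\<And>n. f n \<in> cball 0 r" by (auto simp: bounded_iff)
  then show "\<exists>l\<in>UNIV. f \<longlonglongrightarrow> l"
    using compact_imp_complete[OF compact_cball_field[of r]] f unfolding complete_def by blast
qed

text \<open>This is the real inner product of the coordinate vectors. It yields the expansion in
  \<open>norm_diff_scale_sq\<close>, on which the minimisation in \<open>interpolate_finite\<close>
  rests.\<close>

lemma kre_kcnj_mult: "kre (kcnj x * y) = kre x * kre y + kim x * kim (y::'k::real_normed_field)"
proof (rule kre_kim_eqI[of _ _ "kre x * kim y - kim x * kre y"])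
  have e: "of_real (kim x) * of_real (kim y) * (kj * kj) = - (of_real (kim x) * of_real (kim y) :: 'k)"
    using kj[where 'k='k] kim_real[of x] by auto
  have "kcnj x * y = (of_real (kre x) - of_real (kim x) * kj) * (of_real (kre y) + of_real (kim y) * kj)"
    using arg_cong[OF coords[of y], of "\<lambda>y. kcnj x * y"] unfolding kcnj_def .
  also have "\<dots> = of_real (kre x) * of_real (kre y) + of_real (kre x * kim y - kim x * kre y) * kj
      - of_real (kim x) * of_real (kim y) * (kj * kj)"
    by (simp add: algebra_simps)
  finally show "kcnj x * y = of_real (kre x * kre y + kim x * kim y) + of_real (kre x * kim y - kim x * kre y) * kj"
    unfolding e by simp
qed (simp add: kim_real)

lemma norm_diff_scale_sq:
  "(norm (c - of_real t * d))\<^sup>2 = (norm c)\<^sup>2 - 2 * t * kre (kcnj c * d) + t\<^sup>2 * (norm (d::'k::real_normed_field))\<^sup>2"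
proof -
  have km: "kim (c - of_real t * d) = kim c - t * kim d"
    using kim_add[of c "of_real (- t) * d"] unfolding kim_scale by simp
  then show ?thesis
    unfolding norm_coords kre_diff kre_scale kre_kcnj_mult km by (simp add: power2_eq_square algebra_simps)
qed

lemma fscale_apply [simp]: "fscale c f x = c * f x"
  by (simp add: fscale_def)

lemma norm_inverse_scale_le_1:
  "t > 0 \<Longrightarrow> norm (inverse (of_real t) * (x::'k::real_normed_field)) \<le> 1 \<longleftrightarrow> norm x \<le> t"
  unfolding norm_mult norm_inverse norm_of_real by (simp add: field_simps)

lemma continuous_map_mult_left:
  "continuous_map X (euclidean :: 'k::real_normed_field topology) f \<Longrightarrow> continuous_map X euclidean (\<lambda>x. c * f x)"
  using continuous_map_compose[of X euclidean f euclidean "(*) c"] by (simp add: o_def continuous_intros)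

lemma continuous_map_euclidean_field_iff:
  "continuous_map X (euclidean :: 'k::real_normed_field topology) f \<longleftrightarrow>
    (\<forall>x\<in>topspace X. \<forall>e>0. \<exists>U. openin X U \<and> x \<in> U \<and> (\<forall>y\<in>U. dist (f x) (f y) < e))"
  using Met_TC.continuous_map_to_metric[of X f] by (simp add: mtopology_is_euclidean)

section \<open>Locally convex spaces\<close>

locale vspace =
  fixes s :: "'k::real_normed_field \<Rightarrow> 'y::ab_group_add \<Rightarrow> 'y" and Y :: "'y set"
  assumes vs: "vs_on s Y"
begin

lemma zero_mem [simp]: "0 \<in> Y"
  and add_mem [simp]: "\<lbrakk>x \<in> Y; y \<in> Y\<rbrakk> \<Longrightarrow> x + y \<in> Y"
  and scale_mem [simp]: "x \<in> Y \<Longrightarrow> s c x \<in> Y"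
  and scale_add_right: "\<lbrakk>x \<in> Y; y \<in> Y\<rbrakk> \<Longrightarrow> s c (x + y) = s c x + s c y"
  and scale_add_left: "x \<in> Y \<Longrightarrow> s (c + d) x = s c x + s d x"
  and scale_scale [simp]: "x \<in> Y \<Longrightarrow> s c (s d x) = s (c * d) x"
  and scale_one [simp]: "x \<in> Y \<Longrightarrow> s 1 x = x"
  using vs unfolding vs_on_def by blast+

lemma scale_zero_left [simp]: "x \<in> Y \<Longrightarrow> s 0 x = 0"
  using scale_add_left[of x 0 0] by simp

lemma scale_zero_right [simp]: "s c 0 = 0"
  using scale_add_right[of 0 0 c] by simp

lemma scale_minus_one: "x \<in> Y \<Longrightarrow> s (-1) x = - x"
  using scale_add_left[of x 1 "-1"] by (simp add: eq_neg_iff_add_eq_0 add.commute)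

lemma minus_mem [simp]: "x \<in> Y \<Longrightarrow> - x \<in> Y"
  using scale_mem[of x "-1"] by (simp add: scale_minus_one del: scale_mem)

lemma diff_mem [simp]: "\<lbrakk>x \<in> Y; y \<in> Y\<rbrakk> \<Longrightarrow> x - y \<in> Y"
  using add_mem[of x "- y"] by (simp only: diff_conv_add_uminus minus_mem)

lemma absconv_balanced: "\<lbrakk>absconv s A; A \<subseteq> Y; x \<in> A; norm c \<le> 1\<rbrakk> \<Longrightarrow> s c x \<in> A"
proof -
  assume A: "absconv s A" "A \<subseteq> Y" "x \<in> A" "norm c \<le> 1"
  then have "s c x + s 0 x \<in> A" unfolding absconv_def by simp
  then show ?thesis using A by (simp add: subsetD)
qed

lemma absconv_zero: "\<lbrakk>absconv s A; A \<subseteq> Y; A \<noteq> {}\<rbrakk> \<Longrightarrow> 0 \<in> A"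
  using absconv_balanced[of A _ 0] by fastforce

lemma absconv_convex:
  assumes "absconv s A" "x \<in> A" "y \<in> A" "0 \<le> t" "t \<le> 1"
  shows "s (of_real (1 - t)) x + s (of_real t) y \<in> A"
proof -
  have "norm (of_real (1 - t) :: 'k) + norm (of_real t :: 'k) \<le> 1" unfolding norm_of_real using assms by simp
  then show ?thesis using assms(1-3) unfolding absconv_def by blast
qed

lemma absorbs_iff:
  assumes "A \<subseteq> Y" "B \<subseteq> Y"
  shows "absorbs s A B \<longleftrightarrow> (\<exists>t>0. \<forall>c. norm c \<ge> t \<longrightarrow> (\<forall>b\<in>B. s (inverse c) b \<in> A))"
proof -
  have "B \<subseteq> s c ` A \<longleftrightarrow> (\<forall>b\<in>B. s (inverse c) b \<in> A)" if "norm c > 0" for c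
  proof safe
    fix b assume b: "B \<subseteq> s c ` A" "b \<in> B"
    then obtain a where "a \<in> A" "b = s c a" by blast
    then show "s (inverse c) b \<in> A" using that assms by auto
  next
    fix b assume b: "\<forall>b\<in>B. s (inverse c) b \<in> A" "b \<in> B"
    then have "b = s c (s (inverse c) b)" using that assms by auto
    then show "b \<in> s c ` A" using b by blast
  qed
  then show ?thesis unfolding absorbs_def by (meson less_le_trans)
qed

text \<open>Balancedness passes from one nonzero scalar to all scalars of large norm, so absorption
  need only be tested at a single one.\<close>

lemma absconv_absorbsI:
  assumes "absconv s A" "A \<subseteq> Y" "B \<subseteq> Y" "c \<noteq> 0" "\<And>b. b \<in> B \<Longrightarrow> s c b \<in> A"
  shows "absorbs s A B"
  unfolding absorbs_iff[OF assms(2,3)]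
proof (intro exI[of _ "norm (inverse c)"] conjI allI impI ballI)
  show "0 < norm (inverse c)" using assms by simp
  fix d :: 'k and b assume d: "norm (inverse c) \<le> norm d" and b: "b \<in> B"
  have "norm (inverse d) * norm (inverse c) \<le> norm (inverse d) * norm d"
    by (rule mult_left_mono[OF d]) simp
  also have "\<dots> \<le> 1" by (cases "d = 0") (auto simp: norm_inverse)
  finally have "norm (inverse d * inverse c) \<le> 1" by (simp only: norm_mult)
  then have "s (inverse d * inverse c) (s c b) \<in> A"
    using absconv_balanced assms b by blast
  then show "s (inverse d) b \<in> A" using b assms by (simp add: subsetD mult.assoc)
qed

lemma absorbsE:
  assumes "absorbs s A B" "A \<subseteq> Y" "B \<subseteq> Y"
  obtains t :: real where "t > 0" "\<And>b. b \<in> B \<Longrightarrow> s (of_real (inverse t)) b \<in> A"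
proof -
  obtain t where "t > 0" "\<forall>c. norm c \<ge> t \<longrightarrow> (\<forall>b\<in>B. s (inverse c) b \<in> A)"
    using assms absorbs_iff by blast
  then show ?thesis using that[of t] by (metis abs_of_pos norm_of_real of_real_inverse order_refl)
qed

lemma lin_functionalD:
  assumes "lin_functional s Y \<phi>"
  shows "\<lbrakk>x \<in> Y; y \<in> Y\<rbrakk> \<Longrightarrow> \<phi> (x + y) = \<phi> x + \<phi> y" "x \<in> Y \<Longrightarrow> \<phi> (s c x) = c * \<phi> x"
    "x \<notin> Y \<Longrightarrow> \<phi> x = 0" "\<phi> 0 = 0" "x \<in> Y \<Longrightarrow> \<phi> (- x) = - \<phi> x" "\<lbrakk>x \<in> Y; y \<in> Y\<rbrakk> \<Longrightarrow> \<phi> (x - y) = \<phi> x - \<phi> y"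
proof -
  show add: "\<phi> (x + y) = \<phi> x + \<phi> y" if "x \<in> Y" "y \<in> Y" for x y using assms that unfolding lin_functional_def by blast
  show sc: "\<phi> (s c x) = c * \<phi> x" if "x \<in> Y" for x c using assms that unfolding lin_functional_def by blast
  show "x \<notin> Y \<Longrightarrow> \<phi> x = 0" using assms unfolding lin_functional_def by blast
  show "\<phi> 0 = 0" using sc[of 0 0] by simp
  show m: "\<phi> (- x) = - \<phi> x" if "x \<in> Y" for x using sc[OF that, of "-1"] scale_minus_one[OF that] by simp
  show "\<phi> (x - y) = \<phi> x - \<phi> y" if "x \<in> Y" "y \<in> Y" for x y using add[of x "- y"] m that by simp
qed

lemma absconv_polar:
  assumes "\<And>\<phi>. \<phi> \<in> P \<Longrightarrow> lin_functional s Y \<phi>"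
  shows "absconv s {x \<in> Y. \<forall>\<phi>\<in>P. norm (\<phi> x) \<le> e}"
  unfolding absconv_def
proof (intro ballI allI impI CollectI conjI)
  fix x y \<phi> and a b :: 'k
  assume x: "x \<in> {x \<in> Y. \<forall>\<phi>\<in>P. norm (\<phi> x) \<le> e}" and y: "y \<in> {x \<in> Y. \<forall>\<phi>\<in>P. norm (\<phi> x) \<le> e}"
    and ab: "norm a + norm b \<le> 1" and p: "\<phi> \<in> P"
  have "0 \<le> e" using x p norm_ge_zero order_trans by blast
  have "norm (\<phi> (s a x + s b y)) \<le> norm a * norm (\<phi> x) + norm b * norm (\<phi> y)"
    using x y lin_functionalD[OF assms[OF p]] by (simp add: norm_triangle_le norm_mult)
  also have "\<dots> \<le> norm a * e + norm b * e"
    using x y p by (intro add_mono mult_left_mono) auto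
  also have "\<dots> = (norm a + norm b) * e" by (simp add: algebra_simps)
  also have "\<dots> \<le> e" using ab \<open>0 \<le> e\<close> by (simp add: mult_left_le_one_le)
  finally show "norm (\<phi> (s a x + s b y)) \<le> e" .
qed auto

end

section \<open>Neighbourhoods of zero, bounded sets and continuous functionals\<close>

lemma nbhd0_mono: "nbhd0 T V \<Longrightarrow> V \<subseteq> W \<Longrightarrow> nbhd0 T W"
  unfolding nbhd0_def by blast

lemma nbhd0_zero: "nbhd0 T V \<Longrightarrow> 0 \<in> V"
  unfolding nbhd0_def by blast

locale lcs =
  fixes s :: "'k::real_normed_field \<Rightarrow> 'y::ab_group_add \<Rightarrow> 'y" and Y :: "'y set" and T :: "'y topology"
  assumes lcH: "lcH_space s Y T"
begin

sublocale vspace s Y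
  using lcH by unfold_locales (simp add: lcH_space_def)

lemma topspace_eq [simp]: "topspace T = Y"
  and Hausdorff: "Hausdorff_space T"
  and continuous_add: "continuous_map (prod_topology T T) T (\<lambda>(x, y). x + y)"
  and continuous_scale: "continuous_map (prod_topology (euclidean :: 'k topology) T) T (\<lambda>(c, x). s c x)"
  using lcH by (auto simp: lcH_space_def)

lemma nbhd0_absconvE:
  assumes "nbhd0 T U"
  obtains V where "absconv s V" "V \<subseteq> U" "V \<subseteq> Y" "nbhd0 T V"
proof -
  obtain W where W: "openin T W" "0 \<in> W" "W \<subseteq> U" using assms unfolding nbhd0_def by blast
  then obtain V where "absconv s V" "V \<subseteq> W" "nbhd0 T V" using lcH unfolding lcH_space_def by meson
  then show ?thesis using that[of V] W openin_subset topspace_eq by blast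
qed

lemma continuous_translate: "x \<in> Y \<Longrightarrow> continuous_map T T (\<lambda>y. x + y)"
  using continuous_map_compose[OF _ continuous_add, of T "\<lambda>y. (x, y)"]
  by (simp add: continuous_map_pairwise o_def)

lemma continuous_scale_fixed: "continuous_map T T (s c)"
  using continuous_map_compose[OF _ continuous_scale, of T "\<lambda>y. (c, y)"]
  by (simp add: continuous_map_pairwise o_def)

lemma continuous_scale_at: "x \<in> Y \<Longrightarrow> continuous_map euclidean T (\<lambda>c. s c x)"
  using continuous_map_compose[OF _ continuous_scale, of euclidean "\<lambda>c. (c, x)"]
  by (simp add: continuous_map_pairwise o_def)

lemma open_translate: "\<lbrakk>openin T U; x \<in> Y\<rbrakk> \<Longrightarrow> openin T {y \<in> Y. x + y \<in> U}"
  using openin_continuous_map_preimage[OF continuous_translate] by simp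

text \<open>Translations are continuous with continuous inverses, so the absolutely convex
  neighbourhoods of 0 determine the topology.\<close>

lemma openin_iff:
  "openin T U \<longleftrightarrow> U \<subseteq> Y \<and> (\<forall>x\<in>U. \<exists>V. nbhd0 T V \<and> V \<subseteq> Y \<and> absconv s V \<and> (\<forall>v\<in>V. x + v \<in> U))"
proof (intro iffI conjI ballI)
  show "openin T U \<Longrightarrow> U \<subseteq> Y" using openin_subset by force
  fix x assume U: "openin T U" "x \<in> U"
  then have "x \<in> Y" using openin_subset by force
  then have "nbhd0 T {y \<in> Y. x + y \<in> U}"
    using open_translate[OF U(1)] U unfolding nbhd0_def by force
  then obtain V where "absconv s V" "V \<subseteq> {y \<in> Y. x + y \<in> U}" "V \<subseteq> Y" "nbhd0 T V"
    by (rule nbhd0_absconvE)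
  then show "\<exists>V. nbhd0 T V \<and> V \<subseteq> Y \<and> absconv s V \<and> (\<forall>v\<in>V. x + v \<in> U)" by blast
next
  assume R: "U \<subseteq> Y \<and> (\<forall>x\<in>U. \<exists>V. nbhd0 T V \<and> V \<subseteq> Y \<and> absconv s V \<and> (\<forall>v\<in>V. x + v \<in> U))"
  show "openin T U"
  proof (subst openin_subopen, intro ballI)
    fix x assume x: "x \<in> U"
    then obtain W where W: "openin T W" "0 \<in> W" "\<forall>v\<in>W. x + v \<in> U" and "x \<in> Y"
      using R unfolding nbhd0_def by (meson subsetD)
    then have "openin T {y \<in> Y. - x + y \<in> W}" by (intro open_translate) auto
    moreover have "{y \<in> Y. - x + y \<in> W} \<subseteq> U" using W(3) by fastforce
    ultimately show "\<exists>S. openin T S \<and> x \<in> S \<and> S \<subseteq> U" using W \<open>x \<in> Y\<close>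
      by (intro exI[of _ "{y \<in> Y. - x + y \<in> W}"]) auto
  qed
qed

lemma nbhd0_scale_preimage: "nbhd0 T V \<Longrightarrow> nbhd0 T {y \<in> Y. s c y \<in> V}"
proof -
  assume "nbhd0 T V"
  then obtain W where W: "openin T W" "0 \<in> W" "W \<subseteq> V" unfolding nbhd0_def by blast
  then have "openin T {y \<in> Y. s c y \<in> W}"
    using openin_continuous_map_preimage[OF continuous_scale_fixed] by simp
  then show ?thesis using W unfolding nbhd0_def by (intro exI[of _ "{y \<in> Y. s c y \<in> W}"]) auto
qed

lemma nbhd0_absorbs_point:
  assumes "nbhd0 T V" "y \<in> Y"
  obtains t :: real where "t > 0" "s (of_real t) y \<in> V"
proof -
  obtain W where W: "openin T W" "0 \<in> W" "W \<subseteq> V" using assms unfolding nbhd0_def by blast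
  have "open {c. s c y \<in> W}"
    using openin_continuous_map_preimage[OF continuous_scale_at[OF assms(2)] W(1)] by simp
  then obtain e where "e > 0" "\<forall>c. dist c 0 < e \<longrightarrow> s c y \<in> W"
    using W assms unfolding open_dist by (metis mem_Collect_eq scale_zero_left)
  then show ?thesis using that[of "e/2"] W by (auto simp: subsetD)
qed

lemma tvs_bounded_subset_space: "tvs_bounded s Y T B \<Longrightarrow> B \<subseteq> Y"
  unfolding tvs_bounded_def by blast

lemma tvs_bounded_absorbs: "tvs_bounded s Y T B \<Longrightarrow> nbhd0 T V \<Longrightarrow> absorbs s V B"
  unfolding tvs_bounded_def nbhd0_def absorbs_def by (meson image_mono order_trans)

lemma tvs_boundedI:
  assumes "B \<subseteq> Y" "\<And>V. \<lbrakk>absconv s V; V \<subseteq> Y; nbhd0 T V\<rbrakk> \<Longrightarrow> \<exists>c. c \<noteq> 0 \<and> (\<forall>b\<in>B. s c b \<in> V)"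
  shows "tvs_bounded s Y T B"
  unfolding tvs_bounded_def
proof (intro conjI allI impI assms(1))
  fix U assume U: "openin T U \<and> 0 \<in> U"
  then have "nbhd0 T U" unfolding nbhd0_def by blast
  then obtain V where V: "absconv s V" "V \<subseteq> U" "V \<subseteq> Y" "nbhd0 T V" by (rule nbhd0_absconvE)
  then obtain c where "c \<noteq> 0" "\<forall>b\<in>B. s c b \<in> V" using assms(2) by blast
  then have "absorbs s V B" using absconv_absorbsI V assms(1) by blast
  then show "absorbs s U B" using V(2) unfolding absorbs_def by (meson image_mono order_trans)
qed

lemma tvs_bounded_subset: "tvs_bounded s Y T B \<Longrightarrow> A \<subseteq> B \<Longrightarrow> tvs_bounded s Y T A"
  unfolding tvs_bounded_def absorbs_def by (meson order_trans)

lemma tvs_bounded_Un: "tvs_bounded s Y T A \<Longrightarrow> tvs_bounded s Y T B \<Longrightarrow> tvs_bounded s Y T (A \<union> B)"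
proof -
  assume A: "tvs_bounded s Y T A" and B: "tvs_bounded s Y T B"
  have "absorbs s U (A \<union> B)" if a: "absorbs s U A" and b: "absorbs s U B" for U
  proof -
    obtain t u where "t > 0" "\<forall>c. norm c \<ge> t \<longrightarrow> A \<subseteq> s c ` U" "\<forall>c. norm c \<ge> u \<longrightarrow> B \<subseteq> s c ` U"
      using a b unfolding absorbs_def by blast
    then show ?thesis unfolding absorbs_def by (intro exI[of _ "max t u"]) auto
  qed
  then show ?thesis using A B unfolding tvs_bounded_def by blast
qed

lemma tvs_bounded_singleton: "y \<in> Y \<Longrightarrow> tvs_bounded s Y T {y}"
  by (rule tvs_boundedI, simp) (metis nbhd0_absorbs_point of_real_eq_0_iff order_less_irrefl singletonD)

lemma tvs_bounded_empty: "tvs_bounded s Y T {}"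
  using tvs_bounded_subset[OF tvs_bounded_singleton[of 0]] by simp

lemma tvs_dual_lin: "\<phi> \<in> tvs_dual s Y T \<Longrightarrow> lin_functional s Y \<phi>"
  unfolding tvs_dual_def by blast

lemma tvs_dual_nbhd0:
  assumes "\<phi> \<in> tvs_dual s Y T" "e > 0"
  shows "nbhd0 T {y \<in> Y. norm (\<phi> y) \<le> e}"
proof -
  have "openin T {y \<in> topspace T. \<phi> y \<in> ball 0 e}"
    using assms by (intro openin_continuous_map_preimage[of _ euclidean]) (auto simp: tvs_dual_def)
  then show ?thesis using assms lin_functionalD(4)[OF tvs_dual_lin[OF assms(1)]]
    unfolding nbhd0_def by (intro exI[of _ "{y \<in> topspace T. \<phi> y \<in> ball 0 e}"]) auto
qed

lemma tvs_dualI: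
  assumes \<phi>: "lin_functional s Y \<phi>" and V: "nbhd0 T V" and M: "\<And>v. v \<in> V \<Longrightarrow> norm (\<phi> v) \<le> M"
  shows "\<phi> \<in> tvs_dual s Y T"
proof -
  note lin = lin_functionalD[OF \<phi>]
  have "openin T {y \<in> Y. \<phi> y \<in> U}" if U: "open U" for U
    unfolding openin_iff
  proof (intro conjI ballI)
    fix x assume x: "x \<in> {y \<in> Y. \<phi> y \<in> U}"
    then obtain e where e: "e > 0" "ball (\<phi> x) e \<subseteq> U" using U open_contains_ball by blast
    \<comment> \<open>The summand 1 keeps the denominator positive and the bound
      \<open>t * \<bar>M\<bar> < e\<close> strict.\<close>
    define t where "t = e / (\<bar>M\<bar> + 1)"
    have t: "t > 0" "t * \<bar>M\<bar> < e" using e by (auto simp: t_def field_simps)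
    have "nbhd0 T {y \<in> Y. s (inverse (of_real t)) y \<in> V}" by (rule nbhd0_scale_preimage[OF V])
    then obtain W where W: "absconv s W" "W \<subseteq> {y \<in> Y. s (inverse (of_real t)) y \<in> V}" "W \<subseteq> Y" "nbhd0 T W"
      by (rule nbhd0_absconvE)
    have "x + v \<in> {y \<in> Y. \<phi> y \<in> U}" if v: "v \<in> W" for v
    proof -
      have "v \<in> Y" "s (inverse (of_real t)) v \<in> V" using W v by auto
      then have "norm (inverse (of_real t) * \<phi> v) \<le> \<bar>M\<bar>" using M[of "s (inverse (of_real t)) v"] lin by force
      then have "norm (\<phi> v) \<le> t * \<bar>M\<bar>" using t by (simp add: norm_divide field_simps)
      then have "\<phi> (x + v) \<in> ball (\<phi> x) e" using x \<open>v \<in> Y\<close> lin t by (simp add: dist_norm)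
      then show ?thesis using e x \<open>v \<in> Y\<close> by auto
    qed
    then show "\<exists>V. nbhd0 T V \<and> V \<subseteq> Y \<and> absconv s V \<and> (\<forall>v\<in>V. x + v \<in> {y \<in> Y. \<phi> y \<in> U})"
      using W by blast
  qed auto
  then show ?thesis using \<phi> unfolding tvs_dual_def continuous_map_def by simp
qed

end

section \<open>Topologies of uniform convergence\<close>

text \<open>Two conditions imposed on B and C follow from one imposed on D, so a single member and a
  single radius describe a basic neighbourhood.\<close>

definition directed_family :: "'a set set \<Rightarrow> bool" where
  "directed_family Bs \<longleftrightarrow> Bs \<noteq> {} \<and> (\<forall>B\<in>Bs. \<forall>C\<in>Bs. \<exists>D\<in>Bs. B \<union> C \<subseteq> D)"

text \<open>A common frame for \<open>unif_top\<close>, where \<open>b\<close> is evaluation, and for weak topologies,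
  where \<open>Bs\<close> consists of finite sets.\<close>

definition pair_topology :: "'y set \<Rightarrow> ('y \<Rightarrow> 'z \<Rightarrow> 'k::real_normed_field) \<Rightarrow> 'z set set \<Rightarrow> 'y topology" where
  "pair_topology Y b Bs = topology (\<lambda>U. U \<subseteq> Y \<and>
     (\<forall>x\<in>U. \<exists>B\<in>Bs. \<exists>e>0. \<forall>y\<in>Y. (\<forall>z\<in>B. norm (b y z - b x z) \<le> e) \<longrightarrow> y \<in> U))"

lemma openin_pair_topology:
  assumes "directed_family Bs"
  shows "openin (pair_topology Y b Bs) U \<longleftrightarrow> U \<subseteq> Y \<and>
     (\<forall>x\<in>U. \<exists>B\<in>Bs. \<exists>e>0. \<forall>y\<in>Y. (\<forall>z\<in>B. norm (b y z - b x z) \<le> e) \<longrightarrow> y \<in> U)"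
proof -
  have "istopology (\<lambda>U. U \<subseteq> Y \<and>
     (\<forall>x\<in>U. \<exists>B\<in>Bs. \<exists>e>0. \<forall>y\<in>Y. (\<forall>z\<in>B. norm (b y z - b x z) \<le> e) \<longrightarrow> y \<in> U))" (is "istopology ?P")
    unfolding istopology_def
  proof (rule conjI; intro allI impI)
    fix S U assume S: "?P S" and U: "?P U"
    show "?P (S \<inter> U)"
    proof (intro conjI ballI)
      fix x assume "x \<in> S \<inter> U"
      then have x: "x \<in> S" "x \<in> U" by auto
      obtain B d where B: "B \<in> Bs" "d > 0" "\<And>y. y \<in> Y \<Longrightarrow> (\<forall>z\<in>B. norm (b y z - b x z) \<le> d) \<Longrightarrow> y \<in> S"
        using S x by blast
      obtain C e where C: "C \<in> Bs" "e > 0" "\<And>y. y \<in> Y \<Longrightarrow> (\<forall>z\<in>C. norm (b y z - b x z) \<le> e) \<Longrightarrow> y \<in> U"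
        using U x by blast
      obtain D where D: "D \<in> Bs" "B \<union> C \<subseteq> D" using B(1) C(1) assms unfolding directed_family_def by meson
      have "y \<in> S \<inter> U" if y: "y \<in> Y" "\<forall>z\<in>D. norm (b y z - b x z) \<le> min d e" for y
        using B(3)[OF y(1)] C(3)[OF y(1)] y(2) D(2) by auto
      then show "\<exists>B\<in>Bs. \<exists>e>0. \<forall>y\<in>Y. (\<forall>z\<in>B. norm (b y z - b x z) \<le> e) \<longrightarrow> y \<in> S \<inter> U"
        using D B(2) C(2) by (intro bexI[of _ D] exI[of _ "min d e"]) auto
    qed (use S in auto)
  next
    fix K assume K: "\<forall>S\<in>K. ?P S"
    show "?P (\<Union>K)"
    proof (intro conjI ballI)
      fix x assume "x \<in> \<Union>K"
      then obtain S where S: "S \<in> K" "x \<in> S" by blast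
      then obtain B e where "B \<in> Bs" "e > 0" "\<forall>y\<in>Y. (\<forall>z\<in>B. norm (b y z - b x z) \<le> e) \<longrightarrow> y \<in> S"
        using K by blast
      then show "\<exists>B\<in>Bs. \<exists>e>0. \<forall>y\<in>Y. (\<forall>z\<in>B. norm (b y z - b x z) \<le> e) \<longrightarrow> y \<in> \<Union>K"
        using S by (intro bexI[of _ B] exI[of _ e]) auto
    qed (use K in blast)
  qed
  then show ?thesis unfolding pair_topology_def by (simp add: topology_inverse')
qed

lemma topspace_pair_topology [simp]: "directed_family Bs \<Longrightarrow> topspace (pair_topology Y b Bs) = Y"
proof -
  assume d: "directed_family Bs"
  have "openin (pair_topology Y b Bs) Y"
    unfolding openin_pair_topology[OF d] using d by (auto simp: directed_family_def intro: exI[of _ 1])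
  then show ?thesis using openin_pair_topology[OF d] by (meson openin_subset openin_topspace subset_antisym)
qed

text \<open>The bound d < e keeps the supremum over B strictly below e; a pointwise condition
  \<open>< e\<close> need not be open when B is infinite. The margin e - d is split in half around
  each point.\<close>

lemma open_pair_ball:
  assumes d: "directed_family Bs" and B: "B \<in> Bs"
  shows "openin (pair_topology Y b Bs) {y \<in> Y. \<exists>d<e. \<forall>z\<in>B. norm (b y z - b x z) \<le> d}"
  unfolding openin_pair_topology[OF d]
proof (intro conjI ballI)
  fix y assume "y \<in> {y \<in> Y. \<exists>d<e. \<forall>z\<in>B. norm (b y z - b x z) \<le> d}"
  then obtain d where d: "d < e" "\<forall>z\<in>B. norm (b y z - b x z) \<le> d" by blast
  have "norm (b w z - b x z) \<le> (e + d) / 2" if "norm (b w z - b y z) \<le> (e - d) / 2" "z \<in> B" for w z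
  proof -
    have "norm (b w z - b x z) \<le> norm (b w z - b y z) + norm (b y z - b x z)"
      using norm_triangle_ineq[of "b w z - b y z" "b y z - b x z"] by simp
    also have "\<dots> \<le> (e - d) / 2 + d" using that d by (intro add_mono) auto
    finally show ?thesis by (simp add: field_simps)
  qed
  moreover have "(e + d) / 2 < e" "0 < (e - d) / 2" using d by auto
  ultimately show "\<exists>C\<in>Bs. \<exists>e'>0. \<forall>w\<in>Y. (\<forall>z\<in>C. norm (b w z - b y z) \<le> e') \<longrightarrow>
      w \<in> {y \<in> Y. \<exists>d<e. \<forall>z\<in>B. norm (b y z - b x z) \<le> d}"
    using B by (intro bexI[of _ B] exI[of _ "(e - d) / 2"]) blast+
qed blast

lemma continuous_map_pair:
  assumes d: "directed_family Bs" and "z \<in> B" "B \<in> Bs"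
  shows "continuous_map (pair_topology Y b Bs) euclidean (\<lambda>y. b y z)"
proof -
  have "openin (pair_topology Y b Bs) {y \<in> Y. b y z \<in> U}" if "open U" for U
    unfolding openin_pair_topology[OF d]
  proof (intro conjI ballI)
    fix x assume "x \<in> {y \<in> Y. b y z \<in> U}"
    then obtain e where "e > 0" "cball (b x z) e \<subseteq> U" using \<open>open U\<close> open_contains_cball by blast
    then show "\<exists>B\<in>Bs. \<exists>e>0. \<forall>y\<in>Y. (\<forall>z\<in>B. norm (b y z - b x z) \<le> e) \<longrightarrow> y \<in> {y \<in> Y. b y z \<in> U}"
      using assms by (intro bexI[of _ B] exI[of _ e]) (auto simp: subset_iff dist_norm norm_minus_commute)
  qed blast
  then show ?thesis using d by (simp add: continuous_map_def)
qed

lemma unif_top_eq: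
  assumes d: "directed_family Bs"
  shows "unif_top S Bs = pair_topology S (\<lambda>\<psi> y. \<psi> y) Bs"
proof (rule topology_eq[THEN iffD2], intro allI iffI)
  fix U
  let ?G = "{{\<psi>\<in>S. \<exists>d<e. \<forall>y\<in>B. norm (\<psi> y - \<phi> y) \<le> d} | \<phi> B e. \<phi> \<in> S \<and> B \<in> Bs \<and> (e::real) > 0}"
  show "openin (pair_topology S (\<lambda>\<psi> y. \<psi> y) Bs) U" if "openin (unif_top S Bs) U"
  proof -
    have "generate_topology_on ?G U"
      using that unfolding unif_top_def openin_topology_generated_by_iff .
    then show ?thesis
    proof (induction rule: generate_topology_on.induct)
      case (Basis s)
      then show ?case using open_pair_ball[OF d, where b = "\<lambda>\<psi> y. \<psi> y"] by auto
    qed (auto intro: openin_Union)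
  qed
  show "openin (unif_top S Bs) U" if U: "openin (pair_topology S (\<lambda>\<psi> y. \<psi> y) Bs) U"
  proof (subst openin_subopen, intro ballI)
    fix \<phi> assume "\<phi> \<in> U"
    then obtain B e where B: "B \<in> Bs" "e > 0" "\<forall>y\<in>S. (\<forall>z\<in>B. norm (y z - \<phi> z) \<le> e) \<longrightarrow> y \<in> U" and "\<phi> \<in> S"
      using U unfolding openin_pair_topology[OF d] by blast
    let ?V = "{\<psi>\<in>S. \<exists>d<e. \<forall>y\<in>B. norm (\<psi> y - \<phi> y) \<le> d}"
    have "?V \<in> ?G" using B \<open>\<phi> \<in> S\<close> by blast
    then have "openin (unif_top S Bs) ?V"
      unfolding unif_top_def by (rule topology_generated_by_Basis)
    moreover have "\<phi> \<in> ?V" using B \<open>\<phi> \<in> S\<close> by (auto intro: exI[of _ 0])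
    moreover have "?V \<subseteq> U" using B by fastforce
    ultimately show "\<exists>V. openin (unif_top S Bs) V \<and> \<phi> \<in> V \<and> V \<subseteq> U" by blast
  qed
qed

section \<open>Locally convex topologies defined by a pairing\<close>

text \<open>\<open>pair_bounded\<close> makes scalar multiplication continuous and
  \<open>pair_separates\<close> makes the topology Hausdorff. The locale is used for functionals on
  F with the bounded sets, and for F itself with finite sets of points of a given predual.\<close>

locale pairing = vspace s Y
  for s :: "'k::real_normed_field \<Rightarrow> 'y::ab_group_add \<Rightarrow> 'y" and Y +
  fixes b :: "'y \<Rightarrow> 'z \<Rightarrow> 'k" and Bs :: "'z set set"
  assumes directed: "directed_family Bs"
    and pair_add: "\<lbrakk>x \<in> Y; y \<in> Y; z \<in> B; B \<in> Bs\<rbrakk> \<Longrightarrow> b (x + y) z = b x z + b y z"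
    and pair_scale: "\<lbrakk>x \<in> Y; z \<in> B; B \<in> Bs\<rbrakk> \<Longrightarrow> b (s c x) z = c * b x z"
    and pair_bounded: "\<lbrakk>x \<in> Y; B \<in> Bs\<rbrakk> \<Longrightarrow> \<exists>M. \<forall>z\<in>B. norm (b x z) \<le> M"
    and pair_separates: "\<lbrakk>x \<in> Y; \<forall>B\<in>Bs. \<forall>z\<in>B. b x z = 0\<rbrakk> \<Longrightarrow> x = 0"
begin

abbreviation "ptop \<equiv> pair_topology Y b Bs"

lemmas openin_ptop = openin_pair_topology[OF directed]

lemma pair_zero: "\<lbrakk>z \<in> B; B \<in> Bs\<rbrakk> \<Longrightarrow> b 0 z = 0"
  using pair_scale[of 0 z B 0] by simp

lemma pair_minus: "\<lbrakk>x \<in> Y; z \<in> B; B \<in> Bs\<rbrakk> \<Longrightarrow> b (- x) z = - b x z"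
  using pair_scale[of x z B "-1"] by (simp add: scale_minus_one)

lemma pair_diff: "\<lbrakk>x \<in> Y; y \<in> Y; z \<in> B; B \<in> Bs\<rbrakk> \<Longrightarrow> b (x - y) z = b x z - b y z"
  using pair_add[of x "- y" z B] by (simp add: pair_minus)

lemma nbhd0_pair: "\<lbrakk>B \<in> Bs; e > 0\<rbrakk> \<Longrightarrow> nbhd0 ptop {y \<in> Y. \<forall>z\<in>B. norm (b y z) \<le> e}"
  unfolding nbhd0_def
  by (intro exI[of _ "{y \<in> Y. \<exists>d<e. \<forall>z\<in>B. norm (b y z - b 0 z) \<le> d}"] conjI open_pair_ball directed)
    (auto simp: pair_zero intro: exI[of _ 0])

lemma nbhd0_pairE:
  assumes "nbhd0 ptop U"
  obtains B e where "B \<in> Bs" "e > 0" "{y \<in> Y. \<forall>z\<in>B. norm (b y z) \<le> e} \<subseteq> U"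
proof -
  obtain W where W: "openin ptop W" "0 \<in> W" "W \<subseteq> U" using assms unfolding nbhd0_def by blast
  then obtain B e where "B \<in> Bs" "e > 0" "\<forall>y\<in>Y. (\<forall>z\<in>B. norm (b y z - b 0 z) \<le> e) \<longrightarrow> y \<in> W"
    unfolding openin_ptop by blast
  then show ?thesis using that[of B e] W(3) pair_zero by fastforce
qed

lemma absconv_pair: "B \<in> Bs \<Longrightarrow> absconv s {y \<in> Y. \<forall>z\<in>B. norm (b y z) \<le> e}"
  unfolding absconv_def
proof (intro ballI allI impI CollectI conjI)
  fix x y z and c d :: 'k
  assume B: "B \<in> Bs" and x: "x \<in> {y \<in> Y. \<forall>z\<in>B. norm (b y z) \<le> e}" and y: "y \<in> {y \<in> Y. \<forall>z\<in>B. norm (b y z) \<le> e}"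
    and ab: "norm c + norm d \<le> 1" and z: "z \<in> B"
  have "0 \<le> e" using x z norm_ge_zero order_trans by blast
  have "norm (b (s c x + s d y) z) \<le> norm c * norm (b x z) + norm d * norm (b y z)"
    using x y z B by (simp add: pair_add pair_scale norm_triangle_le norm_mult)
  also have "\<dots> \<le> norm c * e + norm d * e"
    using x y z by (intro add_mono mult_left_mono) auto
  also have "\<dots> = (norm c + norm d) * e" by (simp add: algebra_simps)
  also have "\<dots> \<le> e" using ab \<open>0 \<le> e\<close> by (simp add: mult_left_le_one_le)
  finally show "norm (b (s c x + s d y) z) \<le> e" .
qed auto

lemma continuous_map_add_pair: "continuous_map (prod_topology ptop ptop) ptop (\<lambda>(x, y). x + y)"
  unfolding continuous_map_def
proof (intro conjI allI impI)
  fix U assume U: "openin ptop U"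
  show "openin (prod_topology ptop ptop) {p \<in> topspace (prod_topology ptop ptop). (case p of (x, y) \<Rightarrow> x + y) \<in> U}"
    unfolding openin_prod_topology_alt
  proof (intro allI impI)
    fix x y assume "(x, y) \<in> {p \<in> topspace (prod_topology ptop ptop). (case p of (x, y) \<Rightarrow> x + y) \<in> U}"
    then have xy: "x \<in> Y" "y \<in> Y" "x + y \<in> U" using directed by auto
    then obtain B e where B: "B \<in> Bs" "e > 0" and U': "\<And>w. w \<in> Y \<Longrightarrow> (\<forall>z\<in>B. norm (b w z - b (x + y) z) \<le> e) \<Longrightarrow> w \<in> U"
      using U unfolding openin_ptop by blast
    let ?N = "\<lambda>x. {w \<in> Y. \<exists>d<e/2. \<forall>z\<in>B. norm (b w z - b x z) \<le> d}"
    have "v + w \<in> U" if "v \<in> ?N x" "w \<in> ?N y" for v w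
    proof (rule U')
      show "v + w \<in> Y" using that by simp
      show "\<forall>z\<in>B. norm (b (v + w) z - b (x + y) z) \<le> e"
      proof
        fix z assume z: "z \<in> B"
        have "norm (b v z - b x z) \<le> e/2" "norm (b w z - b y z) \<le> e/2" using that z by fastforce+
        then have "norm ((b v z - b x z) + (b w z - b y z)) \<le> e" using norm_triangle_ineq by (smt (verit) field_sum_of_halves)
        then show "norm (b (v + w) z - b (x + y) z) \<le> e" using that z B xy by (simp add: pair_add algebra_simps)
      qed
    qed
    then show "\<exists>V W. openin ptop V \<and> openin ptop W \<and> x \<in> V \<and> y \<in> W \<and>
        V \<times> W \<subseteq> {p \<in> topspace (prod_topology ptop ptop). (case p of (x, y) \<Rightarrow> x + y) \<in> U}"
      using B xy directed
      by (intro exI[of _ "?N x"] exI[of _ "?N y"] conjI open_pair_ball) (auto intro: exI[of _ 0])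
  qed
qed (use directed in auto)

lemma continuous_map_scale_pair: "continuous_map (prod_topology (euclidean :: 'k topology) ptop) ptop (\<lambda>(c, x). s c x)"
  unfolding continuous_map_def
proof (intro conjI allI impI)
  fix U assume U: "openin ptop U"
  show "openin (prod_topology euclidean ptop) {p \<in> topspace (prod_topology (euclidean :: 'k topology) ptop). (case p of (c, x) \<Rightarrow> s c x) \<in> U}"
    unfolding openin_prod_topology_alt
  proof (intro allI impI)
    fix c :: 'k and x assume "(c, x) \<in> {p \<in> topspace (prod_topology euclidean ptop). (case p of (c, x) \<Rightarrow> s c x) \<in> U}"
    then have cx: "x \<in> Y" "s c x \<in> U" using directed by auto
    then obtain B e where B: "B \<in> Bs" "e > 0" and U': "\<And>w. w \<in> Y \<Longrightarrow> (\<forall>z\<in>B. norm (b w z - b (s c x) z) \<le> e) \<Longrightarrow> w \<in> U"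
      using U unfolding openin_ptop by blast
    obtain M where M: "\<And>z. z \<in> B \<Longrightarrow> norm (b x z) \<le> M" using pair_bounded[OF cx(1) B(1)] by blast
    define M' where "M' = \<bar>M\<bar> + 1"
    have M': "M' > 0" "\<And>z. z \<in> B \<Longrightarrow> norm (b x z) \<le> M'" using M by (force simp: M'_def)+
    \<comment> \<open>In \<open>d * (b w z - b x z) + (d - c) * b x z\<close> each summand receives
      e/2: the radius r handles the second one against M', and r \<le> 1 keeps \<open>norm d\<close>
      below n, against which q is chosen for the first one.\<close>
    define r where "r = min 1 (e / 2 / M')"
    have r: "r > 0" "r \<le> 1" "r * M' \<le> e / 2" using B M' by (auto simp: r_def min_def field_simps)
    define n where "n = norm c + 1"
    define q where "q = e / 2 / n"
    have n: "n > 0" unfolding n_def by (simp add: add_nonneg_pos)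
    have q: "q > 0" "n * q = e / 2"
      using B n by (auto simp: q_def)
    let ?N = "{w \<in> Y. \<exists>d<q. \<forall>z\<in>B. norm (b w z - b x z) \<le> d}"
    have sub: "s d w \<in> U" if "d \<in> ball c r" "w \<in> ?N" for d w
    proof (rule U')
      show "s d w \<in> Y" using that by simp
      show "\<forall>z\<in>B. norm (b (s d w) z - b (s c x) z) \<le> e"
      proof
        fix z assume z: "z \<in> B"
        have dc: "norm (d - c) < r" using that by (simp add: dist_norm norm_minus_commute)
        have nd: "norm d \<le> n" unfolding n_def using dc r norm_triangle_sub[of d c] by linarith
        have "b (s d w) z - b (s c x) z = d * (b w z - b x z) + (d - c) * b x z"
          using that z B cx by (simp add: pair_scale algebra_simps)
        also have "norm \<dots> \<le> norm d * norm (b w z - b x z) + norm (d - c) * norm (b x z)"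
          by (simp add: norm_triangle_le norm_mult)
        also have "\<dots> \<le> n * q + r * M'"
          using that nd dc z M'(2)[OF z] r n by (intro add_mono mult_mono) fastforce+
        also have "\<dots> \<le> e" using r q by simp
        finally show "norm (b (s d w) z - b (s c x) z) \<le> e" .
      qed
    qed
    have "ball c r \<times> ?N \<subseteq> {p \<in> topspace (prod_topology euclidean ptop). (case p of (c, x) \<Rightarrow> s c x) \<in> U}"
    proof
      fix p assume p: "p \<in> ball c r \<times> ?N"
      then have "s (fst p) (snd p) \<in> U" by (intro sub) (simp_all add: mem_Times_iff)
      then show "p \<in> {p \<in> topspace (prod_topology euclidean ptop). (case p of (c, x) \<Rightarrow> s c x) \<in> U}"
        using p directed by (simp add: case_prod_beta mem_Times_iff)
    qed
    then show "\<exists>V W. openin euclidean V \<and> openin ptop W \<and> c \<in> V \<and> x \<in> W \<and>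
        V \<times> W \<subseteq> {p \<in> topspace (prod_topology euclidean ptop). (case p of (c, x) \<Rightarrow> s c x) \<in> U}"
      using B cx directed r q
      by (intro exI[of _ "ball c r"] exI[of _ ?N] conjI open_pair_ball) (auto intro: exI[of _ 0])
  qed
qed (use directed in auto)

lemma Hausdorff_pair: "Hausdorff_space ptop"
  unfolding Hausdorff_space_def
proof (intro allI impI)
  fix x y assume "x \<in> topspace ptop \<and> y \<in> topspace ptop \<and> x \<noteq> y"
  then have xy: "x \<in> Y" "y \<in> Y" "x \<noteq> y" using directed by auto
  then obtain B z where B: "B \<in> Bs" "z \<in> B" "b (x - y) z \<noteq> 0" using pair_separates[of "x - y"] by auto
  then have "b x z \<noteq> b y z" using xy by (simp add: pair_diff)
  then obtain U V where UV: "open U" "open V" "b x z \<in> U" "b y z \<in> V" "U \<inter> V = {}"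
    using hausdorff by metis
  have "openin ptop {w \<in> topspace ptop. b w z \<in> W}" if "open W" for W
    using that continuous_map_pair[OF directed B(2,1)] by (intro openin_continuous_map_preimage) auto
  then show "\<exists>U V. openin ptop U \<and> openin ptop V \<and> x \<in> U \<and> y \<in> V \<and> disjnt U V"
    using UV xy directed
    by (intro exI[of _ "{w \<in> topspace ptop. b w z \<in> U}"] exI[of _ "{w \<in> topspace ptop. b w z \<in> V}"])
      (auto simp: disjnt_def)
qed

lemma lcH_pair: "lcH_space s Y ptop"
  unfolding lcH_space_def
proof (intro conjI allI impI)
  fix U assume "openin ptop U \<and> 0 \<in> U"
  then have "nbhd0 ptop U" unfolding nbhd0_def by blast
  then obtain B e where "B \<in> Bs" "e > 0" "{y \<in> Y. \<forall>z\<in>B. norm (b y z) \<le> e} \<subseteq> U" by (rule nbhd0_pairE)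
  then show "\<exists>V. absconv s V \<and> V \<subseteq> U \<and> nbhd0 ptop V"
    using absconv_pair nbhd0_pair by blast
qed (use vs directed Hausdorff_pair continuous_map_add_pair continuous_map_scale_pair in auto)

sublocale lcs s Y ptop
  by unfold_locales (rule lcH_pair)

lemma tvs_bounded_pair:
  assumes "tvs_bounded s Y ptop A" "B \<in> Bs"
  obtains M where "M > 0" "\<And>x z. \<lbrakk>x \<in> A; z \<in> B\<rbrakk> \<Longrightarrow> norm (b x z) \<le> M"
proof -
  have AY: "A \<subseteq> Y" using assms tvs_bounded_subset_space by blast
  have "absorbs s {y \<in> Y. \<forall>z\<in>B. norm (b y z) \<le> 1} A"
    by (rule tvs_bounded_absorbs[OF assms(1) nbhd0_pair[OF assms(2)]]) simp
  then obtain t where t: "t > 0" "\<And>x. x \<in> A \<Longrightarrow> s (of_real (inverse t)) x \<in> {y \<in> Y. \<forall>z\<in>B. norm (b y z) \<le> 1}"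
    by (rule absorbsE) (use AY in auto)
  have "norm (b x z) \<le> t" if "x \<in> A" "z \<in> B" for x z
    using t(2)[OF that(1)] t(1) that AY assms(2) by (auto simp: pair_scale norm_divide field_simps subsetD)
  then show ?thesis using that t by blast
qed

lemma tvs_bounded_pairI:
  assumes "A \<subseteq> Y" "\<And>B. B \<in> Bs \<Longrightarrow> \<exists>M. \<forall>x\<in>A. \<forall>z\<in>B. norm (b x z) \<le> M"
  shows "tvs_bounded s Y ptop A"
proof (rule tvs_boundedI[OF assms(1)])
  fix V assume "nbhd0 ptop V"
  then obtain B e where B: "B \<in> Bs" "e > 0" "{y \<in> Y. \<forall>z\<in>B. norm (b y z) \<le> e} \<subseteq> V" by (rule nbhd0_pairE)
  then obtain M where M: "\<And>x z. \<lbrakk>x \<in> A; z \<in> B\<rbrakk> \<Longrightarrow> norm (b x z) \<le> M" using assms(2) by blast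
  define t where "t = e / (\<bar>M\<bar> + 1)"
  have t: "t > 0" "t * \<bar>M\<bar> \<le> e" using B by (auto simp: t_def field_simps)
  have "s (of_real t) x \<in> V" if x: "x \<in> A" for x
  proof -
    have "norm (b (s (of_real t) x) z) \<le> e" if "z \<in> B" for z
    proof -
      have "norm (b (s (of_real t) x) z) = t * norm (b x z)"
        using x that assms(1) t B by (auto simp: pair_scale norm_mult subsetD)
      also have "\<dots> \<le> t * \<bar>M\<bar>" using M[OF x that] t by (intro mult_left_mono) auto
      finally show ?thesis using t by simp
    qed
    then show ?thesis using x assms(1) by (intro subsetD[OF B(3)]) auto
  qed
  then show "\<exists>c. c \<noteq> 0 \<and> (\<forall>x\<in>A. s c x \<in> V)" using t by (intro exI[of _ "of_real t"]) auto
qed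

end

context pairing
begin

text \<open>One seminorm, measured from x, scaled by e and cut off at 1, separates x from S. This
  admits \<open>beta_top\<close> as a target space in \<open>gkR_space\<close>.\<close>

lemma completely_regular_pair: "completely_regular_space ptop"
  unfolding completely_regular_space_def
proof (intro allI impI)
  fix S x assume "closedin ptop S \<and> x \<in> topspace ptop - S"
  then have S: "openin ptop (Y - S)" "x \<in> Y - S" using directed by (auto simp: closedin_def)
  then obtain B e where B: "B \<in> Bs" "e > 0" "\<And>y. \<lbrakk>y \<in> Y; \<forall>z\<in>B. norm (b y z - b x z) \<le> e\<rbrakk> \<Longrightarrow> y \<in> Y - S"
    unfolding openin_ptop by blast
  \<comment> \<open>The inserted 0 makes the supremum meaningful for empty B.\<close>
  define p where "p = (\<lambda>y. Sup (insert 0 ((\<lambda>z. norm (b y z - b x z)) ` B)))"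
  have bdd: "bdd_above (insert 0 ((\<lambda>z. norm (b y z - b x z)) ` B))" if y: "y \<in> Y" for y
  proof -
    obtain M where "\<forall>z\<in>B. norm (b (y - x) z) \<le> M" using pair_bounded[of "y - x" B] y S B(1) by auto
    then have "\<forall>z\<in>B. norm (b y z - b x z) \<le> M" using y S B(1) by (simp add: pair_diff)
    then show ?thesis unfolding bdd_above_insert by (intro bdd_aboveI2) blast
  qed
  have p_ge: "0 \<le> p y" "\<And>z. z \<in> B \<Longrightarrow> norm (b y z - b x z) \<le> p y" if "y \<in> Y" for y
    unfolding p_def using bdd[OF that] by (auto intro!: cSup_upper)
  have p_le: "p y \<le> r" if "0 \<le> r" "\<And>z. z \<in> B \<Longrightarrow> norm (b y z - b x z) \<le> r" for y r
    unfolding p_def using that by (intro cSup_least) auto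
  have lip: "p y \<le> p w + d" if "y \<in> Y" "w \<in> Y" "0 \<le> d" "\<And>z. z \<in> B \<Longrightarrow> norm (b y z - b w z) \<le> d" for y w d
  proof (rule p_le)
    show "0 \<le> p w + d" using p_ge(1)[OF that(2)] that(3) by simp
    fix z assume z: "z \<in> B"
    have "norm (b y z - b x z) \<le> norm (b y z - b w z) + norm (b w z - b x z)"
      using norm_triangle_ineq[of "b y z - b w z" "b w z - b x z"] by simp
    then show "norm (b y z - b x z) \<le> p w + d" using that(4)[OF z] p_ge(2)[OF that(2) z] by linarith
  qed
  define g where "g = (\<lambda>y. min 1 (p y / e))"
  have "continuous_map ptop euclideanreal g"
    unfolding continuous_map_euclidean_field_iff
  proof (intro ballI allI impI)
    fix y and r :: real assume y: "y \<in> topspace ptop" and r: "r > 0"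
    let ?U = "{w \<in> Y. \<exists>d<r * e. \<forall>z\<in>B. norm (b w z - b y z) \<le> d}"
    have close: "dist (g y) (g w) < r" if w: "w \<in> ?U" for w
    proof -
      obtain d0 where d0: "d0 < r * e" "\<And>z. z \<in> B \<Longrightarrow> norm (b w z - b y z) \<le> d0" using w by blast
      define d where "d = max 0 d0"
      have d: "0 \<le> d" "d < r * e" "\<And>z. z \<in> B \<Longrightarrow> norm (b w z - b y z) \<le> d"
        using d0 r B(2) by (force simp: d_def)+
      have "p w \<le> p y + d" "p y \<le> p w + d"
        using lip[of w y d] lip[of y w d] d y w directed by (auto simp: norm_minus_commute)
      then have "\<bar>p y - p w\<bar> < r * e" using d(2) by linarith
      then have "\<bar>p y / e - p w / e\<bar> < r" using B(2) by (simp add: diff_divide_distrib[symmetric] divide_less_eq)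
      then show ?thesis unfolding g_def dist_real_def by linarith
    qed
    have yU: "y \<in> ?U" using y r B(2) directed by (auto intro!: exI[of _ 0])
    show "\<exists>U. openin ptop U \<and> y \<in> U \<and> (\<forall>w\<in>U. dist (g y) (g w) < r)"
      by (intro exI[of _ ?U] conjI ballI open_pair_ball[OF directed B(1)] yU) (rule close)
  qed
  moreover have "g y \<in> {0..1}" if "y \<in> Y" for y using p_ge(1)[OF that] B(2) by (simp add: g_def)
  ultimately have "continuous_map ptop (top_of_set {0..1}) g"
    unfolding continuous_map_in_subtopology using directed by auto
  moreover have "g x = 0"
  proof -
    have "p x = 0" using p_le[of 0 x] p_ge(1)[of x] S by simp
    then show ?thesis by (simp add: g_def)
  qed
  moreover have "g y = 1" if y: "y \<in> S" for y
  proof -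
    have yY: "y \<in> Y" using \<open>closedin ptop S \<and> _\<close> closedin_subset y directed by fastforce
    then obtain z where "z \<in> B" "e < norm (b y z - b x z)" using B(3)[of y] y by force
    then have "e < p y" using p_ge(2)[OF yY] by fastforce
    then show ?thesis using B(2) by (simp add: g_def)
  qed
  ultimately show "\<exists>f. continuous_map ptop (top_of_set {0..1::real}) f \<and> f x = 0 \<and> f ` S \<subseteq> {1}"
    by (intro exI[of _ g]) auto
qed

end

section \<open>Hahn--Banach separation\<close>

context vspace
begin

section \<open>Sublinear functionals and the real Hahn--Banach theorem\<close>

lemma scale_of_real: "x \<in> Y \<Longrightarrow> s (of_real t) (s (of_real u) x) = s (of_real (t * u)) x"
  by simp

text \<open>The inequality for t > 0 is easy to verify for infima; applied to t and to its inverse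
  it gives equality, see \<open>sublinear_scale\<close>.\<close>

definition sublinear :: "('y \<Rightarrow> real) \<Rightarrow> bool" where
  "sublinear q \<longleftrightarrow> (\<forall>x\<in>Y. \<forall>y\<in>Y. q (x + y) \<le> q x + q y) \<and> (\<forall>t>0. \<forall>x\<in>Y. q (s (of_real t) x) \<le> t * q x)"

lemma sublinear_add: "\<lbrakk>sublinear q; x \<in> Y; y \<in> Y\<rbrakk> \<Longrightarrow> q (x + y) \<le> q x + q y"
  unfolding sublinear_def by blast

lemma sublinear_scale_le: "\<lbrakk>sublinear q; x \<in> Y; t > 0\<rbrakk> \<Longrightarrow> q (s (of_real t) x) \<le> t * q x"
  unfolding sublinear_def by blast

lemma sublinear_zero: "sublinear q \<Longrightarrow> q 0 = 0"
  using sublinear_scale_le[of q 0 2] sublinear_scale_le[of q 0 "1/2"] by simp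

lemma sublinear_scale:
  assumes q: "sublinear q" "x \<in> Y" "t \<ge> 0"
  shows "q (s (of_real t) x) = t * q x"
proof (cases "t = 0")
  case True then show ?thesis using q sublinear_zero by simp
next
  case False
  then have t: "t > 0" using q by simp
  have "q (s (of_real (inverse t)) (s (of_real t) x)) \<le> inverse t * q (s (of_real t) x)"
    using q t by (intro sublinear_scale_le) auto
  moreover have "s (of_real (inverse t)) (s (of_real t) x) = x"
    using q t by (simp only: scale_of_real) simp
  ultimately have "t * q x \<le> q (s (of_real t) x)" using t by (simp add: field_simps)
  then show ?thesis using sublinear_scale_le[OF q(1,2) t] by simp
qed

lemma sublinear_minus: "\<lbrakk>sublinear q; x \<in> Y\<rbrakk> \<Longrightarrow> - q (- x) \<le> q x"
  using sublinear_add[of q x "- x"] sublinear_zero[of q] by simp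

text \<open>On Y this is the greatest sublinear functional below p whose value at -x is at most - p
  x. If p is minimal it must coincide with p, which makes p additive in the direction x.\<close>

definition descend :: "('y \<Rightarrow> real) \<Rightarrow> 'y \<Rightarrow> 'y \<Rightarrow> real" where
  "descend p x y = (if y \<in> Y then (INF t\<in>{0..}. p (y + s (of_real t) x) - t * p x) else 0)"

context
  fixes p x assumes p: "sublinear p" and x: "x \<in> Y"
begin

lemma descend_bdd: "y \<in> Y \<Longrightarrow> bdd_below ((\<lambda>t. p (y + s (of_real t) x) - t * p x) ` {0..})"
proof (rule bdd_belowI2)
  fix t :: real assume y: "y \<in> Y" and t: "t \<in> {0..}"
  have "p (s (of_real t) x) \<le> p (y + s (of_real t) x) + p (- y)"
    using sublinear_add[OF p, of "y + s (of_real t) x" "- y"] x y by simp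
  then show "- p (- y) \<le> p (y + s (of_real t) x) - t * p x"
    using sublinear_scale[OF p x, of t] t by simp
qed

lemma descend_le: "\<lbrakk>y \<in> Y; t \<ge> 0\<rbrakk> \<Longrightarrow> descend p x y \<le> p (y + s (of_real t) x) - t * p x"
  unfolding descend_def using descend_bdd by (auto intro!: cINF_lower)

lemma descend_ge: "\<lbrakk>y \<in> Y; \<And>t. t \<ge> 0 \<Longrightarrow> a \<le> p (y + s (of_real t) x) - t * p x\<rbrakk> \<Longrightarrow> a \<le> descend p x y"
  unfolding descend_def by (auto intro!: cINF_greatest)

lemma sublinear_descend: "sublinear (descend p x)"
  unfolding sublinear_def
proof (intro conjI ballI allI impI)
  fix y z assume y: "y \<in> Y" and z: "z \<in> Y"
  have "descend p x (y + z) \<le> (p (y + s (of_real t) x) - t * p x) + (p (z + s (of_real u) x) - u * p x)"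
    if t: "t \<ge> 0" and u: "u \<ge> 0" for t u
  proof -
    have "descend p x (y + z) \<le> p ((y + z) + s (of_real (t + u)) x) - (t + u) * p x"
      using y z t u by (intro descend_le) auto
    also have "(y + z) + s (of_real (t + u)) x = (y + s (of_real t) x) + (z + s (of_real u) x)"
      using x by (simp add: scale_add_left algebra_simps)
    also have "p \<dots> \<le> p (y + s (of_real t) x) + p (z + s (of_real u) x)"
      using x y z by (intro sublinear_add[OF p]) auto
    finally show ?thesis by (simp add: algebra_simps)
  qed
  then have "descend p x (y + z) - (p (z + s (of_real u) x) - u * p x) \<le> descend p x y" if "u \<ge> 0" for u
    using that y by (intro descend_ge) (auto simp: algebra_simps)
  then have "descend p x (y + z) - descend p x y \<le> descend p x z"
    using z by (intro descend_ge) (auto simp: algebra_simps)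
  then show "descend p x (y + z) \<le> descend p x y + descend p x z" by simp
next
  fix r y assume r: "(0::real) < r" and y: "y \<in> Y"
  have "descend p x (s (of_real r) y) / r \<le> descend p x y"
  proof (rule descend_ge[OF y])
    fix t :: real assume t: "t \<ge> 0"
    have "descend p x (s (of_real r) y) \<le> p (s (of_real r) y + s (of_real (r * t)) x) - (r * t) * p x"
      using r t y by (intro descend_le) auto
    also have "s (of_real r) y + s (of_real (r * t)) x = s (of_real r) (y + s (of_real t) x)"
      using x y by (simp add: scale_add_right)
    also have "p \<dots> \<le> r * p (y + s (of_real t) x)"
      using r x y by (intro sublinear_scale_le[OF p]) auto
    finally show "descend p x (s (of_real r) y) / r \<le> p (y + s (of_real t) x) - t * p x"
      using r by (simp add: field_simps)
  qed
  then show "descend p x (s (of_real r) y) \<le> r * descend p x y" using r by (simp add: field_simps)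
qed

lemma descend_below: "y \<in> Y \<Longrightarrow> descend p x y \<le> p y"
  using descend_le[of y 0] x by simp

lemma descend_at_minus: "descend p x (- x) \<le> - p x"
  using descend_le[of "- x" 1] x sublinear_zero[OF p] by simp

end

text \<open>Zorn's lemma for the reversed pointwise order. Values outside Y are set to 0 so that
  comparing whole functions means comparing them on Y. The infimum of a chain is finite since - p (-
  y) \<le> - q (- y) \<le> q y, and subadditive since two members of a chain have a common lower
  one.\<close>

lemma minimal_sublinear_exists:
  assumes p: "sublinear p"
  obtains q where "sublinear q" "\<And>y. y \<in> Y \<Longrightarrow> q y \<le> p y"
    "\<And>r. \<lbrakk>sublinear r; \<forall>y\<in>Y. r y \<le> q y\<rbrakk> \<Longrightarrow> \<forall>y\<in>Y. r y = q y"
proof -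
  define A where "A = {q. sublinear q \<and> (\<forall>y\<in>Y. q y \<le> p y) \<and> (\<forall>y. y \<notin> Y \<longrightarrow> q y = 0)}"
  have restr: "(\<lambda>y. if y \<in> Y then r y else 0) \<in> A" if "sublinear r" "\<And>y. y \<in> Y \<Longrightarrow> r y \<le> p y" for r
    using that unfolding A_def sublinear_def by auto
  have "\<exists>m\<in>A. \<forall>a\<in>A. a \<le> m \<longrightarrow> a = m"
  proof (rule predicate_Zorn)
    show "partial_order_on A (relation_of (\<lambda>a u. u \<le> a) A)"
      by (rule partial_order_on_relation_ofI) auto
    fix C assume C: "C \<in> Chains (relation_of (\<lambda>a u. u \<le> a) A)"
    have CA: "C \<subseteq> A" using C by (auto simp: Chains_def relation_of_def)
    have chain: "a \<le> c \<or> c \<le> a" if "a \<in> C" "c \<in> C" for a c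
      using C that by (auto simp: Chains_def relation_of_def)
    show "\<exists>u\<in>A. \<forall>a\<in>C. u \<le> a"
    proof (cases "C = {}")
      case True
      then show ?thesis using restr[OF p] by blast
    next
      case False
      define u where "u = (\<lambda>y. if y \<in> Y then (INF q\<in>C. q y) else 0)"
      have bdd: "bdd_below ((\<lambda>q. q y) ` C)" if "y \<in> Y" for y
      proof (rule bdd_belowI2)
        fix q assume "q \<in> C"
        then have "sublinear q" "q (- y) \<le> p (- y)" using CA that by (auto simp: A_def)
        then show "- p (- y) \<le> q y" using sublinear_minus[of q y] that by simp
      qed
      have lower: "u y \<le> q y" if "q \<in> C" "y \<in> Y" for q y
        unfolding u_def using that bdd by (auto intro!: cINF_lower)
      have great: "a \<le> u y" if "y \<in> Y" "\<And>q. q \<in> C \<Longrightarrow> a \<le> q y" for a y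
        unfolding u_def using that False by (auto intro!: cINF_greatest)
      have "sublinear u"
        unfolding sublinear_def
      proof (intro conjI ballI allI impI)
        fix x y assume x: "x \<in> Y" and y: "y \<in> Y"
        have "u (x + y) \<le> q x + r y" if qr: "q \<in> C" "r \<in> C" for q r
        proof -
          obtain w where w: "w \<in> C" "w \<le> q" "w \<le> r" using chain[OF qr] qr by blast
          have "u (x + y) \<le> w (x + y)" using w x y by (intro lower) auto
          also have "\<dots> \<le> w x + w y" using w CA x y by (intro sublinear_add) (auto simp: A_def)
          also have "\<dots> \<le> q x + r y" using w by (intro add_mono) (auto simp: le_fun_def)
          finally show ?thesis .
        qed
        then have "u (x + y) - r y \<le> u x" if "r \<in> C" for r
          using that x by (intro great) (auto simp: algebra_simps)
        then have "u (x + y) - u x \<le> u y"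
          using y by (intro great) (auto simp: algebra_simps)
        then show "u (x + y) \<le> u x + u y" by simp
      next
        fix t x assume t: "(0::real) < t" and x: "x \<in> Y"
        have "u (s (of_real t) x) / t \<le> u x"
        proof (rule great[OF x])
          fix q assume q: "q \<in> C"
          have "u (s (of_real t) x) \<le> q (s (of_real t) x)" using x q by (intro lower) auto
          also have "\<dots> \<le> t * q x" using q CA x t by (intro sublinear_scale_le) (auto simp: A_def)
          finally show "u (s (of_real t) x) / t \<le> q x" using t by (simp add: field_simps)
        qed
        then show "u (s (of_real t) x) \<le> t * u x" using t by (simp add: field_simps)
      qed
      moreover have "u y \<le> p y" if "y \<in> Y" for y
        using lower[OF _ that] False CA that unfolding A_def by fastforce
      ultimately have "u \<in> A" unfolding A_def by (auto simp: u_def)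
      moreover have "u \<le> a" if "a \<in> C" for a
      proof (rule le_funI)
        fix y show "u y \<le> a y"
          using lower[OF that, of y] that CA by (cases "y \<in> Y") (auto simp: A_def u_def)
      qed
      ultimately show ?thesis by blast
    qed
  qed
  then obtain m where m: "m \<in> A" "\<And>a. a \<in> A \<Longrightarrow> a \<le> m \<Longrightarrow> a = m" by blast
  show ?thesis
  proof (rule that[of m])
    show "sublinear m" "\<And>y. y \<in> Y \<Longrightarrow> m y \<le> p y" using m(1) by (auto simp: A_def)
    fix r assume r: "sublinear r" "\<forall>y\<in>Y. r y \<le> m y"
    have "r y \<le> p y" if "y \<in> Y" for y
      using r(2) m(1) that unfolding A_def by (blast intro: order_trans)
    then have "(\<lambda>y. if y \<in> Y then r y else 0) \<in> A" by (rule restr[OF r(1)])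
    moreover have "(\<lambda>y. if y \<in> Y then r y else 0) \<le> m"
      using r m(1) by (auto simp: le_fun_def A_def)
    ultimately have "(\<lambda>y. if y \<in> Y then r y else 0) = m" by (rule m(2))
    then have "(if y \<in> Y then r y else 0) = m y" for y by (rule fun_cong)
    then show "\<forall>y\<in>Y. r y = m y" by (metis (full_types))
  qed
qed

text \<open>A minimal sublinear functional \<open>l\<close> agrees with \<open>descend l x\<close> for every \<open>x\<close>, hence is additive.\<close>

lemma hahn_banach_real:
  assumes p: "sublinear p" and x0: "x0 \<in> Y"
  obtains l where "\<And>x y. \<lbrakk>x \<in> Y; y \<in> Y\<rbrakk> \<Longrightarrow> l (x + y) = l x + l y"
    "\<And>t x. x \<in> Y \<Longrightarrow> l (s (of_real t) x) = t * l x"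
    "\<And>x. x \<in> Y \<Longrightarrow> l x \<le> p x" "p x0 \<le> l x0"
proof -
  \<comment> \<open>Starting from \<open>descend p x0\<close> instead of p forces l (- x0) \<le> - p
    x0, so that l attains p at x0.\<close>
  obtain l where l: "sublinear l" "\<And>y. y \<in> Y \<Longrightarrow> l y \<le> descend p x0 y"
    and lmin: "\<And>r. \<lbrakk>sublinear r; \<forall>y\<in>Y. r y \<le> l y\<rbrakk> \<Longrightarrow> \<forall>y\<in>Y. r y = l y"
    by (rule minimal_sublinear_exists[OF sublinear_descend[OF p x0]]) blast
  have add: "l (x + y) = l x + l y" if x: "x \<in> Y" and y: "y \<in> Y" for x y
  proof -
    have "descend l x y = l y"
      using lmin[OF sublinear_descend[OF l(1) x]] descend_below[OF l(1) x] y by blast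
    then have "l y \<le> l (y + x) - l x" using descend_le[OF l(1) x y, of 1] x by simp
    then show ?thesis using sublinear_add[OF l(1) x y] by (simp add: add.commute)
  qed
  have minus: "l (- x) = - l x" if "x \<in> Y" for x
    using add[of x "- x"] that sublinear_zero[OF l(1)] by simp
  have scale: "l (s (of_real t) x) = t * l x" if x: "x \<in> Y" for t x
  proof (cases "t \<ge> 0")
    case True then show ?thesis using sublinear_scale[OF l(1) x] by blast
  next
    case False
    then have "l (s (of_real (- t)) (- x)) = - t * l (- x)" using x by (intro sublinear_scale[OF l(1)]) auto
    moreover have "s (of_real (- t)) (- x) = s (of_real t) x"
      using x scale_scale[of x "- of_real t" "-1"] by (simp add: scale_minus_one del: scale_scale)
    ultimately show ?thesis using minus[OF x] by simp
  qed
  have "l (- x0) \<le> - p x0" using l(2)[of "- x0"] descend_at_minus[OF p x0] x0 by fastforce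
  then have "p x0 \<le> l x0" using minus[OF x0] by simp
  moreover have "l x \<le> p x" if "x \<in> Y" for x
    using l(2)[OF that] descend_below[OF p x0 that] by (rule order_trans)
  ultimately show ?thesis using that[of l] add scale by blast
qed

section \<open>Minkowski gauges and separation over the scalar field\<close>

definition gauge :: "'y set \<Rightarrow> 'y \<Rightarrow> real" where
  "gauge C y = Inf {t. t > 0 \<and> s (of_real (inverse t)) y \<in> C}"

context
  fixes C assumes C: "absconv s C" "C \<subseteq> Y" and absorbing: "\<And>y. y \<in> Y \<Longrightarrow> \<exists>t>0. s (of_real t) y \<in> C"
begin

lemma gauge_le: "t > 0 \<Longrightarrow> s (of_real (inverse t)) y \<in> C \<Longrightarrow> gauge C y \<le> t"
  unfolding gauge_def by (rule cInf_lower) (auto intro: bdd_belowI[of _ 0])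

lemma gauge_ge:
  assumes "y \<in> Y" "\<And>t. \<lbrakk>t > 0; s (of_real (inverse t)) y \<in> C\<rbrakk> \<Longrightarrow> a \<le> t"
  shows "a \<le> gauge C y"
proof -
  obtain t where t: "t > 0" "s (of_real t) y \<in> C" using absorbing assms(1) by blast
  then have "inverse t \<in> {t. t > 0 \<and> s (of_real (inverse t)) y \<in> C}" by simp
  then have "{t. t > 0 \<and> s (of_real (inverse t)) y \<in> C} \<noteq> {}" by blast
  then show ?thesis unfolding gauge_def using assms(2) by (intro cInf_greatest) blast+
qed

lemma sublinear_gauge: "sublinear (gauge C)"
  unfolding sublinear_def
proof (intro conjI ballI allI impI)
  fix x y assume x: "x \<in> Y" and y: "y \<in> Y"
  have *: "gauge C (x + y) \<le> t + u"
    if t: "t > 0" "s (of_real (inverse t)) x \<in> C" and u: "u > 0" "s (of_real (inverse u)) y \<in> C" for t u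
  proof (rule gauge_le)
    show "0 < t + u" using t u by simp
    have "norm (of_real (t / (t + u)) :: 'k) + norm (of_real (u / (t + u)) :: 'k) \<le> 1"
      unfolding norm_of_real using t u by (simp add: add_divide_distrib[symmetric])
    then have "s (of_real (t / (t + u))) (s (of_real (inverse t)) x) + s (of_real (u / (t + u))) (s (of_real (inverse u)) y) \<in> C"
      using C t u unfolding absconv_def by blast
    also have "s (of_real (t / (t + u))) (s (of_real (inverse t)) x) = s (of_real (inverse (t + u))) x"
      using t unfolding scale_of_real[OF x] by (intro arg_cong[of _ _ "\<lambda>t. s (of_real t) x"]) (simp add: field_simps)
    also have "s (of_real (u / (t + u))) (s (of_real (inverse u)) y) = s (of_real (inverse (t + u))) y"
      using u unfolding scale_of_real[OF y] by (intro arg_cong[of _ _ "\<lambda>t. s (of_real t) y"]) (simp add: field_simps)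
    finally show "s (of_real (inverse (t + u))) (x + y) \<in> C" using x y by (simp add: scale_add_right)
  qed
  have "gauge C (x + y) - u \<le> gauge C x" if u: "u > 0" "s (of_real (inverse u)) y \<in> C" for u
    using *[OF _ _ u] by (intro gauge_ge[OF x]) force
  then have "gauge C (x + y) - gauge C x \<le> gauge C y"
    by (intro gauge_ge[OF y]) force
  then show "gauge C (x + y) \<le> gauge C x + gauge C y" by simp
next
  fix r x assume r: "(0::real) < r" and x: "x \<in> Y"
  have "gauge C (s (of_real r) x) / r \<le> gauge C x"
  proof (rule gauge_ge[OF x])
    fix t assume t: "(0::real) < t" "s (of_real (inverse t)) x \<in> C"
    have "gauge C (s (of_real r) x) \<le> r * t"
    proof (rule gauge_le)
      have "s (of_real (inverse (r * t))) (s (of_real r) x) = s (of_real (inverse t)) x"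
        using r unfolding scale_of_real[OF x] by (intro arg_cong[of _ _ "\<lambda>t. s (of_real t) x"]) (simp add: field_simps)
      then show "s (of_real (inverse (r * t))) (s (of_real r) x) \<in> C" using t by simp
    qed (use r t in simp)
    then show "gauge C (s (of_real r) x) / r \<le> t" using r by (simp add: field_simps)
  qed
  then show "gauge C (s (of_real r) x) \<le> r * gauge C x" using r by (simp add: field_simps)
qed

lemma gauge_le_one: "y \<in> C \<Longrightarrow> gauge C y \<le> 1"
  using gauge_le[of 1 y] C by (auto simp: subsetD)

text \<open>Without closedness of C only the weak inequality is available;
  \<open>separation_absconv\<close> recovers a strict one.\<close>

lemma gauge_ge_one:
  assumes y: "y \<in> Y" "y \<notin> C" shows "1 \<le> gauge C y"
proof (rule gauge_ge[OF y(1)], rule ccontr)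
  fix t assume t: "(0::real) < t" "s (of_real (inverse t)) y \<in> C" "\<not> 1 \<le> t"
  have "s (of_real t) (s (of_real (inverse t)) y) \<in> C"
    using t by (intro absconv_balanced[OF C t(2)]) simp
  then show False using y t unfolding scale_of_real[OF y(1)] by simp
qed

end

text \<open>The functional \<open>x \<mapsto> l x - i l (i x)\<close> also covers the real case, where the unit \<open>kj\<close> is \<open>0\<close>.\<close>

lemma hahn_banach_absconv:
  assumes C: "absconv s C" "C \<subseteq> Y" and absorbing: "\<And>y. y \<in> Y \<Longrightarrow> \<exists>t>0. s (of_real t) y \<in> C"
    and y0: "y0 \<in> Y" "y0 \<notin> C"
  obtains \<phi> where "lin_functional s Y \<phi>" "\<And>x. x \<in> C \<Longrightarrow> norm (\<phi> x) \<le> 1" "1 \<le> norm (\<phi> y0)"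
proof -
  obtain l where add: "\<And>x y. \<lbrakk>x \<in> Y; y \<in> Y\<rbrakk> \<Longrightarrow> l (x + y) = l x + l y"
    and scale: "\<And>t x. x \<in> Y \<Longrightarrow> l (s (of_real t) x) = t * l x"
    and le: "\<And>x. x \<in> Y \<Longrightarrow> l x \<le> gauge C x" and ge: "gauge C y0 \<le> l y0"
    using hahn_banach_real[OF sublinear_gauge[OF C absorbing] y0(1)] by blast
  define \<phi> where "\<phi> = (\<lambda>x. if x \<in> Y then of_real (l x) - kj * of_real (l (s kj x)) else (0::'k))"
  have l0: "l 0 = 0" using scale[of 0 0] by simp
  have lm: "l (- x) = - l x" if "x \<in> Y" for x using scale[OF that, of "-1"] that by (simp add: scale_minus_one)
  have \<phi>add: "\<phi> (x + y) = \<phi> x + \<phi> y" if "x \<in> Y" "y \<in> Y" for x y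
    using that by (simp add: \<phi>_def add scale_add_right algebra_simps)
  have \<phi>real: "\<phi> (s (of_real t) x) = of_real t * \<phi> x" if x: "x \<in> Y" for t x
  proof -
    have "s kj (s (of_real t) x) = s (of_real t) (s kj x)" using x by (simp add: mult.commute)
    then show ?thesis using x by (simp add: \<phi>_def scale del: scale_scale) (simp add: algebra_simps)
  qed
  have \<phi>j: "\<phi> (s kj x) = kj * \<phi> x" if x: "x \<in> Y" for x
  proof (cases "kj = (0::'k)")
    case True then show ?thesis using x l0 by (simp add: \<phi>_def)
  next
    case False
    then have jj: "kj * kj = (-1::'k)" using kj by blast
    then have "kj * (kj * a) = - a" for a :: 'k
      using mult.assoc[of kj kj a] by simp
    then show ?thesis using x jj lm by (simp add: \<phi>_def scale_minus_one right_diff_distrib)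
  qed
  have \<phi>scale: "\<phi> (s c x) = c * \<phi> x" if x: "x \<in> Y" for c x
  proof -
    have "s c x = s (of_real (kre c)) x + s (of_real (kim c)) (s kj x)"
      using x coords[of c] by (simp add: scale_add_left[symmetric])
    then have "\<phi> (s c x) = of_real (kre c) * \<phi> x + of_real (kim c) * (kj * \<phi> x)"
      using x \<phi>add[of "s (of_real (kre c)) x" "s (of_real (kim c)) (s kj x)"] \<phi>real[of "s kj x"] \<phi>real \<phi>j
      by (simp del: scale_scale)
    also have "\<dots> = (of_real (kre c) + of_real (kim c) * kj) * \<phi> x" by (simp add: algebra_simps)
    finally show ?thesis using coords[of c] by simp
  qed
  have lin: "lin_functional s Y \<phi>"
    unfolding lin_functional_def using \<phi>add \<phi>scale by (simp add: \<phi>_def)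
  have re: "kre (\<phi> x) = l x" if "x \<in> Y" for x
    by (rule kre_kim_eqI[of _ _ "if kj = (0::'k) then 0 else - l (s kj x)"])
      (use that in \<open>auto simp: \<phi>_def\<close>)
  have "norm (\<phi> x) \<le> 1" if x: "x \<in> C" for x
  proof -
    \<comment> \<open>C is balanced, so x may be rotated until its value is real and nonnegative;
      there it agrees with l, which the gauge bounds.\<close>
    obtain u :: 'k where u: "norm u = 1" "u * \<phi> x = of_real (norm (\<phi> x))" by (rule ex_unit_scalar)
    have xY: "x \<in> Y" using x C by blast
    have ux: "s u x \<in> C" using absconv_balanced[OF C x] u by simp
    have "norm (\<phi> x) = kre (\<phi> (s u x))" using \<phi>scale[OF xY] u by simp
    also have "\<dots> = l (s u x)" using xY by (intro re) simp
    also have "\<dots> \<le> gauge C (s u x)" using xY by (intro le) simp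
    also have "\<dots> \<le> 1" by (rule gauge_le_one[OF C absorbing ux])
    finally show ?thesis .
  qed
  moreover have "1 \<le> norm (\<phi> y0)"
    using gauge_ge_one[OF C absorbing y0] ge re[OF y0(1)] abs_kre_le[of "\<phi> y0"] by linarith
  ultimately show ?thesis using that lin by blast
qed

end

context lcs
begin

text \<open>Strictness comes from moving y: for some c in (0,1) the point c y is still outside A,
  and a neighbourhood V keeps it outside C = A + V. This C is absorbing, so it has a gauge; the
  functional is continuous because it is bounded on V, and norm at least 1 at c y means norm greater
  than 1 at y.\<close>

lemma separation_absconv:
  assumes A: "absconv s A" "A \<subseteq> Y" "closedin T A" "A \<noteq> {}" and y: "y \<in> Y" "y \<notin> A"
  obtains \<phi> where "\<phi> \<in> tvs_dual s Y T" "\<And>x. x \<in> A \<Longrightarrow> norm (\<phi> x) \<le> 1" "1 < norm (\<phi> y)"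
proof -
  have U: "openin T (Y - A)" using A(3) by (simp add: closedin_def)
  have "open {c. s c y \<in> Y - A}"
    using openin_continuous_map_preimage[OF continuous_scale_at[OF y(1)] U] by simp
  moreover have "1 \<in> {c. s c y \<in> Y - A}" using y by simp
  ultimately obtain e where e: "e > 0" "ball 1 e \<subseteq> {c. s c y \<in> Y - A}" using open_contains_ball by metis
  define c where "c = 1 - min (e/2) (1/2)"
  have c: "0 < c" "c < 1" "1 - c < e" using e by (auto simp: c_def)
  have "dist 1 (of_real c :: 'k) = \<bar>1 - c\<bar>" by (metis dist_norm norm_of_real of_real_1 of_real_diff)
  then have "of_real c \<in> ball (1::'k) e" using c by simp
  then have yc: "s (of_real c) y \<in> Y - A" using e by blast
  then obtain V where V: "nbhd0 T V" "V \<subseteq> Y" "absconv s V" "\<And>v. v \<in> V \<Longrightarrow> s (of_real c) y + v \<in> Y - A"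
    using U unfolding openin_iff by blast
  define C where "C = {a + v |a v. a \<in> A \<and> v \<in> V}"
  have A0: "0 \<in> A" using absconv_zero A by blast
  have V0: "0 \<in> V" using V(1) nbhd0_zero by blast
  have sub: "A \<subseteq> C" "V \<subseteq> C" using A0 V0 unfolding C_def by (force intro: exI[of _ 0])+
  have CY: "C \<subseteq> Y" using A V by (auto simp: C_def subsetD)
  have "absconv s C"
    unfolding absconv_def
  proof (intro ballI allI impI)
    fix x z and a b :: 'k assume "x \<in> C" "z \<in> C" and ab: "norm a + norm b \<le> 1"
    then obtain x1 x2 z1 z2 where x: "x = x1 + x2" "x1 \<in> A" "x2 \<in> V" and z: "z = z1 + z2" "z1 \<in> A" "z2 \<in> V"
      unfolding C_def by blast
    have mem: "x1 \<in> Y" "x2 \<in> Y" "z1 \<in> Y" "z2 \<in> Y" using x z A V by auto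
    have "s a x1 + s b z1 \<in> A" "s a x2 + s b z2 \<in> V"
      using x z A(1) V(3) ab unfolding absconv_def by blast+
    moreover have "s a x + s b z = (s a x1 + s b z1) + (s a x2 + s b z2)"
      using mem by (simp add: x z scale_add_right algebra_simps)
    ultimately show "s a x + s b z \<in> C" unfolding C_def by blast
  qed
  moreover have "\<exists>t>0. s (of_real t) x \<in> C" if "x \<in> Y" for x
    using nbhd0_absorbs_point[OF V(1) that] sub by blast
  moreover have "s (of_real c) y \<notin> C"
  proof
    assume "s (of_real c) y \<in> C"
    then obtain a v where av: "s (of_real c) y = a + v" "a \<in> A" "v \<in> V" unfolding C_def by blast
    then have "- v \<in> V" using absconv_balanced[OF V(3,2), of v "-1"] V(2) by (auto simp: scale_minus_one subsetD)
    then have "a \<in> Y - A" using V(4)[of "- v"] av(1) by simp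
    then show False using av by blast
  qed
  ultimately obtain \<phi> where \<phi>: "lin_functional s Y \<phi>" "\<And>x. x \<in> C \<Longrightarrow> norm (\<phi> x) \<le> 1"
    "1 \<le> norm (\<phi> (s (of_real c) y))"
    using hahn_banach_absconv[of C "s (of_real c) y"] CY yc by blast
  have "\<phi> \<in> tvs_dual s Y T" using tvs_dualI[OF \<phi>(1) V(1)] \<phi>(2) sub by blast
  moreover have "1 < norm (\<phi> y)"
  proof -
    have "1 \<le> c * norm (\<phi> y)" using \<phi>(3) lin_functionalD(2)[OF \<phi>(1) y(1)] c by (simp add: norm_mult)
    moreover have "c * norm (\<phi> y) \<le> c" if "norm (\<phi> y) \<le> 1" using mult_left_mono[OF that, of c] c by simp
    ultimately show ?thesis using c by linarith
  qed
  ultimately show ?thesis using that \<phi>(2) sub by blast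
qed

end

section \<open>The canonical linearisation\<close>

locale bbc_cnc =
  E: lcs fscale F \<tau> + E': lcs fscale F \<tau>'
  for F :: "('a \<Rightarrow> 'k::real_normed_field) set" and \<tau> \<tau>' +
  assumes bornological: "bornological fscale F \<tau>"
    and BBC: "BBC F \<tau> \<tau>'" and CNC: "CNC F \<tau> \<tau>'"
begin

abbreviation "\<B> \<equiv> {B. tvs_bounded fscale F \<tau> B}"
abbreviation "Y \<equiv> Fprime_B F \<tau> \<tau>'"
abbreviation "\<beta> \<equiv> beta_top F \<tau> \<tau>'"

lemma directed_bounded: "directed_family \<B>"
  unfolding directed_family_def using E.tvs_bounded_empty E.tvs_bounded_Un by blast

lemma beta_eq: "\<beta> = pair_topology Y (\<lambda>\<phi> f. \<phi> f) \<B>"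
  unfolding beta_top_def by (rule unif_top_eq[OF directed_bounded])

lemma Y_lin: "\<phi> \<in> Y \<Longrightarrow> lin_functional fscale F \<phi>"
  unfolding Fprime_B_def by blast

lemmas Y_linD = E.lin_functionalD[OF Y_lin]

lemma Y_cont: "\<lbrakk>\<phi> \<in> Y; tvs_bounded fscale F \<tau> B\<rbrakk> \<Longrightarrow> continuous_map (subtopology \<tau>' B) euclidean \<phi>"
  unfolding Fprime_B_def by blast

lemma bounded_hullE:
  assumes "tvs_bounded fscale F \<tau> B"
  obtains K where "B \<subseteq> K" "absconv fscale K" "tvs_bounded fscale F \<tau> K" "compactin \<tau>' K" "K \<subseteq> F" "0 \<in> K"
proof -
  have "tvs_bounded fscale F \<tau> (B \<union> {0})"
    by (intro E.tvs_bounded_Un assms E.tvs_bounded_singleton) simp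
  from BBC[unfolded BBC_def, rule_format, OF this]
  obtain K where K: "B \<union> {0} \<subseteq> K" "absconv fscale K" "tvs_bounded fscale F \<tau> K" "compactin \<tau>' K"
    by blast
  then show ?thesis using that[of K] E.tvs_bounded_subset_space[of K] by simp
qed

text \<open>Continuity on B alone does not bound a functional; on the hull K from (BBC) it does, as
  K is both \<tau>-bounded, which gives continuity, and \<tau>'-compact.\<close>

lemma Y_bounded:
  assumes "\<phi> \<in> Y" "tvs_bounded fscale F \<tau> B"
  shows "\<exists>M. \<forall>f\<in>B. norm (\<phi> f) \<le> M"
proof -
  obtain K where K: "B \<subseteq> K" "tvs_bounded fscale F \<tau> K" "compactin \<tau>' K" using assms(2) bounded_hullE by metis
  have "compactin (subtopology \<tau>' K) K" using K by (simp add: compactin_subtopology)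
  then have "compactin euclidean (\<phi> ` K)" by (rule image_compactin[OF _ Y_cont[OF assms(1) K(2)]])
  then have "bounded (\<phi> ` K)" by (simp add: compact_imp_bounded)
  then show ?thesis using K(1) unfolding bounded_iff by blast
qed

lemma Y_add: assumes "\<phi> \<in> Y" "\<psi> \<in> Y" shows "\<phi> + \<psi> \<in> Y"
  using assms Y_linD[OF assms(1)] Y_linD[OF assms(2)]
  unfolding Fprime_B_def lin_functional_def plus_fun_def
  by (auto simp: algebra_simps intro!: continuous_map_add)

lemma Y_scale: assumes "\<phi> \<in> Y" shows "fscale c \<phi> \<in> Y"
  using assms Y_linD[OF assms]
  unfolding Fprime_B_def lin_functional_def
  by (auto simp: algebra_simps continuous_map_mult_left fscale_def[of c \<phi>])

lemma Y_zero: "0 \<in> Y"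
  unfolding Fprime_B_def lin_functional_def by (simp add: zero_fun_def)

lemma vs_Y: "vs_on fscale Y"
  unfolding vs_on_def using Y_add Y_scale Y_zero
  by (auto simp: fscale_def plus_fun_def algebra_simps)

lemma dual_subset_Y: "tvs_dual fscale F \<tau>' \<subseteq> Y"
  unfolding tvs_dual_def Fprime_B_def by (auto intro: continuous_map_from_subtopology)

lemma closed_zero: "closedin \<tau>' {0}"
  using E'.Hausdorff by (simp add: closedin_Hausdorff_singleton)

text \<open>Since \<tau>' is Hausdorff, \<open>{0}\<close> is a closed absolutely convex set, and f
  can be separated from it by a \<tau>'-continuous functional.\<close>

lemma Y_separates:
  assumes "f \<in> F" "f \<noteq> 0" obtains \<phi> where "\<phi> \<in> Y" "\<phi> f \<noteq> 0"
proof -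
  have "absconv fscale {0 :: 'a \<Rightarrow> 'k}" unfolding absconv_def by simp
  then obtain \<phi> where "\<phi> \<in> tvs_dual fscale F \<tau>'" "1 < norm (\<phi> f)"
    using E'.separation_absconv[of "{0}" f] closed_zero assms by auto
  then show ?thesis using that dual_subset_Y by force
qed

text \<open>From here on unqualified facts concern \<open>Y\<close> with \<open>ptop\<close>, which
  is \<beta> by \<open>beta_eq\<close>; the prefixes \<open>E\<close> and \<open>E'\<close> refer to
  F with \<tau> and \<tau>'.\<close>

sublocale pairing fscale Y "\<lambda>\<phi> f. \<phi> f" \<B>
proof unfold_locales
  show "vs_on fscale Y" by (rule vs_Y)
  fix \<phi> assume \<phi>: "\<phi> \<in> Y" "\<forall>B\<in>\<B>. \<forall>f\<in>B. \<phi> f = 0"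
  show "\<phi> = 0"
  proof (rule ext)
    fix f show "\<phi> f = 0 f"
      using \<phi>(2) E.tvs_bounded_singleton[of f] Y_linD(3)[OF \<phi>(1)] by (cases "f \<in> F") auto
  qed
qed (use directed_bounded Y_bounded in \<open>auto simp: fscale_def\<close>)

lemma polar_absconv: "P \<subseteq> Y \<Longrightarrow> absconv fscale {f \<in> F. \<forall>\<phi>\<in>P. norm (\<phi> f) \<le> e}"
  using Y_lin by (intro E.absconv_polar) blast

lemma eval_in_dual:
  assumes "f \<in> F" shows "evalf Y f \<in> tvs_dual fscale Y ptop"
proof -
  have "continuous_map ptop euclidean (\<lambda>\<phi>. \<phi> f)"
    by (rule continuous_map_pair[OF directed_bounded, of f "{f}"]) (simp_all add: E.tvs_bounded_singleton assms)
  then have "continuous_map ptop euclidean (evalf Y f)"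
    by (rule continuous_map_eq) (simp add: evalf_def directed_bounded)
  then show ?thesis
    unfolding tvs_dual_def lin_functional_def by (simp add: evalf_def)
qed

section \<open>Surjectivity of evaluation onto the dual\<close>

lemma sum_Y_mem: "\<lbrakk>finite \<Phi>; \<Phi> \<subseteq> Y\<rbrakk> \<Longrightarrow> (\<Sum>\<phi>\<in>\<Phi>. fscale (c \<phi>) \<phi>) \<in> Y"
  by (induction rule: finite_induct) auto

lemma sum_Y_apply: "(\<Sum>\<phi>\<in>\<Phi>. fscale (c \<phi>) \<phi>) f = (\<Sum>\<phi>\<in>\<Phi>. c \<phi> * \<phi> f)"
  by (induction \<Phi> rule: infinite_finite_induct) auto

lemma lin_functional_sum_Y:
  assumes "finite \<Phi>" "\<Phi> \<subseteq> Y" and z: "lin_functional fscale Y z"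
  shows "z (\<Sum>\<phi>\<in>\<Phi>. fscale (c \<phi>) \<phi>) = (\<Sum>\<phi>\<in>\<Phi>. c \<phi> * z \<phi>)"
  using assms(1,2) by (induction rule: finite_induct) (auto simp: lin_functionalD[OF z] sum_Y_mem)

text \<open>A minimiser over \<open>K\<close> of the squared distance between \<open>\<phi> \<mapsto> \<phi> f\<close> and \<open>z\<close> on finitely many
  functionals: the first order condition and the polar bound force the distance to vanish.\<close>

lemma interpolate_finite:
  assumes K: "K \<subseteq> F" "absconv fscale K" "tvs_bounded fscale F \<tau> K" "compactin \<tau>' K" "0 \<in> K"
    and z: "lin_functional fscale Y z" "\<And>\<phi>. \<lbrakk>\<phi> \<in> Y; \<forall>f\<in>K. norm (\<phi> f) \<le> 1\<rbrakk> \<Longrightarrow> norm (z \<phi>) \<le> 1"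
    and \<Phi>: "finite \<Phi>" "\<Phi> \<subseteq> Y"
  shows "\<exists>f\<in>K. \<forall>\<phi>\<in>\<Phi>. z \<phi> = \<phi> f"
proof -
  define g where "g = (\<lambda>f. \<Sum>\<phi>\<in>\<Phi>. (norm (z \<phi> - \<phi> f))\<^sup>2)"
  have cont: "continuous_map (subtopology \<tau>' K) euclideanreal g"
    unfolding g_def using \<Phi> Y_cont[OF _ K(3)]
    by (intro continuous_map_sum continuous_map_real_pow continuous_map_norm continuous_map_diff) auto
  have "compactin (subtopology \<tau>' K) K" using K by (simp add: compactin_subtopology)
  from image_compactin[OF this cont] have "compact (g ` K)" by simp
  moreover have "g ` K \<noteq> {}" using K by blast
  ultimately obtain f0 where f0: "f0 \<in> K" "\<And>f. f \<in> K \<Longrightarrow> g f0 \<le> g f"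
    using compact_attains_inf[of "g ` K"] by blast
  define c where "c = (\<lambda>\<phi>. z \<phi> - \<phi> f0)"
  \<comment> \<open>\<open>kre (\<psi> h)\<close> is the real inner product of the residual vector c
    with the values of \<Phi> at h; minimality of f0 says that f0 maximises it over K.\<close>
  define \<psi> where "\<psi> = (\<Sum>\<phi>\<in>\<Phi>. fscale (kcnj (c \<phi>)) \<phi>)"
  have \<psi>: "\<psi> \<in> Y" "\<And>f. \<psi> f = (\<Sum>\<phi>\<in>\<Phi>. kcnj (c \<phi>) * \<phi> f)" "z \<psi> = (\<Sum>\<phi>\<in>\<Phi>. kcnj (c \<phi>) * z \<phi>)"
    unfolding \<psi>_def using \<Phi> by (simp_all only: sum_Y_mem sum_Y_apply lin_functional_sum_Y[OF _ _ z(1)])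
  note \<psi>lin = Y_linD[OF \<psi>(1)]
  have kre_sum: "kre (\<Sum>\<phi>\<in>\<Phi>. h \<phi>) = (\<Sum>\<phi>\<in>\<Phi>. kre (h \<phi>))" for h :: "_ \<Rightarrow> 'k"
    using kre_of_real[of 0, where 'k='k] by (induction \<Phi> rule: infinite_finite_induct) (auto simp: kre_add)
  have first_order: "kre (\<psi> h) \<le> kre (\<psi> f0)" if h: "h \<in> K" for h
  proof -
    define d :: "(('a \<Rightarrow> 'k) \<Rightarrow> 'k) \<Rightarrow> 'k" where "d = (\<lambda>\<phi>. \<phi> h - \<phi> f0)"
    define S D where "S = (\<Sum>\<phi>\<in>\<Phi>. kre (kcnj (c \<phi>) * d \<phi>))" and "D = (\<Sum>\<phi>\<in>\<Phi>. (norm (d \<phi>))\<^sup>2)"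
    have S: "S = kre (\<psi> h) - kre (\<psi> f0)"
      unfolding S_def d_def \<psi>(2) kre_sum by (simp add: right_diff_distrib kre_diff sum_subtractf)
    \<comment> \<open>Moving from f0 towards h inside K changes g by - 2 t S + t^2 D. Divide by t
      and let t tend to 0 to get S \<le> 0.\<close>
    have "2 * S \<le> t * D" if t: "0 < t" "t \<le> 1" for t
    proof -
      define f where "f = fscale (of_real (1 - t)) f0 + fscale (of_real t) h"
      have "f \<in> K" unfolding f_def using t f0 h K by (intro E.absconv_convex) auto
      have "z \<phi> - \<phi> f = c \<phi> - of_real t * d \<phi>" if "\<phi> \<in> \<Phi>" for \<phi>
      proof -
        have "\<phi> \<in> Y" "f0 \<in> F" "h \<in> F" using that \<Phi> f0 h K by auto
        then show ?thesis unfolding f_def c_def d_def by (simp add: Y_linD algebra_simps)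
      qed
      then have "g f = (\<Sum>\<phi>\<in>\<Phi>. (norm (c \<phi>))\<^sup>2 - 2 * t * kre (kcnj (c \<phi>) * d \<phi>) + t\<^sup>2 * (norm (d \<phi>))\<^sup>2)"
        unfolding g_def by (intro sum.cong refl) (simp add: norm_diff_scale_sq)
      also have "\<dots> = g f0 - 2 * t * S + t\<^sup>2 * D"
        unfolding g_def c_def S_def D_def by (simp add: sum.distrib sum_subtractf sum_distrib_left)
      finally have "2 * t * S \<le> t\<^sup>2 * D" using f0(2)[OF \<open>f \<in> K\<close>] by simp
      then show ?thesis using t by (simp add: power2_eq_square)
    qed
    from this[of "1 / real (Suc n)" for n] have "2 * S \<le> (1 / real (Suc n)) * D" for n by simp
    moreover have "(\<lambda>n. (1 / real (Suc n)) * D) \<longlonglongrightarrow> 0 * D"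
      by (intro tendsto_intros LIMSEQ_Suc[OF lim_1_over_n])
    ultimately have "2 * S \<le> 0 * D" using LIMSEQ_le_const by blast
    then show ?thesis using S by simp
  qed
  define M where "M = kre (\<psi> f0)"
  \<comment> \<open>K is balanced, so a rotation of h turns the bound on the real part into one on
    the norm.\<close>
  have M: "norm (\<psi> h) \<le> M" if h: "h \<in> K" for h
  proof -
    obtain u :: 'k where u: "norm u = 1" "u * \<psi> h = of_real (norm (\<psi> h))" by (rule ex_unit_scalar)
    have "fscale u h \<in> K" using E.absconv_balanced[OF K(2,1) h] u by simp
    moreover have "\<psi> (fscale u h) = of_real (norm (\<psi> h))" using \<psi>lin(2) u h K by auto
    ultimately show ?thesis using first_order unfolding M_def by fastforce
  qed
  \<comment> \<open>M may be 0, so \<psi> is normalised by any r > M instead.\<close>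
  have "norm (z \<psi>) \<le> r" if "r > M" for r
  proof -
    have "r > 0" using that M[OF K(5)] norm_ge_zero[of "\<psi> 0"] by linarith
    have "norm (z (fscale (of_real (inverse r)) \<psi>)) \<le> 1"
    proof (rule z(2)[OF Y_scale[OF \<psi>(1)]], intro ballI)
      fix f assume "f \<in> K"
      then have "norm (\<psi> f) \<le> r" using M that by force
      then show "norm (fscale (of_real (inverse r)) \<psi> f) \<le> 1"
        using \<open>r > 0\<close> by (simp add: norm_inverse_scale_le_1)
    qed
    then show ?thesis
      using \<open>r > 0\<close> lin_functionalD(2)[OF z(1) \<psi>(1)] by (simp add: norm_inverse_scale_le_1)
  qed
  then have "norm (z \<psi>) \<le> M" by (rule dense_ge)
  \<comment> \<open>This real part is the sum of the squared residuals, so all of them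
    vanish.\<close>
  then have "kre (z \<psi> - \<psi> f0) \<le> 0" using abs_kre_le[of "z \<psi>"] unfolding kre_diff M_def by linarith
  moreover have "z \<psi> - \<psi> f0 = (\<Sum>\<phi>\<in>\<Phi>. kcnj (c \<phi>) * c \<phi>)"
    unfolding \<psi>(2,3) c_def by (simp add: sum_subtractf right_diff_distrib)
  ultimately have "(\<Sum>\<phi>\<in>\<Phi>. (norm (c \<phi>))\<^sup>2) \<le> 0" by (simp only: kre_sum kcnj_mult_norm kre_of_real)
  moreover have "(\<Sum>\<phi>\<in>\<Phi>. (norm (c \<phi>))\<^sup>2) \<ge> 0" by (simp add: sum_nonneg)
  ultimately have "\<forall>\<phi>\<in>\<Phi>. (norm (c \<phi>))\<^sup>2 = 0" using \<Phi>(1) sum_nonneg_eq_0_iff by (metis (no_types, lifting) antisym zero_le_power2)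
  then show ?thesis using f0(1) unfolding c_def by auto
qed

lemma interpolate:
  assumes K: "K \<subseteq> F" "absconv fscale K" "tvs_bounded fscale F \<tau> K" "compactin \<tau>' K" "0 \<in> K"
    and z: "lin_functional fscale Y z" "\<And>\<phi>. \<lbrakk>\<phi> \<in> Y; \<forall>f\<in>K. norm (\<phi> f) \<le> 1\<rbrakk> \<Longrightarrow> norm (z \<phi>) \<le> 1"
  shows "\<exists>f\<in>K. \<forall>\<phi>\<in>Y. z \<phi> = \<phi> f"
proof -
  let ?X = "subtopology \<tau>' K"
  have top: "topspace ?X = K" using K(1) by auto
  have X: "compact_space ?X" using K(4) by (simp add: compact_space_subtopology)
  define C where "C = (\<lambda>\<phi>. {f \<in> K. \<phi> f = z \<phi>})"
  have "closedin ?X (C \<phi>)" if "\<phi> \<in> Y" for \<phi>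
    using closedin_continuous_map_preimage[OF Y_cont[OF that K(3)], of "{z \<phi>}"]
    unfolding top by (simp add: C_def)
  moreover have "\<Inter>\<F> \<noteq> {}" if fin: "finite \<F>" "\<F> \<subseteq> C ` Y" for \<F>
  proof -
    obtain \<Phi> where "finite \<Phi>" "\<Phi> \<subseteq> Y" "\<F> = C ` \<Phi>" using finite_subset_image[OF fin] by blast
    then obtain f where "f \<in> K" "\<forall>\<phi>\<in>\<Phi>. z \<phi> = \<phi> f" using interpolate_finite[OF K z, of \<Phi>] by blast
    then have "f \<in> \<Inter>\<F>" using \<open>\<F> = C ` \<Phi>\<close> by (auto simp: C_def)
    then show ?thesis by blast
  qed
  ultimately have "\<Inter>(C ` Y) \<noteq> {}"
    by (intro X[unfolded compact_space_fip, rule_format]) auto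
  then obtain f where f: "\<And>\<phi>. \<phi> \<in> Y \<Longrightarrow> f \<in> C \<phi>" by blast
  \<comment> \<open>The zero functional makes the family of sets nonempty, so its intersection lies
    in K.\<close>
  then have "f \<in> K" using Y_zero unfolding C_def by blast
  moreover have "z \<phi> = \<phi> f" if "\<phi> \<in> Y" for \<phi> using f[OF that] by (simp add: C_def)
  ultimately show ?thesis by blast
qed

lemma dual_eq_eval: "tvs_dual fscale Y ptop = evalf Y ` F"
proof
  show "evalf Y ` F \<subseteq> tvs_dual fscale Y ptop" using eval_in_dual by blast
  show "tvs_dual fscale Y ptop \<subseteq> evalf Y ` F"
  proof
    fix z assume z: "z \<in> tvs_dual fscale Y ptop"
    note zl = lin_functionalD[OF tvs_dual_lin[OF z]]
    have "nbhd0 ptop {\<phi> \<in> Y. norm (z \<phi>) \<le> 1}" by (rule tvs_dual_nbhd0[OF z]) simp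
    then obtain B e where B: "B \<in> \<B>" "e > 0" "{\<phi> \<in> Y. \<forall>f\<in>B. norm (\<phi> f) \<le> e} \<subseteq> {\<phi> \<in> Y. norm (z \<phi>) \<le> 1}"
      by (rule nbhd0_pairE)
    \<comment> \<open>Enlarging B to K shrinks the polar, so z stays bounded on it; multiplying by e
      normalises the bound to 1.\<close>
    obtain K where K: "B \<subseteq> K" "absconv fscale K" "tvs_bounded fscale F \<tau> K" "compactin \<tau>' K" "K \<subseteq> F" "0 \<in> K"
      using bounded_hullE B(1) by blast
    have bd: "norm (fscale (of_real e) z \<phi>) \<le> 1" if "\<phi> \<in> Y" "\<forall>f\<in>K. norm (\<phi> f) \<le> 1" for \<phi>
    proof -
      have "fscale (of_real e) \<phi> \<in> {\<phi> \<in> Y. \<forall>f\<in>B. norm (\<phi> f) \<le> e}"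
        using that K(1) B(2) Y_scale by (auto simp: fscale_def norm_mult mult_left_le subsetD)
      then have "norm (z (fscale (of_real e) \<phi>)) \<le> 1" using B(3) by blast
      then show ?thesis using zl(2)[OF that(1)] by simp
    qed
    have lin: "lin_functional fscale Y (fscale (of_real e) z)"
      using zl unfolding lin_functional_def by (auto simp: fscale_def algebra_simps)
    obtain f where f: "f \<in> K" "\<forall>\<phi>\<in>Y. fscale (of_real e) z \<phi> = \<phi> f"
      using interpolate[OF K(5,2,3,4,6) lin bd] by blast
    have fF: "f \<in> F" using f K by blast
    have "z = evalf Y (fscale (of_real (inverse e)) f)"
    proof (rule ext)
      fix \<phi>
      show "z \<phi> = evalf Y (fscale (of_real (inverse e)) f) \<phi>"
      proof (cases "\<phi> \<in> Y")
        case True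
        then have "\<phi> f = of_real e * z \<phi>" using f(2) by simp
        then show ?thesis using True B(2) Y_linD(2)[OF True fF] by (simp add: evalf_def)
      next
        case False then show ?thesis using zl(3) by (simp add: evalf_def)
      qed
    qed
    moreover have "fscale (of_real (inverse e)) f \<in> F" by (rule E.scale_mem[OF fF])
    ultimately show "z \<in> evalf Y ` F" by blast
  qed
qed

section \<open>Evaluation as a topological isomorphism onto the strong dual\<close>

lemma inj_eval: "inj_on (evalf Y) F"
proof (rule inj_onI, rule ccontr)
  fix f g assume fg: "f \<in> F" "g \<in> F" "evalf Y f = evalf Y g" "f \<noteq> g"
  then obtain \<phi> where \<phi>: "\<phi> \<in> Y" "\<phi> (f - g) \<noteq> 0" using Y_separates[of "f - g"] by auto
  then show False using fun_cong[OF fg(3), of \<phi>] fg Y_linD(6)[OF \<phi>(1)] by (simp add: evalf_def)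
qed

text \<open>Bornologicity is what makes the polars of \<open>\<beta>\<close>-bounded sets neighbourhoods of \<open>0\<close>.\<close>

lemma nbhd0_polar:
  assumes M: "tvs_bounded fscale Y ptop M" and "e > 0"
  shows "nbhd0 \<tau> {f \<in> F. \<forall>\<phi>\<in>M. norm (\<phi> f) \<le> e}" (is "nbhd0 \<tau> ?V")
proof -
  have MY: "M \<subseteq> Y" using M tvs_bounded_subset_space by blast
  have "absorbs fscale ?V B" if B: "tvs_bounded fscale F \<tau> B" for B
  proof -
    obtain R where R: "R > 0" "\<And>\<phi> f. \<lbrakk>\<phi> \<in> M; f \<in> B\<rbrakk> \<Longrightarrow> norm (\<phi> f) \<le> R"
      using tvs_bounded_pair[OF M, of B] B by blast
    have BF: "B \<subseteq> F" using B E.tvs_bounded_subset_space by blast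
    show ?thesis
    proof (rule E.absconv_absorbsI[of _ _ "of_real (e / R)"])
      fix f assume f: "f \<in> B"
      have "norm (\<phi> (fscale (of_real (e / R)) f)) \<le> e" if "\<phi> \<in> M" for \<phi>
      proof -
        have "norm (\<phi> (fscale (of_real (e / R)) f)) = (e / R) * norm (\<phi> f)"
          using that MY f BF R(1) \<open>e > 0\<close> Y_linD(2)[of \<phi> f] by (auto simp: norm_mult norm_divide subsetD)
        also have "\<dots> \<le> (e / R) * R" using R(2)[OF that f] R(1) \<open>e > 0\<close> by (intro mult_left_mono) auto
        finally show ?thesis using R(1) by simp
      qed
      then show "fscale (of_real (e / R)) f \<in> ?V" using f BF by auto
    qed (use polar_absconv[OF MY] BF R(1) \<open>e > 0\<close> in auto)
  qed
  then show ?thesis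
    using bornological[unfolded bornological_def, rule_format, of ?V] polar_absconv[OF MY] by simp
qed

text \<open>The bipolar argument: M is the polar of a \<tau>'-closed V supplied by (CNC). It is
  \<beta>-bounded because V absorbs the \<tau>-bounded sets, and a point outside V is detected by a
  \<tau>'-continuous functional bounded by 1 on V, which belongs to M.\<close>

lemma polar_subset_nbhd0:
  assumes "nbhd0 \<tau> U"
  obtains M where "tvs_bounded fscale Y ptop M" "{f \<in> F. \<forall>\<phi>\<in>M. norm (\<phi> f) \<le> 1} \<subseteq> U"
proof -
  obtain W where "openin \<tau> W" "0 \<in> W" "W \<subseteq> U" using assms unfolding nbhd0_def by blast
  then obtain V where V: "V \<subseteq> U" "absconv fscale V" "closedin \<tau>' V" "nbhd0 \<tau> V"
    using CNC unfolding CNC_def by (meson order_trans)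
  have VF: "V \<subseteq> F" using closedin_subset[OF V(3)] by simp
  define M where "M = {\<phi> \<in> Y. \<forall>f\<in>V. norm (\<phi> f) \<le> 1}"
  have "tvs_bounded fscale Y ptop M"
  proof (rule tvs_bounded_pairI)
    fix B assume "B \<in> \<B>"
    then have "absorbs fscale V B" "B \<subseteq> F" using E.tvs_bounded_absorbs V(4) E.tvs_bounded_subset_space by auto
    then obtain t where t: "t > 0" "\<And>f. f \<in> B \<Longrightarrow> fscale (of_real (inverse t)) f \<in> V"
      using E.absorbsE VF by blast
    have "norm (\<phi> f) \<le> t" if "\<phi> \<in> M" "f \<in> B" for \<phi> f
    proof -
      have "norm (\<phi> (fscale (of_real (inverse t)) f)) \<le> 1" using that t(2) unfolding M_def by blast
      then show ?thesis using that \<open>B \<subseteq> F\<close> t(1) Y_linD(2)[of \<phi> f] unfolding M_def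
        by (auto simp: norm_inverse_scale_le_1 subsetD)
    qed
    then show "\<exists>R. \<forall>\<phi>\<in>M. \<forall>f\<in>B. norm (\<phi> f) \<le> R" by blast
  qed (simp add: M_def)
  moreover have "{f \<in> F. \<forall>\<phi>\<in>M. norm (\<phi> f) \<le> 1} \<subseteq> V"
  proof (rule subsetI, rule ccontr)
    fix f assume f: "f \<in> {f \<in> F. \<forall>\<phi>\<in>M. norm (\<phi> f) \<le> 1}" "f \<notin> V"
    have "V \<noteq> {}" using nbhd0_zero[OF V(4)] by blast
    then obtain \<phi> where \<phi>: "\<phi> \<in> tvs_dual fscale F \<tau>'" "\<And>x. x \<in> V \<Longrightarrow> norm (\<phi> x) \<le> 1" "1 < norm (\<phi> f)"
      using E'.separation_absconv[OF V(2) VF V(3)] f by blast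
    then have "\<phi> \<in> M" using dual_subset_Y unfolding M_def by blast
    then show False using f \<phi>(3) by force
  qed
  ultimately show ?thesis using that V(1) by blast
qed

abbreviation "SD \<equiv> strong_dual fscale Y ptop"

lemma directed_beta_bounded: "directed_family {M. tvs_bounded fscale Y ptop M}"
  unfolding directed_family_def using tvs_bounded_empty tvs_bounded_Un by blast

lemma strong_dual_eq:
  "SD = pair_topology (tvs_dual fscale Y ptop) (\<lambda>\<psi> \<phi>. \<psi> \<phi>) {M. tvs_bounded fscale Y ptop M}"
  unfolding strong_dual_def by (rule unif_top_eq[OF directed_beta_bounded])

lemmas openin_strong_dual =
  openin_pair_topology[OF directed_beta_bounded, where Y = "tvs_dual fscale Y ptop" and b = "\<lambda>\<psi> \<phi>. \<psi> \<phi>", folded strong_dual_eq]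

lemma topspace_strong_dual: "topspace SD = tvs_dual fscale Y ptop"
  unfolding strong_dual_eq by (rule topspace_pair_topology[OF directed_beta_bounded])

lemma eval_diff: "\<lbrakk>f \<in> F; g \<in> F; \<phi> \<in> Y\<rbrakk> \<Longrightarrow> evalf Y g \<phi> - evalf Y f \<phi> = \<phi> (g - f)"
  by (simp add: evalf_def Y_linD(6))

lemma homeomorphic_eval: "homeomorphic_map \<tau> SD (evalf Y)"
proof (rule bijective_open_imp_homeomorphic_map)
  have dual: "evalf Y f \<in> topspace SD" if "f \<in> F" for f
    using that unfolding topspace_strong_dual by (rule eval_in_dual)
  show "continuous_map \<tau> SD (evalf Y)"
    unfolding continuous_map_def
  proof (intro conjI allI impI)
    show "evalf Y \<in> topspace \<tau> \<rightarrow> topspace SD" using dual by simp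
    fix U assume U: "openin SD U"
    show "openin \<tau> {f \<in> topspace \<tau>. evalf Y f \<in> U}"
      unfolding E.openin_iff
    proof (intro conjI ballI)
      fix f assume f: "f \<in> {f \<in> topspace \<tau>. evalf Y f \<in> U}"
      then obtain M e where M: "tvs_bounded fscale Y ptop M" "e > 0"
        "\<And>\<psi>. \<lbrakk>\<psi> \<in> tvs_dual fscale Y ptop; \<forall>\<phi>\<in>M. norm (\<psi> \<phi> - evalf Y f \<phi>) \<le> e\<rbrakk> \<Longrightarrow> \<psi> \<in> U"
        using U unfolding openin_strong_dual by blast
      have MY: "M \<subseteq> Y" using M tvs_bounded_subset_space by blast
      let ?V = "{g \<in> F. \<forall>\<phi>\<in>M. norm (\<phi> g) \<le> e}"
      have "f + g \<in> {f \<in> topspace \<tau>. evalf Y f \<in> U}" if g: "g \<in> ?V" for g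
      proof -
        have "evalf Y (f + g) \<phi> - evalf Y f \<phi> = \<phi> g" if "\<phi> \<in> M" for \<phi>
          using eval_diff[of f "f + g" \<phi>] f g that MY by auto
        then have "evalf Y (f + g) \<in> U" using f g by (intro M(3) eval_in_dual) auto
        then show ?thesis using f g by simp
      qed
      then show "\<exists>V. nbhd0 \<tau> V \<and> V \<subseteq> F \<and> absconv fscale V \<and> (\<forall>v\<in>V. f + v \<in> {f \<in> topspace \<tau>. evalf Y f \<in> U})"
        using nbhd0_polar[OF M(1,2)] polar_absconv[OF MY] by (intro exI[of _ ?V]) blast
    qed auto
  qed
  show "open_map \<tau> SD (evalf Y)"
    unfolding open_map_def
  proof (intro allI impI)
    fix U assume U: "openin \<tau> U"
    then have UF: "U \<subseteq> F" using openin_subset by force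
    show "openin SD (evalf Y ` U)"
      unfolding openin_strong_dual
    proof (intro conjI ballI)
      show "evalf Y ` U \<subseteq> tvs_dual fscale Y ptop" using UF eval_in_dual by blast
      fix \<xi> assume "\<xi> \<in> evalf Y ` U"
      then obtain f where f: "f \<in> U" "\<xi> = evalf Y f" by blast
      then obtain V where V: "nbhd0 \<tau> V" "\<And>v. v \<in> V \<Longrightarrow> f + v \<in> U"
        using U unfolding E.openin_iff by blast
      obtain M where M: "tvs_bounded fscale Y ptop M" "{f \<in> F. \<forall>\<phi>\<in>M. norm (\<phi> f) \<le> 1} \<subseteq> V"
        by (rule polar_subset_nbhd0[OF V(1)])
      have MY: "M \<subseteq> Y" using M tvs_bounded_subset_space by blast
      have "\<psi> \<in> evalf Y ` U" if \<psi>: "\<psi> \<in> tvs_dual fscale Y ptop" "\<forall>\<phi>\<in>M. norm (\<psi> \<phi> - \<xi> \<phi>) \<le> 1" for \<psi>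
      proof -
        \<comment> \<open>Openness relies on surjectivity: every functional near \<xi> is again an
          evaluation.\<close>
        obtain g where g: "g \<in> F" "\<psi> = evalf Y g" using \<psi>(1) unfolding dual_eq_eval by blast
        have "norm (\<phi> (g - f)) \<le> 1" if "\<phi> \<in> M" for \<phi>
          using \<psi>(2) that eval_diff[of f g \<phi>] g f UF MY by fastforce
        then have "g - f \<in> V" using g f UF by (intro subsetD[OF M(2)]) auto
        then have "g \<in> U" using V(2)[of "g - f"] by simp
        then show ?thesis using g by blast
      qed
      then show "\<exists>M\<in>{M. tvs_bounded fscale Y ptop M}. \<exists>e>0. \<forall>\<psi>\<in>tvs_dual fscale Y ptop.
          (\<forall>\<phi>\<in>M. norm (\<psi> \<phi> - \<xi> \<phi>) \<le> e) \<longrightarrow> \<psi> \<in> evalf Y ` U"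
        using M(1) by (intro bexI[of _ M] exI[of _ 1]) auto
    qed
  qed
  show "evalf Y ` topspace \<tau> = topspace SD" unfolding topspace_strong_dual dual_eq_eval by simp
  show "inj_on (evalf Y) (topspace \<tau>)" using inj_eval by simp
qed

section \<open>Completeness and barrelledness of the predual\<close>

text \<open>Continuity is required on each bounded set separately, so approximation that is uniform
  on each of them suffices. It serves for limits of Cauchy filters and for the series in
  \<open>banach_mackey\<close>.\<close>

lemma uniform_limit_in_Y:
  assumes l: "lin_functional fscale F l"
    and lim: "\<And>B e. \<lbrakk>tvs_bounded fscale F \<tau> B; e > 0\<rbrakk> \<Longrightarrow> \<exists>\<phi>\<in>Y. \<forall>f\<in>B. norm (\<phi> f - l f) \<le> e"
  shows "l \<in> Y"
proof -
  have "continuous_map (subtopology \<tau>' B) euclidean l" if B: "tvs_bounded fscale F \<tau> B" for B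
    unfolding continuous_map_euclidean_field_iff
  proof (intro ballI allI impI)
    fix f and e :: real assume f: "f \<in> topspace (subtopology \<tau>' B)" and e: "e > 0"
    \<comment> \<open>Two approximation errors and one oscillation, each at most e/4, stay strictly
      below e.\<close>
    obtain \<phi> where \<phi>: "\<phi> \<in> Y" "\<forall>f\<in>B. norm (\<phi> f - l f) \<le> e/4" using lim[OF B, of "e/4"] e by auto
    obtain U where U: "openin (subtopology \<tau>' B) U" "f \<in> U" "\<forall>g\<in>U. dist (\<phi> f) (\<phi> g) < e/4"
      using Y_cont[OF \<phi>(1) B] f e unfolding continuous_map_euclidean_field_iff by (metis zero_less_divide_iff zero_less_numeral)
    have "dist (l f) (l g) < e" if g: "g \<in> U" for g
    proof -
      have "f \<in> B" "g \<in> B" using f g openin_subset[OF U(1)] by auto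
      then have "norm (\<phi> f - l f) \<le> e/4" "norm (\<phi> g - l g) \<le> e/4" using \<phi>(2) by auto
      then have "dist (\<phi> f) (l f) \<le> e/4" "dist (\<phi> g) (l g) \<le> e/4" by (simp_all add: dist_norm)
      moreover have "dist (\<phi> f) (\<phi> g) < e/4" using U g by blast
      moreover have "dist (l f) (l g) \<le> dist (\<phi> f) (l f) + dist (\<phi> f) (\<phi> g) + dist (\<phi> g) (l g)"
        using dist_triangle3[of "l f" "l g" "\<phi> f"] dist_triangle[of "\<phi> f" "l g" "\<phi> g"] by linarith
      ultimately show ?thesis using e by linarith
    qed
    then show "\<exists>U. openin (subtopology \<tau>' B) U \<and> f \<in> U \<and> (\<forall>g\<in>U. dist (l f) (l g) < e)"
      using U by blast
  qed
  then show ?thesis using l unfolding Fprime_B_def by blast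
qed

lemma complete_ptop: "tvs_complete Y ptop"
  unfolding tvs_complete_def
proof (intro allI impI)
  fix G assume "tvs_cauchy Y ptop G"
  then have G: "G \<noteq> bot" "eventually (\<lambda>\<phi>. \<phi> \<in> Y) G"
    and cau: "\<And>U. \<lbrakk>openin ptop U; 0 \<in> U\<rbrakk> \<Longrightarrow> eventually (\<lambda>p. fst p - snd p \<in> U) (G \<times>\<^sub>F G)"
    unfolding tvs_cauchy_def by auto
  have unif: "\<exists>P. eventually P G \<and> (\<forall>\<phi> \<psi>. P \<phi> \<longrightarrow> P \<psi> \<longrightarrow> \<phi> \<in> Y \<and> (\<forall>f\<in>B. norm (\<phi> f - \<psi> f) \<le> e))"
    if B: "B \<in> \<B>" and e: "e > 0" for B e
  proof -
    obtain U where U: "openin ptop U" "0 \<in> U" "U \<subseteq> {\<phi> \<in> Y. \<forall>f\<in>B. norm (\<phi> f) \<le> e}"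
      using nbhd0_pair[OF B e] unfolding nbhd0_def by blast
    obtain P where P: "eventually P G" "\<And>\<phi> \<psi>. P \<phi> \<Longrightarrow> P \<psi> \<Longrightarrow> \<phi> - \<psi> \<in> U"
      using cau[OF U(1,2)] unfolding eventually_prod_same by auto
    have "eventually (\<lambda>\<phi>. P \<phi> \<and> \<phi> \<in> Y) G" using P(1) G(2) by (rule eventually_conj)
    moreover have "norm (\<phi> f - \<psi> f) \<le> e" if "P \<phi>" "P \<psi>" "f \<in> B" for \<phi> \<psi> f
      using subsetD[OF U(3) P(2)[OF that(1,2)]] that(3) by simp
    ultimately show ?thesis by blast
  qed
  have "\<exists>c. ((\<lambda>\<phi>. \<phi> f) \<longlongrightarrow> c) G" if f: "f \<in> F" for f
  proof -
    have "cauchy_filter (filtermap (\<lambda>\<phi>. \<phi> f) G)"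
      unfolding cauchy_filter_metric_filtermap
    proof (intro allI impI)
      fix e :: real assume "e > 0"
      then obtain P where P: "eventually P G" "\<forall>\<phi> \<psi>. P \<phi> \<longrightarrow> P \<psi> \<longrightarrow> \<phi> \<in> Y \<and> (\<forall>f\<in>{f}. norm (\<phi> f - \<psi> f) \<le> e/2)"
        using unif[of "{f}" "e/2"] E.tvs_bounded_singleton[OF f] by auto
      then show "\<exists>P. eventually P G \<and> (\<forall>x y. P x \<and> P y \<longrightarrow> dist (x f) (y f) < e)"
        using \<open>e > 0\<close> by (intro exI[of _ P]) (fastforce simp: dist_norm)
    qed
    from cauchy_filter_complete_converges[OF this complete_field]
    obtain c where "filtermap (\<lambda>\<phi>. \<phi> f) G \<le> nhds c"
      using G(1) by (auto simp: filtermap_bot_iff)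
    then show ?thesis unfolding filterlim_def by blast
  qed
  then obtain l0 where l0: "\<And>f. f \<in> F \<Longrightarrow> ((\<lambda>\<phi>. \<phi> f) \<longlongrightarrow> l0 f) G" by metis
  \<comment> \<open>Linear functionals in \<open>lin_functional\<close> vanish off the
    carrier.\<close>
  define l where "l = (\<lambda>f. if f \<in> F then l0 f else 0)"
  have l: "((\<lambda>\<phi>. \<phi> f) \<longlongrightarrow> l f) G" if "f \<in> F" for f using l0[OF that] that by (simp add: l_def)
  have "l (f + g) = l f + l g" if "f \<in> F" "g \<in> F" for f g
  proof (rule tendsto_unique[OF G(1)])
    show "((\<lambda>\<phi>. \<phi> (f + g)) \<longlongrightarrow> l (f + g)) G" using that by (intro l) simp
    show "((\<lambda>\<phi>. \<phi> (f + g)) \<longlongrightarrow> l f + l g) G"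
      by (rule Lim_transform_eventually[OF tendsto_add[OF l[OF that(1)] l[OF that(2)]]])
        (use G(2) in eventually_elim, use that Y_linD(1) in auto)
  qed
  moreover have "l (fscale c f) = c * l f" if "f \<in> F" for c f
  proof (rule tendsto_unique[OF G(1)])
    show "((\<lambda>\<phi>. \<phi> (fscale c f)) \<longlongrightarrow> l (fscale c f)) G" using that by (intro l) simp
    show "((\<lambda>\<phi>. \<phi> (fscale c f)) \<longlongrightarrow> c * l f) G"
      by (rule Lim_transform_eventually[OF tendsto_mult_left[OF l[OF that], of c]])
        (use G(2) in eventually_elim, use that Y_linD(2) in auto)
  qed
  ultimately have lin: "lin_functional fscale F l" unfolding lin_functional_def by (simp add: l_def)
  have close: "eventually (\<lambda>\<phi>. \<phi> \<in> Y \<and> (\<forall>f\<in>B. norm (\<phi> f - l f) \<le> e)) G" if B: "B \<in> \<B>" and e: "e > 0" for B e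
  proof -
    obtain P where P: "eventually P G" "\<And>\<phi> \<psi> f. \<lbrakk>P \<phi>; P \<psi>; f \<in> B\<rbrakk> \<Longrightarrow> norm (\<phi> f - \<psi> f) \<le> e" "\<And>\<phi>. P \<phi> \<Longrightarrow> \<phi> \<in> Y"
      using unif[OF B e] by blast
    \<comment> \<open>With \<phi> fixed, \<psi> runs along the filter: pairwise closeness becomes
      closeness to the limit, still uniformly on B.\<close>
    have "norm (\<phi> f - l f) \<le> e" if "P \<phi>" "f \<in> B" for \<phi> f
    proof -
      have "f \<in> F" using that B E.tvs_bounded_subset_space by blast
      have "((\<lambda>\<psi>. norm (\<phi> f - \<psi> f)) \<longlongrightarrow> norm (\<phi> f - l f)) G" by (intro tendsto_intros l[OF \<open>f \<in> F\<close>])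
      then show ?thesis
        by (rule tendsto_upperbound) (use P(1) in eventually_elim, use P(2) that G(1) in auto)
    qed
    then show ?thesis using P(3) by (intro eventually_mono[OF P(1)]) auto
  qed
  have lY: "l \<in> Y"
  proof (rule uniform_limit_in_Y[OF lin])
    fix B and e :: real assume "tvs_bounded fscale F \<tau> B" "e > 0"
    then show "\<exists>\<phi>\<in>Y. \<forall>f\<in>B. norm (\<phi> f - l f) \<le> e"
      using eventually_happens'[OF G(1) close[of B e]] by blast
  qed
  have "limitin ptop id l G"
    unfolding limitin_def
  proof (intro conjI allI impI)
    show "l \<in> topspace ptop" using lY by simp
    fix U assume U: "openin ptop U \<and> l \<in> U"
    then obtain B e where B: "B \<in> \<B>" "e > 0" "\<And>\<phi>. \<lbrakk>\<phi> \<in> Y; \<forall>f\<in>B. norm (\<phi> f - l f) \<le> e\<rbrakk> \<Longrightarrow> \<phi> \<in> U"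
      unfolding openin_ptop by blast
    show "eventually (\<lambda>\<phi>. id \<phi> \<in> U) G"
      by (rule eventually_mono[OF close[OF B(1,2)]]) (use B(3) in auto)
  qed
  then show "\<exists>l. limitin ptop id l G" by blast
qed

text \<open>The Banach--Mackey theorem by a gliding hump: if the bound fails, the signed series
  \<open>\<Sum> \<plusminus> \<phi>\<^sub>n / 3^n\<close>, whose signs are chosen so that the \<open>n\<close>-th term is not cancelled
  by the preceding ones, converges to a functional that is unbounded on \<open>B\<close>.\<close>

lemma banach_mackey:
  assumes M: "tvs_bounded fscale Y ptop M"
    and B: "B \<subseteq> F" "\<And>\<phi>. \<phi> \<in> Y \<Longrightarrow> \<exists>R. \<forall>f\<in>B. norm (\<phi> f) \<le> R"
  shows "\<exists>R. \<forall>f\<in>B. \<forall>\<phi>\<in>M. norm (\<phi> f) \<le> R"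
proof (rule ccontr)
  assume unb: "\<not> ?thesis"
  have MY: "M \<subseteq> Y" using M tvs_bounded_subset_space by blast
  have bound: "\<exists>R>0. \<forall>g\<in>A. \<forall>\<psi>\<in>M. norm (\<psi> g) \<le> R" if A: "tvs_bounded fscale F \<tau> A" for A
  proof -
    obtain R where "R > 0" "\<And>\<psi> g. \<lbrakk>\<psi> \<in> M; g \<in> A\<rbrakk> \<Longrightarrow> norm (\<psi> g) \<le> R"
      by (rule tvs_bounded_pair[OF M, of A]) (use A in auto)
    then show ?thesis by blast
  qed
  \<comment> \<open>The values of M at f have a finite supremum since \<open>{f}\<close> is bounded.
    A functional within the factor 2/3 of it can serve to estimate all other terms at f.\<close>
  have "\<exists>f\<in>B. \<exists>\<phi>\<in>M. r < norm (\<phi> f) \<and> (\<forall>\<psi>\<in>M. norm (\<psi> f) \<le> 3/2 * norm (\<phi> f))" if r: "r > 0" for r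
  proof -
    obtain f \<phi> where f: "f \<in> B" "\<phi> \<in> M" "r < norm (\<phi> f)" using unb by (meson not_le_imp_less)
    obtain R where R: "\<And>\<psi>. \<psi> \<in> M \<Longrightarrow> norm (\<psi> f) \<le> R"
      using bound[OF E.tvs_bounded_singleton[of f]] f B(1) by blast
    define S where "S = (SUP \<psi>\<in>M. norm (\<psi> f))"
    have bdd: "bdd_above ((\<lambda>\<psi>. norm (\<psi> f)) ` M)" using R by (rule bdd_aboveI2)
    have le: "norm (\<psi> f) \<le> S" if "\<psi> \<in> M" for \<psi> unfolding S_def using that bdd by (rule cSUP_upper)
    have "r < S" using le[OF f(2)] f(3) by simp
    then have "max r (2/3 * S) < S" using r by simp
    then obtain \<psi> where "\<psi> \<in> M" "max r (2/3 * S) < norm (\<psi> f)"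
      unfolding S_def using less_cSUP_iff[OF _ bdd] f(2) by blast
    then show ?thesis using f(1) le by (intro bexI[of _ f] bexI[of _ \<psi>]) fastforce+
  qed
  then have "\<forall>n::nat. \<exists>f \<phi>. f \<in> B \<and> \<phi> \<in> M \<and> 4^n < norm (\<phi> f) \<and> (\<forall>\<psi>\<in>M. norm (\<psi> f) \<le> 3/2 * norm (\<phi> f))"
    by (meson zero_less_numeral zero_less_power)
  then obtain f \<phi> where f: "\<And>n::nat. f n \<in> B" and \<phi>: "\<And>n. \<phi> n \<in> M" "\<And>n. 4^n < norm (\<phi> n (f n))"
    "\<And>n \<psi>. \<psi> \<in> M \<Longrightarrow> norm (\<psi> (f n)) \<le> 3/2 * norm (\<phi> n (f n))"
    by metis
  \<comment> \<open>The weights after the n-th add up to half of 1/3^n; with the factor 3/2 from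
    near-maximality, the later terms at f n amount to at most 3/4 of the hump Q/3^n, where Q =
    \<open>norm (\<phi> n (f n))\<close>. At least a quarter of the hump survives, and it exceeds
    (4/3)^n / 4 because Q > 4^n.\<close>
  define z where "z = (\<lambda>n. fscale (of_real (1/3^n)) (\<phi> n))"
  define y where "y = rec_nat (0 :: ('a \<Rightarrow> 'k) \<Rightarrow> 'k)
     (\<lambda>n x. if norm (z n (f n)) \<le> norm ((x + z n) (f n)) then x + z n else x - z n)"
  have y0: "y 0 = 0" by (simp add: y_def)
  have ySuc: "y (Suc n) = y n + z n \<or> y (Suc n) = y n - z n" for n by (simp add: y_def)
  \<comment> \<open>Since \<open>2 * norm b \<le> norm (a + b) + norm (a - b)\<close>, one of the
    two signs does not lose the size of b.\<close>
  have hump: "norm (z n (f n)) \<le> norm (y (Suc n) (f n))" for n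
  proof (cases "norm (z n (f n)) \<le> norm ((y n + z n) (f n))")
    case True then show ?thesis by (simp add: y_def)
  next
    case False
    then have "y (Suc n) (f n) = y n (f n) - z n (f n)" "norm (y n (f n) + z n (f n)) < norm (z n (f n))"
      by (simp_all add: y_def)
    moreover have "2 * norm (z n (f n)) \<le> norm (y n (f n) + z n (f n)) + norm (y n (f n) - z n (f n))"
      using norm_triangle_ineq4[of "y n (f n) + z n (f n)" "y n (f n) - z n (f n)"]
      by (simp add: norm_mult mult_2[symmetric])
    ultimately show ?thesis by simp
  qed
  have zY: "z n \<in> Y" for n using subsetD[OF MY \<phi>(1)] unfolding z_def by (rule Y_scale)
  have yY: "y n \<in> Y" for n by (induction n) (use y0 ySuc zY in \<open>metis zero_mem add_mem diff_mem\<close>)+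
  have increment: "norm (y (Suc n) g - y n g) \<le> R / 3^n" if R: "\<And>\<psi>. \<psi> \<in> M \<Longrightarrow> norm (\<psi> g) \<le> R" for g R n
  proof -
    have "y (Suc n) g - y n g = z n g \<or> y (Suc n) g - y n g = - z n g" using ySuc[of n] by auto
    then have "norm (y (Suc n) g - y n g) = norm (z n g)" by (metis norm_minus_cancel)
    also have "\<dots> = norm (\<phi> n g) / 3^n" by (simp add: z_def norm_divide norm_power)
    also have "\<dots> \<le> R / 3^n" using R[OF \<phi>(1)] by (intro divide_right_mono) auto
    finally show ?thesis .
  qed
  have tail: "norm (y m g - y n g) \<le> 3/2 * R / 3^n" if "n \<le> m" and R: "\<And>\<psi>. \<psi> \<in> M \<Longrightarrow> norm (\<psi> g) \<le> R" for g R m n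
  proof -
    \<comment> \<open>The exact geometric sum, sharper than needed, is what the induction can
      carry.\<close>
    have "norm (y m g - y n g) \<le> 3/2 * R * (1/3^n - 1/3^m)"
      using \<open>n \<le> m\<close>
    proof (induction m rule: dec_induct)
      case (step m)
      have "norm (y (Suc m) g - y n g) \<le> norm (y (Suc m) g - y m g) + norm (y m g - y n g)"
        using norm_triangle_ineq[of "y (Suc m) g - y m g" "y m g - y n g"] by simp
      also have "\<dots> \<le> R / 3^m + 3/2 * R * (1/3^n - 1/3^m)"
        using increment[OF R] step.IH by (rule add_mono)
      also have "\<dots> = 3/2 * R * (1/3^n - 1/3^Suc m)" by (simp add: field_simps)
      finally show ?case .
    qed simp
    also have "\<dots> \<le> 3/2 * R * (1/3^n)"
      using order_trans[OF norm_ge_zero R[OF \<phi>(1)]] by (intro mult_left_mono) auto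
    finally show ?thesis by simp
  qed
  have "\<exists>c. (\<lambda>n. y n g) \<longlonglongrightarrow> c" if g: "g \<in> F" for g
  proof -
    obtain R where R: "R > 0" "\<And>\<psi>. \<psi> \<in> M \<Longrightarrow> norm (\<psi> g) \<le> R"
      using bound[OF E.tvs_bounded_singleton[OF g]] by blast
    have "Cauchy (\<lambda>n. y n g)"
    proof (rule CauchyI')
      fix e :: real assume "e > 0"
      then have "\<exists>n. (1/3)^n < e / (3/2 * R)" using R(1) by (intro real_arch_pow_inv) auto
      then obtain N where N: "(1/3)^N < e / (3/2 * R)" by blast
      have "dist (y m g) (y n g) < e" if "m \<ge> N" "n > m" for m n
      proof -
        have "dist (y m g) (y n g) \<le> 3/2 * R / 3^m"
          using tail[of m n g R] R(2) that by (simp add: dist_norm norm_minus_commute)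
        also have "\<dots> \<le> 3/2 * R / 3^N" using that R(1) by (intro divide_left_mono power_increasing) auto
        also have "\<dots> < e" using N R(1) by (simp add: power_one_over field_simps)
        finally show ?thesis .
      qed
      then show "\<exists>N. \<forall>m\<ge>N. \<forall>n>m. dist (y m g) (y n g) < e" by blast
    qed
    then show ?thesis using complete_field unfolding complete_def by blast
  qed
  then obtain l0 where l0: "\<And>g. g \<in> F \<Longrightarrow> (\<lambda>n. y n g) \<longlonglongrightarrow> l0 g" by metis
  define l where "l = (\<lambda>g. if g \<in> F then l0 g else 0)"
  have l: "(\<lambda>n. y n g) \<longlonglongrightarrow> l g" if "g \<in> F" for g using l0[OF that] that by (simp add: l_def)
  have ltail: "norm (l g - y n g) \<le> 3/2 * R / 3^n" if "g \<in> F" and R: "\<And>\<psi>. \<psi> \<in> M \<Longrightarrow> norm (\<psi> g) \<le> R" for g R n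
  proof -
    have "(\<lambda>m. norm (y m g - y n g)) \<longlonglongrightarrow> norm (l g - y n g)" by (intro tendsto_intros l[OF \<open>g \<in> F\<close>])
    moreover have "norm (y m g - y n g) \<le> 3/2 * R / 3^n" if "m \<ge> n" for m using that R by (rule tail)
    ultimately show ?thesis using LIMSEQ_le_const2 by blast
  qed
  have "l (g + h) = l g + l h" if "g \<in> F" "h \<in> F" for g h
  proof (rule LIMSEQ_unique)
    show "(\<lambda>n. y n (g + h)) \<longlonglongrightarrow> l (g + h)" using that by (intro l) simp
    show "(\<lambda>n. y n (g + h)) \<longlonglongrightarrow> l g + l h"
      using tendsto_add[OF l[OF that(1)] l[OF that(2)]] Y_linD(1)[OF yY that] by simp
  qed
  moreover have "l (fscale c g) = c * l g" if "g \<in> F" for c g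
  proof (rule LIMSEQ_unique)
    show "(\<lambda>n. y n (fscale c g)) \<longlonglongrightarrow> l (fscale c g)" using that by (intro l) simp
    show "(\<lambda>n. y n (fscale c g)) \<longlonglongrightarrow> c * l g"
      using tendsto_mult_left[OF l[OF that], of c] Y_linD(2)[OF yY that] by simp
  qed
  ultimately have lin: "lin_functional fscale F l" unfolding lin_functional_def by (simp add: l_def)
  have "l \<in> Y"
  proof (rule uniform_limit_in_Y[OF lin])
    fix A and e :: real assume A: "tvs_bounded fscale F \<tau> A" and "e > 0"
    obtain R where R: "R > 0" "\<And>g \<psi>. \<lbrakk>g \<in> A; \<psi> \<in> M\<rbrakk> \<Longrightarrow> norm (\<psi> g) \<le> R" using bound[OF A] by blast
    have "\<exists>n. (1/3)^n < e / (3/2 * R)" using R(1) \<open>e > 0\<close> by (intro real_arch_pow_inv) auto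
    then obtain N where N: "(1/3)^N < e / (3/2 * R)" by blast
    have "norm (y N g - l g) \<le> e" if "g \<in> A" for g
    proof -
      have "norm (y N g - l g) \<le> 3/2 * R / 3^N"
        using ltail[of g R N] R(2)[OF that] that E.tvs_bounded_subset_space[OF A] by (auto simp: norm_minus_commute)
      also have "\<dots> < e" using N R(1) by (simp add: power_one_over field_simps)
      finally show ?thesis by simp
    qed
    then show "\<exists>\<phi>\<in>Y. \<forall>g\<in>A. norm (\<phi> g - l g) \<le> e" using yY by blast
  qed
  then obtain R where R: "\<And>g. g \<in> B \<Longrightarrow> norm (l g) \<le> R" using B(2) by blast
  have "(4/3)^n \<le> 4 * R" for n :: nat
  proof -
    define Q where "Q = norm (\<phi> n (f n))"
    have "norm (l (f n) - y (Suc n) (f n)) \<le> 3/2 * (3/2 * Q) / 3^Suc n"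
      unfolding Q_def using f B(1) \<phi>(3) by (intro ltail) auto
    moreover have "Q / 3^n \<le> norm (y (Suc n) (f n))"
      using hump[of n] by (simp add: Q_def z_def norm_divide norm_power)
    moreover have "norm (y (Suc n) (f n)) \<le> norm (l (f n)) + norm (l (f n) - y (Suc n) (f n))"
      by (metis norm_minus_commute norm_triangle_sub)
    ultimately have "Q / 3^n - 3/4 * (Q / 3^n) \<le> R" using R[OF f[of n]] by simp
    then have "Q / 3^n \<le> 4 * R" by simp
    moreover have "(4/3)^n \<le> Q / 3^n"
      unfolding power_divide using \<phi>(2)[of n] by (intro divide_right_mono) (simp_all add: Q_def)
    ultimately show ?thesis by linarith
  qed
  moreover obtain n where "4 * R < (4/3)^n" using real_arch_pow[of "4/3" "4 * R"] by auto
  ultimately show False by (meson not_le)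
qed

lemma barrelled_ptop: "barrelled fscale Y ptop"
  unfolding barrelled_def
proof (intro allI impI)
  fix A assume "A \<subseteq> Y \<and> absconv fscale A \<and> closedin ptop A \<and> (\<forall>y\<in>Y. absorbs fscale A {y})"
  then have A: "A \<subseteq> Y" "absconv fscale A" "closedin ptop A" and abs: "\<And>\<phi>. \<phi> \<in> Y \<Longrightarrow> absorbs fscale A {\<phi>}" by auto
  define B where "B = {f \<in> F. \<forall>\<phi>\<in>A. norm (\<phi> f) \<le> 1}"
  have "absorbs fscale A {0}" using abs Y_zero by blast
  then have "A \<noteq> {}" unfolding absorbs_def by (metis image_empty insert_not_empty order_refl subset_empty norm_of_real abs_ge_self)
  have pw: "\<exists>R. \<forall>f\<in>B. norm (\<phi> f) \<le> R" if \<phi>: "\<phi> \<in> Y" for \<phi>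
  proof -
    obtain t where t: "t > 0" "\<And>\<psi>. \<psi> \<in> {\<phi>} \<Longrightarrow> fscale (of_real (inverse t)) \<psi> \<in> A"
      by (rule absorbsE[OF abs[OF \<phi>] A(1)]) (use \<phi> in auto)
    have "norm (\<phi> f) \<le> t" if "f \<in> B" for f
    proof -
      have "norm (fscale (of_real (inverse t)) \<phi> f) \<le> 1" using that t(2) unfolding B_def by blast
      then show ?thesis using t(1) by (simp add: norm_inverse_scale_le_1)
    qed
    then show ?thesis by blast
  qed
  have BF: "B \<subseteq> F" by (auto simp: B_def)
  \<comment> \<open>By \<open>polar_subset_nbhd0\<close> each neighbourhood contains the polar of a
    \<beta>-bounded M; Banach-Mackey turns the pointwise bounds on B into one uniform on M, so this
    polar absorbs B.\<close>
  have "tvs_bounded fscale F \<tau> B"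
  proof (rule E.tvs_boundedI[OF BF])
    fix V assume "nbhd0 \<tau> V"
    then obtain M where M: "tvs_bounded fscale Y ptop M" "{f \<in> F. \<forall>\<phi>\<in>M. norm (\<phi> f) \<le> 1} \<subseteq> V"
      by (rule polar_subset_nbhd0)
    have MY: "M \<subseteq> Y" using M tvs_bounded_subset_space by blast
    obtain R where R: "\<And>f \<phi>. \<lbrakk>f \<in> B; \<phi> \<in> M\<rbrakk> \<Longrightarrow> norm (\<phi> f) \<le> R" using banach_mackey[OF M(1) BF pw] by blast
    define t where "t = \<bar>R\<bar> + 1"
    have t: "t > 0" "\<And>f \<phi>. \<lbrakk>f \<in> B; \<phi> \<in> M\<rbrakk> \<Longrightarrow> norm (\<phi> f) \<le> t" using R by (force simp: t_def)+
    have "fscale (inverse (of_real t)) f \<in> V" if f: "f \<in> B" for f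
    proof (rule subsetD[OF M(2)], intro CollectI conjI ballI)
      show "fscale (inverse (of_real t)) f \<in> F" using f BF by auto
      fix \<phi> assume \<phi>: "\<phi> \<in> M"
      then show "norm (\<phi> (fscale (inverse (of_real t)) f)) \<le> 1"
        using Y_linD(2)[of \<phi> f "inverse (of_real t)"] t f BF MY by (auto simp: norm_inverse_scale_le_1 subsetD)
    qed
    then show "\<exists>c. c \<noteq> 0 \<and> (\<forall>f\<in>B. fscale c f \<in> V)" using t(1) by (intro exI[of _ "inverse (of_real t)"]) auto
  qed
  then have nb: "nbhd0 ptop {\<phi> \<in> Y. \<forall>f\<in>B. norm (\<phi> f) \<le> 1}" by (intro nbhd0_pair) auto
  moreover have "{\<phi> \<in> Y. \<forall>f\<in>B. norm (\<phi> f) \<le> 1} \<subseteq> A"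
  proof (rule subsetI, rule ccontr)
    fix \<phi> assume \<phi>: "\<phi> \<in> {\<phi> \<in> Y. \<forall>f\<in>B. norm (\<phi> f) \<le> 1}" "\<phi> \<notin> A"
    then obtain \<psi> where \<psi>: "\<psi> \<in> tvs_dual fscale Y ptop" "\<And>x. x \<in> A \<Longrightarrow> norm (\<psi> x) \<le> 1" "1 < norm (\<psi> \<phi>)"
      using separation_absconv[OF A(2,1,3) \<open>A \<noteq> {}\<close>, of \<phi>] by blast
    \<comment> \<open>The separating functional is an evaluation at some f; being bounded by 1 on A
      it puts f into B, where \<phi> is bounded by 1.\<close>
    then obtain f where f: "f \<in> F" "\<psi> = evalf Y f" unfolding dual_eq_eval by blast
    have ev: "\<psi> x = x f" if "x \<in> Y" for x using that by (simp add: f(2) evalf_def)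
    have "f \<in> B" unfolding B_def using f(1) \<psi>(2) ev A(1) by (auto simp: subsetD)
    then show False using \<phi> \<psi>(3) ev by force
  qed
  ultimately show "nbhd0 ptop A" by (rule nbhd0_mono)
qed

lemma cscb_linearisation_evalf:
  assumes "\<And>x. x \<in> topspace \<Omega> \<Longrightarrow> evalf F x \<in> Y" and "continuous_map \<Omega> \<beta> (evalf F)"
  shows "cscb_linearisation \<Omega> F \<tau> fscale Y \<beta> (evalf F) (evalf Y)"
  unfolding cscb_linearisation_def beta_eq
proof (intro conjI ballI allI)
  show "bij_betw (evalf Y) F (tvs_dual fscale Y ptop)"
    unfolding bij_betw_def dual_eq_eval using inj_eval by blast
  show "evalf Y (f + g) = evalf Y f + evalf Y g" if "f \<in> F" "g \<in> F" for f g
    using that by (auto simp: evalf_def Y_linD)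
  show "evalf Y (fscale c f) = fscale c (evalf Y f)" if "f \<in> F" for c f
    using that by (auto simp: evalf_def Y_linD)
  show "evalf Y f (evalf F x) = f x" if "f \<in> F" "x \<in> topspace \<Omega>" for f x
    using that assms(1)[OF that(2)] by (simp add: evalf_def[of Y]) (simp add: evalf_def)
qed (use assms lcH_pair homeomorphic_eval complete_ptop barrelled_ptop in \<open>auto simp: beta_eq\<close>)

end

section \<open>Continuity of the evaluation map\<close>

context bbc_cnc
begin

lemma eval_in_Y:
  assumes "continuous_map \<tau>' euclidean (\<lambda>f. f x)" shows "evalf F x \<in> Y"
proof -
  have "continuous_map \<tau>' euclidean (evalf F x)"
    by (rule continuous_map_eq[OF assms]) (simp add: evalf_def)
  then have "evalf F x \<in> tvs_dual fscale F \<tau>'"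
    unfolding tvs_dual_def lin_functional_def by (simp add: evalf_def)
  then show ?thesis using dual_subset_Y by blast
qed

text \<open>The space X is kept general: it is \<Omega> when bounded sets are equicontinuous, and a
  compact subspace of \<Omega> in the \<open>gkR_space\<close> argument.\<close>

lemma continuous_evaluation:
  assumes "\<And>x. x \<in> topspace X \<Longrightarrow> evalf F x \<in> Y"
    and eq: "\<And>B. tvs_bounded fscale F \<tau> B \<Longrightarrow> equicontinuous_on X B"
  shows "continuous_map X \<beta> (evalf F)"
  unfolding beta_eq continuous_map_def
proof (intro conjI allI impI)
  show "evalf F \<in> topspace X \<rightarrow> topspace ptop" using assms(1) by simp
  fix U assume U: "openin ptop U"
  show "openin X {x \<in> topspace X. evalf F x \<in> U}"
  proof (subst openin_subopen, intro ballI)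
    fix x assume x: "x \<in> {x \<in> topspace X. evalf F x \<in> U}"
    then obtain B e where B: "B \<in> \<B>" "e > 0" "\<And>\<phi>. \<lbrakk>\<phi> \<in> Y; \<forall>f\<in>B. norm (\<phi> f - evalf F x f) \<le> e\<rbrakk> \<Longrightarrow> \<phi> \<in> U"
      using U unfolding openin_ptop by blast
    have BF: "B \<subseteq> F" using B E.tvs_bounded_subset_space by blast
    obtain W where W: "openin X W" "x \<in> W" "\<forall>y\<in>W. \<forall>f\<in>B. norm (f y - f x) < e"
      using eq[of B] B(1,2) x unfolding equicontinuous_on_def by blast
    have "evalf F y \<in> U" if "y \<in> W" for y
    proof (rule B(3))
      show "evalf F y \<in> Y" using that openin_subset[OF W(1)] assms(1) by blast
      show "\<forall>f\<in>B. norm (evalf F y f - evalf F x f) \<le> e"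
        using W(3) that BF by (auto simp: evalf_def subsetD intro: less_imp_le)
    qed
    then show "\<exists>T. openin X T \<and> x \<in> T \<and> T \<subseteq> {x \<in> topspace X. evalf F x \<in> U}"
      using W openin_subset[OF W(1)] by blast
  qed
qed

end

section \<open>Evaluation and the compact-open topology\<close>

lemma directed_compact: "directed_family {K. compactin \<Omega> K}"
  unfolding directed_family_def by (auto intro: compactin_Un)

lemma tau_co_eq: "tau_co \<Omega> F = pair_topology F (\<lambda>f x. f x) {K. compactin \<Omega> K}"
  unfolding tau_co_def by (rule unif_top_eq[OF directed_compact])

lemma continuous_map_eval_tau_co:
  assumes "coarser (tau_co \<Omega> F) \<tau>'" "topspace \<tau>' = F" "x \<in> topspace \<Omega>"
  shows "continuous_map \<tau>' euclidean (\<lambda>f. f x)"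
proof -
  have "continuous_map (tau_co \<Omega> F) euclidean (\<lambda>f. f x)"
    unfolding tau_co_eq by (rule continuous_map_pair[OF directed_compact, of x "{x}"]) (use assms(3) in auto)
  then show ?thesis
    using assms(1,2) unfolding continuous_map_def coarser_def tau_co_eq topspace_pair_topology[OF directed_compact]
    by auto
qed

lemma continuous_map_eval_tau_p:
  assumes "coarser (tau_p \<Omega> F) \<tau>'" "topspace \<tau>' = F" "x \<in> topspace \<Omega>"
  shows "continuous_map \<tau>' euclidean (\<lambda>f. f x)"
proof -
  have "openin (tau_p \<Omega> F) {f \<in> F. f x \<in> U}" if "open U" for U
    unfolding tau_p_def using that assms(3) by (intro topology_generated_by_Basis) blast
  then show ?thesis using assms(1,2) unfolding continuous_map_def coarser_def by auto
qed

text \<open>The easy half of Arzela--Ascoli: a compact set has finite uniform \<open>e/4\<close>-nets on \<open>K\<close>,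
  and their members are continuous.\<close>

lemma equicontinuous_on_compact:
  assumes C: "compactin (tau_co \<Omega> F) C" and K: "compactin \<Omega> K"
    and cont: "\<And>f. f \<in> F \<Longrightarrow> continuous_map \<Omega> euclidean (f :: 'a \<Rightarrow> 'k::real_normed_field)"
  shows "equicontinuous_on (subtopology \<Omega> K) C"
  unfolding equicontinuous_on_def
proof (intro ballI allI impI)
  fix x and e :: real assume x: "x \<in> topspace (subtopology \<Omega> K)" and e: "e > 0"
  have CF: "C \<subseteq> F" using compactin_subset_topspace[OF C] unfolding tau_co_eq by (simp add: directed_compact)
  define N where "N = (\<lambda>f. {g \<in> F. \<exists>d<e/4. \<forall>y\<in>K. norm (g y - f y) \<le> d})"
  have "openin (tau_co \<Omega> F) (N f)" for f
    unfolding N_def tau_co_eq using K by (intro open_pair_ball directed_compact) simp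
  moreover have "C \<subseteq> \<Union>(N ` C)" using CF e by (force simp: N_def intro: exI[of _ 0])
  ultimately obtain \<G> where \<G>: "finite \<G>" "\<G> \<subseteq> N ` C" "C \<subseteq> \<Union>\<G>"
    using compactinD[OF C, of "N ` C"] by blast
  obtain \<Phi> where \<Phi>: "finite \<Phi>" "\<Phi> \<subseteq> C" "\<G> = N ` \<Phi>" using finite_subset_image[OF \<G>(1,2)] by blast
  define W where "W = (\<Inter>f\<in>\<Phi>. {y \<in> topspace (subtopology \<Omega> K). f y \<in> ball (f x) (e/4)}) \<inter> topspace (subtopology \<Omega> K)"
  have "openin (subtopology \<Omega> K) {y \<in> topspace (subtopology \<Omega> K). f y \<in> ball (f x) (e/4)}" if "f \<in> \<Phi>" for f
    by (rule openin_continuous_map_preimage[of _ euclidean])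
      (use that \<Phi> CF cont in \<open>auto intro!: continuous_map_from_subtopology\<close>)
  then have "openin (subtopology \<Omega> K) W" unfolding W_def by (rule openin_INT[OF \<Phi>(1)])
  moreover have "x \<in> W" using x e by (simp add: W_def)
  moreover have "norm (f y - f x) < e" if y: "y \<in> W" and f: "f \<in> C" for y f
  proof -
    obtain g where g: "g \<in> \<Phi>" "f \<in> N g" using \<G>(3) \<Phi>(3) f by blast
    then obtain d where d: "d < e/4" "\<forall>y\<in>K. norm (f y - g y) \<le> d" unfolding N_def by blast
    have "y \<in> K" "x \<in> K" using y x by (auto simp: W_def)
    then have "dist (f y) (g y) \<le> d" "dist (f x) (g x) \<le> d" using d(2) by (simp_all add: dist_norm)
    moreover have "dist (g x) (g y) < e/4" using y g(1) unfolding W_def by auto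
    moreover have "dist (f y) (f x) \<le> dist (f y) (g y) + dist (g x) (g y) + dist (f x) (g x)"
      using dist_triangle[of "f y" "f x" "g y"] dist_triangle[of "g y" "f x" "g x"] by (simp add: dist_commute)
    ultimately have "dist (f y) (f x) < e" using e d(1) by linarith
    then show ?thesis by (simp add: dist_norm)
  qed
  ultimately show "\<exists>U. openin (subtopology \<Omega> K) U \<and> x \<in> U \<and> (\<forall>y\<in>U. \<forall>f\<in>C. norm (f y - f x) < e)" by blast
qed

lemma continuous_evaluation_gkR:
  fixes F :: "('a \<Rightarrow> 'k::real_normed_field) set"
  assumes "bbc_cnc F \<tau> \<tau>'" and co: "coarser (tau_co \<Omega> F) \<tau>'"
    and cont: "\<And>f. f \<in> F \<Longrightarrow> continuous_map \<Omega> euclidean f"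
    and gkR: "gkR_space \<Omega> TYPE(('a \<Rightarrow> 'k) \<Rightarrow> 'k)"
  shows "\<forall>x\<in>topspace \<Omega>. evalf F x \<in> Fprime_B F \<tau> \<tau>'" "continuous_map \<Omega> (beta_top F \<tau> \<tau>') (evalf F)"
proof -
  interpret bbc_cnc F \<tau> \<tau>' by fact
  show mem: "\<forall>x\<in>topspace \<Omega>. evalf F x \<in> Y"
    using eval_in_Y continuous_map_eval_tau_co[OF co E'.topspace_eq] by blast
  have sub: "continuous_map (subtopology \<Omega> K) \<beta> (evalf F)" if K: "compactin \<Omega> K" for K
  proof (rule continuous_evaluation)
    fix B assume "tvs_bounded fscale F \<tau> B"
    \<comment> \<open>The hull from (BBC) is compact for \<tau>', hence for the coarser
      \<open>tau_co\<close>, where compactness forces equicontinuity on K.\<close>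
    then obtain C where C: "B \<subseteq> C" "compactin \<tau>' C" by (rule bounded_hullE)
    have "continuous_map \<tau>' (tau_co \<Omega> F) id"
      using co E'.topspace_eq openin_subset[of "tau_co \<Omega> F"]
      unfolding continuous_map_def coarser_def tau_co_eq topspace_pair_topology[OF directed_compact]
      by (auto simp: Int_absorb1 Collect_conj_eq)
    then have "compactin (tau_co \<Omega> F) C" using image_compactin[OF C(2)] by fastforce
    then have "equicontinuous_on (subtopology \<Omega> K) C" using K cont by (rule equicontinuous_on_compact)
    then show "equicontinuous_on (subtopology \<Omega> K) B" using C(1) unfolding equicontinuous_on_def by (meson subsetD)
  qed (use mem in auto)
  have "completely_regular_space \<beta>" unfolding beta_eq by (rule completely_regular_pair)
  moreover have "evalf F \<in> topspace \<Omega> \<rightarrow> topspace \<beta>" unfolding beta_eq using mem by simp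
  ultimately show "continuous_map \<Omega> \<beta> (evalf F)" using gkR sub unfolding gkR_space_def by blast
qed

section \<open>From linearisations to weak-star compactness\<close>

lemma closedin_Collect_Ball:
  assumes "\<And>i. i \<in> I \<Longrightarrow> closedin X {x \<in> topspace X. P i x}"
  shows "closedin X {x \<in> topspace X. \<forall>i\<in>I. P i x}"
proof -
  \<comment> \<open>The whole space is inserted to cover an empty index set.\<close>
  have "closedin X (\<Inter>(insert (topspace X) ((\<lambda>i. {x \<in> topspace X. P i x}) ` I)))"
    using assms by (intro closedin_Inter) auto
  moreover have "\<Inter>(insert (topspace X) ((\<lambda>i. {x \<in> topspace X. P i x}) ` I)) = {x \<in> topspace X. \<forall>i\<in>I. P i x}" by auto
  ultimately show ?thesis by simp
qed

context lcs
begin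

text \<open>Alaoglu's theorem: A absorbs every point y, which confines \<psi> y to a compact ball of
  radius r y. Linearity and the bound on A are closed conditions in the product topology, which is
  the topology of the function type.\<close>

lemma compact_polar:
  assumes "nbhd0 T A"
  shows "compact {\<psi>. lin_functional s Y \<psi> \<and> (\<forall>y\<in>A. norm (\<psi> y) \<le> 1)}" (is "compact ?L")
proof -
  have "\<exists>r. \<forall>\<psi>\<in>?L. norm (\<psi> y) \<le> r" for y
  proof (cases "y \<in> Y")
    case True
    then obtain t where t: "t > 0" "s (of_real t) y \<in> A" using nbhd0_absorbs_point[OF assms] by blast
    have "norm (\<psi> y) \<le> inverse t" if "\<psi> \<in> ?L" for \<psi>
    proof -
      have \<psi>: "norm (\<psi> (s (of_real t) y)) \<le> 1" "lin_functional s Y \<psi>" using that t(2) by auto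
      then have "t * norm (\<psi> y) \<le> 1"
        using lin_functionalD(2)[OF \<psi>(2) True, of "of_real t"] t(1) by (simp add: norm_mult)
      then show ?thesis using t(1) by (simp add: field_simps)
    qed
    then show ?thesis by blast
  next
    case False
    then have "\<forall>\<psi>\<in>?L. norm (\<psi> y) \<le> 0" using lin_functionalD(3) by auto
    then show ?thesis by blast
  qed
  then have "\<exists>r. \<forall>y. \<forall>\<psi>\<in>?L. norm (\<psi> y) \<le> r y" by (intro choice) (rule allI)
  then obtain r where r: "\<And>y \<psi>. \<psi> \<in> ?L \<Longrightarrow> norm (\<psi> y) \<le> r y" by blast
  have "compactin (product_topology (\<lambda>_::'y. euclidean :: 'k topology) UNIV) (PiE UNIV (\<lambda>y. cball 0 (r y)))"
    unfolding compactin_PiE by (simp add: compact_cball_field)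
  then have "compact (PiE UNIV (\<lambda>y::'y. cball 0 (r y) :: 'k set))"
    unfolding euclidean_product_topology by simp
  moreover have "closed ?L"
  proof -
    have "?L = (\<Inter>x\<in>Y. \<Inter>y\<in>Y. {\<psi>. \<psi> (x + y) = \<psi> x + \<psi> y}) \<inter> (\<Inter>c. \<Inter>x\<in>Y. {\<psi>. \<psi> (s c x) = c * \<psi> x})
        \<inter> (\<Inter>x\<in>-Y. {\<psi>. \<psi> x = 0}) \<inter> (\<Inter>y\<in>A. {\<psi>. norm (\<psi> y) \<le> 1})"
      unfolding lin_functional_def by auto
    also have "closed \<dots>"
      by (intro closed_Int closed_INT ballI closed_Collect_eq closed_Collect_le continuous_intros
          continuous_on_product_coordinates)
    finally show ?thesis .
  qed
  ultimately have "compact (PiE UNIV (\<lambda>y::'y. cball 0 (r y) :: 'k set) \<inter> ?L)" by (rule compact_Int_closed)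
  moreover have "PiE UNIV (\<lambda>y::'y. cball 0 (r y) :: 'k set) \<inter> ?L = ?L" using r by auto
  ultimately show ?thesis by simp
qed

end

text \<open>The witness \<open>\<tau>'\<close> is the weak-star topology, carried over to \<open>F\<close> by the linearisation.\<close>

lemma linearisation_imp_bbc_cnc:
  fixes F :: "('a \<Rightarrow> 'k::real_normed_field) set" and s :: "'k \<Rightarrow> 'y::ab_group_add \<Rightarrow> 'y"
  assumes lcHF: "lcH_space fscale F \<tau>" and lin: "cscb_linearisation \<Omega> F \<tau> s Y TY \<delta> T"
  shows "\<exists>\<tau>'. lcH_space fscale F \<tau>' \<and> coarser (tau_p \<Omega> F) \<tau>' \<and> BBC F \<tau> \<tau>' \<and> CNC F \<tau> \<tau>'
    \<and> (\<forall>B. tvs_bounded fscale F \<tau> B \<longrightarrow> equicontinuous_on \<Omega> B)"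
proof -
  interpret E: lcs fscale F \<tau> by unfold_locales (rule lcHF)
  interpret Y: lcs s Y TY by unfold_locales (use lin in \<open>simp add: cscb_linearisation_def\<close>)
  let ?D = "tvs_dual s Y TY" and ?SD = "strong_dual s Y TY"
  have \<delta>: "\<And>x. x \<in> topspace \<Omega> \<Longrightarrow> \<delta> x \<in> Y" "continuous_map \<Omega> TY \<delta>"
    and bij: "bij_betw T F ?D"
    and Tadd: "\<And>f g. \<lbrakk>f \<in> F; g \<in> F\<rbrakk> \<Longrightarrow> T (f + g) = T f + T g"
    and Tscale: "\<And>c f. f \<in> F \<Longrightarrow> T (fscale c f) = fscale c (T f)"
    and T\<delta>: "\<And>f x. \<lbrakk>f \<in> F; x \<in> topspace \<Omega>\<rbrakk> \<Longrightarrow> T f (\<delta> x) = f x"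
    and homeo: "homeomorphic_map \<tau> ?SD T" and barr: "barrelled s Y TY"
    using lin unfolding cscb_linearisation_def by auto
  have TD: "T f \<in> ?D" if "f \<in> F" for f using bij that unfolding bij_betw_def by blast
  note Tlin = Y.lin_functionalD[OF Y.tvs_dual_lin[OF TD]]
  have T0: "T 0 = 0" using Tscale[of 0 0] by (auto simp: fun_eq_iff)
  have inj: "inj_on T F" using bij unfolding bij_betw_def by blast
  have dirM: "directed_family {M. tvs_bounded s Y TY M}"
    unfolding directed_family_def using Y.tvs_bounded_empty Y.tvs_bounded_Un by blast
  have SD: "?SD = pair_topology ?D (\<lambda>\<psi> y. \<psi> y) {M. tvs_bounded s Y TY M}"
    unfolding strong_dual_def by (rule unif_top_eq[OF dirM])
  \<comment> \<open>Together with \<open>nbhdE\<close> this describes \<tau> through T: its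
    neighbourhoods of 0 are given by uniform smallness of T f on bounded subsets of Y.\<close>
  have nbhd: "nbhd0 \<tau> {f \<in> F. \<forall>y\<in>M. norm (T f y) \<le> e}" if M: "tvs_bounded s Y TY M" and e: "e > 0" for M e
  proof -
    let ?W = "{\<psi> \<in> ?D. \<exists>d<e. \<forall>y\<in>M. norm (\<psi> y - T 0 y) \<le> d}"
    have "openin ?SD ?W" unfolding SD using M by (intro open_pair_ball dirM) simp
    then have "openin \<tau> {f \<in> topspace \<tau>. T f \<in> ?W}"
      using homeomorphic_imp_continuous_map[OF homeo] by (rule openin_continuous_map_preimage[rotated])
    then show ?thesis unfolding nbhd0_def using e TD[of 0]
      by (intro exI[of _ "{f \<in> topspace \<tau>. T f \<in> ?W}"]) (auto simp: T0 intro: exI[of _ 0])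
  qed
  have nbhdE: "\<exists>M e. tvs_bounded s Y TY M \<and> e > 0 \<and> {f \<in> F. \<forall>y\<in>M. norm (T f y) \<le> e} \<subseteq> U" if U: "nbhd0 \<tau> U" for U
  proof -
    obtain W where W: "openin \<tau> W" "0 \<in> W" "W \<subseteq> U" using U unfolding nbhd0_def by blast
    have WF: "W \<subseteq> F" using openin_subset[OF W(1)] by simp
    have "openin ?SD (T ` W)" using homeomorphic_map_openness_eq[OF homeo] W(1) by blast
    then have "\<forall>\<phi>\<in>T ` W. \<exists>M\<in>{M. tvs_bounded s Y TY M}. \<exists>e>0. \<forall>\<psi>\<in>?D.
        (\<forall>y\<in>M. norm (\<psi> y - \<phi> y) \<le> e) \<longrightarrow> \<psi> \<in> T ` W"
      unfolding SD openin_pair_topology[OF dirM] by (rule conjunct2)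
    from bspec[OF this imageI[OF W(2)]]
    obtain M e where M: "tvs_bounded s Y TY M" "e > 0"
      "\<And>\<psi>. \<lbrakk>\<psi> \<in> ?D; \<forall>y\<in>M. norm (\<psi> y - T 0 y) \<le> e\<rbrakk> \<Longrightarrow> \<psi> \<in> T ` W"
      by blast
    have "f \<in> U" if "f \<in> F" "\<forall>y\<in>M. norm (T f y) \<le> e" for f
    proof -
      have "T f \<in> T ` W" using that by (intro M(3) TD) (simp_all add: T0)
      then show ?thesis using inj that(1) W(3) WF by (auto dest: inj_onD)
    qed
    then show ?thesis using M(1,2) by blast
  qed
  define fin where "fin = {A. finite A \<and> A \<subseteq> Y}"
  interpret W: pairing fscale F T fin
  proof unfold_locales
    show "directed_family fin"
      unfolding directed_family_def fin_def by (auto intro: exI[of _ "{}"])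
    show "\<exists>M. \<forall>z\<in>A. norm (T f z) \<le> M" if "f \<in> F" "A \<in> fin" for f A
    proof -
      have "bdd_above ((\<lambda>z. norm (T f z)) ` A)" using that unfolding fin_def by auto
      then show ?thesis unfolding bdd_above_def by auto
    qed
    fix f assume f: "f \<in> F" "\<forall>A\<in>fin. \<forall>z\<in>A. T f z = 0"
    have "T f y = T 0 y" for y
    proof (cases "y \<in> Y")
      case True
      then have "{y} \<in> fin" by (simp add: fin_def)
      then show ?thesis using f(2) by (auto simp: T0)
    next
      case False then show ?thesis using Tlin(3)[OF f(1)] by (simp add: T0)
    qed
    then have "T f = T 0" by (rule ext)
    then show "f = 0" by (rule inj_onD[OF inj]) (use f(1) in simp_all)
  qed (auto simp: Tadd Tscale)
  let ?\<tau>' = "pair_topology F T fin"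
  have ev_cont: "continuous_map ?\<tau>' euclidean (\<lambda>f. T f y)" if "y \<in> Y" for y
    by (rule continuous_map_pair[OF W.directed, of y "{y}"]) (use that in \<open>auto simp: fin_def\<close>)
  have closed_polar: "closedin ?\<tau>' {f \<in> F. \<forall>y\<in>M. norm (T f y) \<le> e}" if "M \<subseteq> Y" for M e
  proof -
    have "closedin ?\<tau>' {f \<in> topspace ?\<tau>'. T f y \<in> cball 0 e}" if "y \<in> Y" for y
      by (rule closedin_continuous_map_preimage[OF ev_cont[OF that]]) simp
    then show ?thesis using closedin_Collect_Ball[of M ?\<tau>' "\<lambda>y f. T f y \<in> cball 0 e"] that by auto
  qed
  have absconv_polar: "absconv fscale {f \<in> F. \<forall>y\<in>M. norm (T f y) \<le> e}" for M e
  proof -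
    define ev where "ev = (\<lambda>y f. if f \<in> F then T f y else 0)"
    have "absconv fscale {f \<in> F. \<forall>\<phi>\<in>ev ` M. norm (\<phi> f) \<le> e}"
      by (rule E.absconv_polar) (auto simp: ev_def lin_functional_def Tadd Tscale)
    moreover have "{f \<in> F. \<forall>\<phi>\<in>ev ` M. norm (\<phi> f) \<le> e} = {f \<in> F. \<forall>y\<in>M. norm (T f y) \<le> e}" by (auto simp: ev_def)
    ultimately show ?thesis by simp
  qed
  \<comment> \<open>The polar of B in Y is a barrel; it absorbs each y because B is bounded and
    evaluation at y is continuous for \<tau>.\<close>
  have polar_nbhd: "nbhd0 TY {y \<in> Y. \<forall>f\<in>B. norm (T f y) \<le> 1}" if B: "tvs_bounded fscale F \<tau> B" for B
  proof -
    let ?A = "{y \<in> Y. \<forall>f\<in>B. norm (T f y) \<le> 1}"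
    have BF: "B \<subseteq> F" using B E.tvs_bounded_subset_space by blast
    have eq: "?A = {y \<in> Y. \<forall>\<phi>\<in>T ` B. norm (\<phi> y) \<le> 1}" by auto
    have ac: "absconv s ?A" unfolding eq by (rule Y.absconv_polar) (use BF TD Y.tvs_dual_lin in blast)
    have "closedin TY {y \<in> topspace TY. T f y \<in> cball 0 1}" if "f \<in> B" for f
      by (rule closedin_continuous_map_preimage[of _ euclidean]) (use TD that BF in \<open>auto simp: tvs_dual_def\<close>)
    then have "closedin TY ?A" using closedin_Collect_Ball[of B TY "\<lambda>f y. T f y \<in> cball 0 1"] by simp
    moreover have "absorbs s ?A {y}" if y: "y \<in> Y" for y
    proof -
      have "absorbs fscale {f \<in> F. \<forall>y\<in>{y}. norm (T f y) \<le> 1} B"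
        by (rule E.tvs_bounded_absorbs[OF B nbhd[OF Y.tvs_bounded_singleton[OF y]]]) simp
      then obtain t where t: "t > 0" "\<And>f. f \<in> B \<Longrightarrow> fscale (of_real (inverse t)) f \<in> {f \<in> F. \<forall>y\<in>{y}. norm (T f y) \<le> 1}"
        by (rule E.absorbsE) (use BF in auto)
      have "s (of_real (inverse t)) y \<in> ?A"
      proof (intro CollectI conjI ballI)
        fix f assume f: "f \<in> B"
        then have "norm (T (fscale (of_real (inverse t)) f) y) \<le> 1" using t(2) by blast
        then show "norm (T f (s (of_real (inverse t)) y)) \<le> 1"
          using f BF y Tscale[of f] Tlin(2)[of f y] by (auto simp: subsetD)
      qed (use y in simp)
      then show ?thesis using t(1) y by (intro Y.absconv_absorbsI[OF ac, of _ "of_real (inverse t)"]) auto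
    qed
    ultimately show ?thesis using barr[unfolded barrelled_def, rule_format, of ?A] ac by simp
  qed
  have "coarser (tau_p \<Omega> F) ?\<tau>'"
    unfolding coarser_def
  proof (intro allI impI)
    fix U assume "openin (tau_p \<Omega> F) U"
    then have "generate_topology_on {{f\<in>F. f x \<in> U} | x U. x \<in> topspace \<Omega> \<and> open U} U"
      unfolding tau_p_def openin_topology_generated_by_iff .
    then show "openin ?\<tau>' U"
    proof (induction rule: generate_topology_on.induct)
      case (Basis V)
      then obtain x O' where x: "x \<in> topspace \<Omega>" "open O'" "V = {f \<in> F. f x \<in> O'}" by blast
      then have "V = {f \<in> topspace ?\<tau>'. T f (\<delta> x) \<in> O'}" using T\<delta> by auto
      then show ?case using openin_continuous_map_preimage[OF ev_cont[OF \<delta>(1)[OF x(1)]], of O'] x(2) by simp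
    qed (auto intro: openin_Union)
  qed
  moreover have "BBC F \<tau> ?\<tau>'"
    unfolding BBC_def
  proof (intro allI impI)
    fix B assume B: "tvs_bounded fscale F \<tau> B"
    have BF: "B \<subseteq> F" using B E.tvs_bounded_subset_space by blast
    \<comment> \<open>K is the bipolar of B. It is bounded because the neighbourhood A absorbs every
      bounded M, and weak-star compact as the polar of a neighbourhood.\<close>
    define A where "A = {y \<in> Y. \<forall>f\<in>B. norm (T f y) \<le> 1}"
    define K where "K = {f \<in> F. \<forall>y\<in>A. norm (T f y) \<le> 1}"
    have A: "nbhd0 TY A" "A \<subseteq> Y" unfolding A_def by (rule polar_nbhd[OF B]) blast
    have KF: "K \<subseteq> F" by (auto simp: K_def)
    have "B \<subseteq> K" using BF by (auto simp: K_def A_def)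
    moreover have "absconv fscale K" unfolding K_def by (rule absconv_polar)
    moreover have "tvs_bounded fscale F \<tau> K"
    proof (rule E.tvs_boundedI[OF KF])
      fix V assume "nbhd0 \<tau> V"
      then obtain M e where M: "tvs_bounded s Y TY M" "e > 0" "{f \<in> F. \<forall>y\<in>M. norm (T f y) \<le> e} \<subseteq> V"
        using nbhdE by blast
      have MY: "M \<subseteq> Y" using M Y.tvs_bounded_subset_space by blast
      obtain t where t: "t > 0" "\<And>y. y \<in> M \<Longrightarrow> s (of_real (inverse t)) y \<in> A"
        by (rule Y.absorbsE[OF Y.tvs_bounded_absorbs[OF M(1) A(1)] A(2) MY]) blast
      have "fscale (of_real (e / t)) f \<in> V" if f: "f \<in> K" for f
      proof (rule subsetD[OF M(3)], intro CollectI conjI ballI)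
        show "fscale (of_real (e / t)) f \<in> F" using f KF by auto
        fix y assume y: "y \<in> M"
        have "f \<in> F" "y \<in> Y" using f y KF MY by auto
        have "norm (T f (s (of_real (inverse t)) y)) \<le> 1" using f t(2)[OF y] unfolding K_def by blast
        then have "norm (T f y) \<le> t"
          using Tlin(2)[OF \<open>f \<in> F\<close> \<open>y \<in> Y\<close>] t(1) by (simp add: norm_inverse_scale_le_1)
        then have "(e / t) * norm (T f y) \<le> (e / t) * t" using t(1) M(2) by (intro mult_left_mono) auto
        then show "norm (T (fscale (of_real (e / t)) f) y) \<le> e"
          using Tscale[OF \<open>f \<in> F\<close>] t(1) M(2) by (simp add: norm_mult norm_divide)
      qed
      then show "\<exists>c. c \<noteq> 0 \<and> (\<forall>f\<in>K. fscale c f \<in> V)"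
        using t(1) M(2) by (intro exI[of _ "of_real (e / t)"]) auto
    qed
    moreover have "compactin ?\<tau>' K"
    proof -
      \<comment> \<open>L is compact among all functions on the type. Its members are bounded on A,
        hence continuous, hence in the range of T, so the inverse G of T carries L onto K.\<close>
      define L where "L = {\<psi>. lin_functional s Y \<psi> \<and> (\<forall>y\<in>A. norm (\<psi> y) \<le> 1)}"
      have LD: "L \<subseteq> ?D" unfolding L_def using Y.tvs_dualI[OF _ A(1)] by blast
      define G where "G = inv_into F T"
      have G: "G \<psi> \<in> F" "T (G \<psi>) = \<psi>" if "\<psi> \<in> L" for \<psi>
      proof -
        have "\<psi> \<in> T ` F" using that LD bij unfolding bij_betw_def by blast
        then show "G \<psi> \<in> F" "T (G \<psi>) = \<psi>" unfolding G_def by (rule inv_into_into, rule f_inv_into_f)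
      qed
      have GK: "G ` L = K"
      proof
        show "G ` L \<subseteq> K" using G unfolding K_def L_def by auto
        have "f \<in> G ` L" if "f \<in> K" for f
        proof -
          have "T f \<in> L" "G (T f) = f"
            using that TD Y.tvs_dual_lin inj unfolding K_def L_def G_def by auto
          then show ?thesis by (metis image_eqI)
        qed
        then show "K \<subseteq> G ` L" by blast
      qed
      have "continuous_map (top_of_set L) ?\<tau>' G"
        unfolding continuous_map_def
      proof (intro conjI allI impI)
        show "G \<in> topspace (top_of_set L) \<rightarrow> topspace ?\<tau>'" using G by simp
        fix U assume U: "openin ?\<tau>' U"
        show "openin (top_of_set L) {\<psi> \<in> topspace (top_of_set L). G \<psi> \<in> U}"
        proof (subst openin_subopen, intro ballI)
          fix \<psi> assume \<psi>: "\<psi> \<in> {\<psi> \<in> topspace (top_of_set L). G \<psi> \<in> U}"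
          then have \<psi>L: "\<psi> \<in> L" by simp
          have "\<forall>f\<in>U. \<exists>C\<in>fin. \<exists>e>0. \<forall>g\<in>F. (\<forall>y\<in>C. norm (T g y - T f y) \<le> e) \<longrightarrow> g \<in> U"
            using U unfolding W.openin_ptop by (rule conjunct2)
          from bspec[OF this, of "G \<psi>"] \<psi>
          obtain C e where C: "C \<in> fin" "e > 0" "\<And>g. \<lbrakk>g \<in> F; \<forall>y\<in>C. norm (T g y - \<psi> y) \<le> e\<rbrakk> \<Longrightarrow> g \<in> U"
            unfolding G(2)[OF \<psi>L] by blast
          have "open (\<Inter>y\<in>C. {\<xi>. norm (\<xi> y - \<psi> y) < e})"
          proof (intro open_INT ballI)
            show "finite C" using C(1) by (simp add: fin_def)
            show "open {\<xi>. norm (\<xi> y - \<psi> y) < e}" for y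
              by (intro open_Collect_less continuous_intros continuous_on_product_coordinates)
          qed
          then have "openin (top_of_set L) (L \<inter> (\<Inter>y\<in>C. {\<xi>. norm (\<xi> y - \<psi> y) < e}))" by (rule openin_open_Int)
          moreover have "\<xi> \<in> {\<psi> \<in> topspace (top_of_set L). G \<psi> \<in> U}"
            if "\<xi> \<in> L \<inter> (\<Inter>y\<in>C. {\<xi>. norm (\<xi> y - \<psi> y) < e})" for \<xi>
            using that G[of \<xi>] by (auto intro!: C(3) less_imp_le)
          ultimately show "\<exists>N. openin (top_of_set L) N \<and> \<psi> \<in> N \<and> N \<subseteq> {\<psi> \<in> topspace (top_of_set L). G \<psi> \<in> U}"
            using \<psi>L C(2) by (intro exI[of _ "L \<inter> (\<Inter>y\<in>C. {\<xi>. norm (\<xi> y - \<psi> y) < e})"]) auto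
        qed
      qed
      moreover have "compactin (top_of_set L) L"
        unfolding compactin_subtopology using Y.compact_polar[OF A(1)] by (simp add: L_def)
      ultimately show ?thesis using image_compactin GK by metis
    qed
    ultimately show "\<exists>K. B \<subseteq> K \<and> absconv fscale K \<and> tvs_bounded fscale F \<tau> K \<and> compactin ?\<tau>' K" by blast
  qed
  moreover have "CNC F \<tau> ?\<tau>'"
    unfolding CNC_def
  proof (intro allI impI)
    fix U assume "openin \<tau> U \<and> 0 \<in> U"
    then have "nbhd0 \<tau> U" unfolding nbhd0_def by blast
    then obtain M e where M: "tvs_bounded s Y TY M" "e > 0" "{f \<in> F. \<forall>y\<in>M. norm (T f y) \<le> e} \<subseteq> U"
      using nbhdE by blast
    then show "\<exists>V. V \<subseteq> U \<and> absconv fscale V \<and> closedin ?\<tau>' V \<and> nbhd0 \<tau> V"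
      using absconv_polar closed_polar[OF Y.tvs_bounded_subset_space[OF M(1)]] nbhd by blast
  qed
  moreover have "equicontinuous_on \<Omega> B" if B: "tvs_bounded fscale F \<tau> B" for B
    unfolding equicontinuous_on_def
  proof (intro ballI allI impI)
    fix x and e :: real assume x: "x \<in> topspace \<Omega>" and e: "e > 0"
    have BF: "B \<subseteq> F" using B E.tvs_bounded_subset_space by blast
    \<comment> \<open>The polar gives a weak inequality, and halving e makes it strict.\<close>
    define c where "c = e / 2"
    have c: "0 < c" "c < e" using e by (auto simp: c_def)
    obtain W where W: "openin TY W" "0 \<in> W" "W \<subseteq> {y \<in> Y. s (inverse (of_real c)) y \<in> {y \<in> Y. \<forall>f\<in>B. norm (T f y) \<le> 1}}"
      using Y.nbhd0_scale_preimage[OF polar_nbhd[OF B]] unfolding nbhd0_def by blast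
    define U where "U = {x' \<in> topspace \<Omega>. \<delta> x' \<in> {y \<in> Y. - \<delta> x + y \<in> W}}"
    have "openin \<Omega> U"
      unfolding U_def using \<delta> x by (intro openin_continuous_map_preimage[OF \<delta>(2)] Y.open_translate W(1)) simp
    moreover have "x \<in> U" using x W(2) \<delta>(1) by (simp add: U_def)
    moreover have "norm (f y - f x) < e" if y: "y \<in> U" and f: "f \<in> B" for y f
    proof -
      have fF: "f \<in> F" and y': "y \<in> topspace \<Omega>" using f BF y by (auto simp: U_def)
      have "- \<delta> x + \<delta> y \<in> W" using y by (simp add: U_def)
      then have d: "\<delta> y - \<delta> x \<in> W" by simp
      then have "norm (T f (s (inverse (of_real c)) (\<delta> y - \<delta> x))) \<le> 1" using W(3) f by blast
      moreover have "\<delta> y - \<delta> x \<in> Y" using \<delta>(1) x y' by simp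
      ultimately have "norm (T f (\<delta> y - \<delta> x)) \<le> c"
        using Tlin(2)[OF fF] c by (simp add: norm_inverse_scale_le_1)
      moreover have "T f (\<delta> y - \<delta> x) = f y - f x"
        using Tlin(6)[OF fF] \<delta>(1) x y' T\<delta>[OF fF] by simp
      ultimately show ?thesis using c by simp
    qed
    ultimately show "\<exists>U. openin \<Omega> U \<and> x \<in> U \<and> (\<forall>y\<in>U. \<forall>f\<in>B. norm (f y - f x) < e)" by blast
  qed
  ultimately show ?thesis using W.lcH_pair by blast
qed

theorem theorem4p10:
  fixes \<Omega> :: "'a topology" and F :: "('a \<Rightarrow> 'k::real_normed_field) set"
    and \<tau> :: "('a \<Rightarrow> 'k) topology"
  assumes "Hausdorff_space \<Omega>" and "topspace \<Omega> \<noteq> {}"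
    and "cont_function_space \<Omega> F"
    and "lcH_space fscale F \<tau>" and "bornological fscale F \<tau>"
  defines "cond_b \<equiv> (\<exists>\<tau>'. lcH_space fscale F \<tau>' \<and> coarser (tau_p \<Omega> F) \<tau>'
              \<and> BBC F \<tau> \<tau>' \<and> CNC F \<tau> \<tau>'
              \<and> (\<forall>B. tvs_bounded fscale F \<tau> B \<longrightarrow> equicontinuous_on \<Omega> B))"
    and "cond_c \<equiv> (\<exists>\<tau>'. lcH_space fscale F \<tau>' \<and> BBC F \<tau> \<tau>' \<and> CNC F \<tau> \<tau>'
              \<and> (\<forall>x\<in>topspace \<Omega>. evalf F x \<in> Fprime_B F \<tau> \<tau>')
              \<and> continuous_map \<Omega> (beta_top F \<tau> \<tau>') (evalf F))"
    and "cond_d \<equiv> (\<exists>\<tau>'. lcH_space fscale F \<tau>' \<and> coarser (tau_co \<Omega> F) \<tau>'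
              \<and> BBC F \<tau> \<tau>' \<and> CNC F \<tau> \<tau>')"
  shows "(\<forall>(s :: 'k \<Rightarrow> 'y::ab_group_add \<Rightarrow> 'y) Y TY \<delta> T.
             cscb_linearisation \<Omega> F \<tau> s Y TY \<delta> T \<longrightarrow> cond_b)
       \<and> (cond_b \<longrightarrow> (\<exists>(s :: 'k \<Rightarrow> (('a \<Rightarrow> 'k) \<Rightarrow> 'k) \<Rightarrow> (('a \<Rightarrow> 'k) \<Rightarrow> 'k)) Y TY \<delta> T.
             cscb_linearisation \<Omega> F \<tau> s Y TY \<delta> T))
       \<and> (cond_b \<longleftrightarrow> cond_c)
       \<and> (gkR_space \<Omega> TYPE(('a \<Rightarrow> 'k) \<Rightarrow> 'k) \<longrightarrow> cond_d \<longrightarrow> cond_c)"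
proof -
  have loc: "bbc_cnc F \<tau> \<tau>'" if "lcH_space fscale F \<tau>'" "BBC F \<tau> \<tau>'" "CNC F \<tau> \<tau>'" for \<tau>'
    using that assms(4,5) by (simp add: bbc_cnc_def bbc_cnc_axioms_def lcs_def)
  have cont: "continuous_map \<Omega> euclidean f" if "f \<in> F" for f
    using assms(3) that by (simp add: cont_function_space_def)
  \<comment> \<open>The type \<open>'z\<close> is generalised, so the fact applies both to the
    arbitrary \<open>'y\<close> of the conclusion and to the functionals produced by
    \<open>ca\<close>; the latter use closes the circle from (c) to (b).\<close>
  have ab: cond_b if "cscb_linearisation \<Omega> F \<tau> s Y TY \<delta> T"
    for s :: "'k \<Rightarrow> 'z::ab_group_add \<Rightarrow> 'z" and Y TY \<delta> T
    unfolding cond_b_def by (rule linearisation_imp_bbc_cnc[OF assms(4) that])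
  have ca: "\<exists>(s :: 'k \<Rightarrow> (('a \<Rightarrow> 'k) \<Rightarrow> 'k) \<Rightarrow> (('a \<Rightarrow> 'k) \<Rightarrow> 'k)) Y TY \<delta> T.
             cscb_linearisation \<Omega> F \<tau> s Y TY \<delta> T" if cond_c
  proof -
    obtain \<tau>' where c: "lcH_space fscale F \<tau>'" "BBC F \<tau> \<tau>'" "CNC F \<tau> \<tau>'"
      "\<forall>x\<in>topspace \<Omega>. evalf F x \<in> Fprime_B F \<tau> \<tau>'" "continuous_map \<Omega> (beta_top F \<tau> \<tau>') (evalf F)"
      using \<open>cond_c\<close> unfolding cond_c_def by blast
    show ?thesis using bbc_cnc.cscb_linearisation_evalf[OF loc[OF c(1-3)], of \<Omega>] c(4,5) by blast
  qed
  have bc: cond_c if cond_b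
  proof -
    obtain \<tau>' where b: "lcH_space fscale F \<tau>'" "coarser (tau_p \<Omega> F) \<tau>'" "BBC F \<tau> \<tau>'" "CNC F \<tau> \<tau>'"
      "\<forall>B. tvs_bounded fscale F \<tau> B \<longrightarrow> equicontinuous_on \<Omega> B"
      using \<open>cond_b\<close> unfolding cond_b_def by blast
    interpret bbc_cnc F \<tau> \<tau>' by (rule loc[OF b(1,3,4)])
    have "\<forall>x\<in>topspace \<Omega>. evalf F x \<in> Y"
      using eval_in_Y continuous_map_eval_tau_p[OF b(2) E'.topspace_eq] by blast
    then show ?thesis using continuous_evaluation[of \<Omega>] b unfolding cond_c_def by blast
  qed
  have dc: cond_c if gkR: "gkR_space \<Omega> TYPE(('a \<Rightarrow> 'k) \<Rightarrow> 'k)" and cond_d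
  proof -
    obtain \<tau>' where d: "lcH_space fscale F \<tau>'" "coarser (tau_co \<Omega> F) \<tau>'" "BBC F \<tau> \<tau>'" "CNC F \<tau> \<tau>'"
      using \<open>cond_d\<close> unfolding cond_d_def by blast
    show ?thesis
      using continuous_evaluation_gkR[OF loc[OF d(1,3,4)] d(2) cont gkR] d unfolding cond_c_def by blast
  qed
  have cb: cond_b if cond_c using ca[OF that] ab by blast
  show ?thesis using ab ca bc cb dc by blast
qed

end
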